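(* Let $(X_k)_{k\in\mathbb{Z}}$ be a stationary reversible real-valued Markov chain whose marginal distribution has a density $f$. Let $H_k(u,v)=\mathbb{P}(X_0>u,X_k>v)-\mathbb{P}(X_0>u)\mathbb{P}(X_k>v)$ and $\eta_k=\int\int|H_k(u,v)|\,du\,dv$, and assume that $$\eta_k\le\frac{1}{k^4\,l(k)}\qquad\text{for all } k\ge1,$$ where $l$ is a positive function increasing to infinity which is slowly varying at infinity, i.e. $\lim_{x\to\infty}l(cx)/l(x)=1$ for every $c>0$. Let $(b_n)$ be a sequence of positive bandwidths with $b_n\to0$ and $nb_n^4\to\infty$. Let $K:\mathbb{R}\to[0,\infty)$ be a kernel (a probability density) satisfying: (C1) $K$ is symmetric, decreasing on $(0,\infty)$, and $\int K(u)\,du=1$; (C2) $x^2K(x)\to0$ as $x\to\infty$; (C3) $K$ is differentiable with $K'$ bounded. Let $$\hat f_n(x)=\frac{1}{nb_n}\sum_{k=1}^nK\Big(\frac{x-X_k}{b_n}\Big).$$ Let $x_1,\dots,x_m$ be distinct real points such that, for each $j$, $f$ is continuous at $x_j$ and $f(x_j)\ne0$. Assume that $(X_0,X_2)$ has a joint density $f_2$ which is locally bounded around each pair $(x_i,x_j)$, $1\le i,j\le m$: for each such pair there exist constants $M>0$ and $C_M$ (depending on $(x_i,x_j)$) such that $$\sup_{|a|<M,\ |b|<M}|f_2(x_i+a,x_j+b)|<C_M.$$ Then, as $n\to\infty$, $$\sqrt{nb_n}\left(\frac{\hat f_n(x_j)-\mathbb{E}\hat f_n(x_j)}{\big(\hat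 f_n(x_j)\int K^2(u)\,du\big)^{1/2}},\ 1\le j\le m\right)\Rightarrow N(0,I_m),$$ where $\Rightarrow$ denotes convergence in distribution and $I_m$ is the $m\times m$ identity matrix.
   Context: A stationary (strictly stationary) Markov chain $(X_k)_{k\in\mathbb{Z}}$ is reversible if $(X_0,X_1)$ and $(X_1,X_0)$ have the same distribution. On the event $\{\hat f_n(x_j)=0\}$ the corresponding ratio may be assigned an arbitrary value (e.g. $0$). *)

theory Defs
  imports "HOL-Probability.Probability"
begin

text \<open>Strict stationarity: all finite-dimensional distributions are invariant under time shifts.\<close>

definition stationary_process :: "'a measure \<Rightarrow> (int \<Rightarrow> 'a \<Rightarrow> real) \<Rightarrow> bool" where
  "stationary_process M X \<longleftrightarrow>
     (\<forall>k. X k \<in> borel_measurable M) \<and>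
     (\<forall>J h. finite J \<longrightarrow>
        distr M (PiM J (\<lambda>_. borel)) (\<lambda>\<omega>. \<lambda>i\<in>J. X (i + h) \<omega>) =
        distr M (PiM J (\<lambda>_. borel)) (\<lambda>\<omega>. \<lambda>i\<in>J. X i \<omega>))"

definition past_algebra :: "'a measure \<Rightarrow> (int \<Rightarrow> 'a \<Rightarrow> real) \<Rightarrow> int \<Rightarrow> 'a measure" where
  "past_algebra M X k =
     sigma (space M) (\<Union>j\<in>{..k}. {X j -` A \<inter> space M | A. A \<in> sets borel})"

text \<open>Markov property: conditionally on the whole past up to time \<open>k\<close>, the law of \<open>X (k + 1)\<close>
  depends on \<open>X k\<close> only.\<close>

definition markov_chain :: "'a measure \<Rightarrow> (int \<Rightarrow> 'a \<Rightarrow> real) \<Rightarrow> bool" where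
  "markov_chain M X \<longleftrightarrow>
     (\<forall>k. X k \<in> borel_measurable M) \<and>
     (\<forall>k. \<forall>A\<in>sets borel. AE \<omega> in M.
        real_cond_exp M (past_algebra M X k) (\<lambda>\<omega>. indicator A (X (k + 1) \<omega>)) \<omega> =
        real_cond_exp M (vimage_algebra (space M) (X k) borel)
          (\<lambda>\<omega>. indicator A (X (k + 1) \<omega>)) \<omega>)"

definition reversible :: "'a measure \<Rightarrow> (int \<Rightarrow> 'a \<Rightarrow> real) \<Rightarrow> bool" where
  "reversible M X \<longleftrightarrow>
     distr M (borel \<Otimes>\<^sub>M borel) (\<lambda>\<omega>. (X 0 \<omega>, X 1 \<omega>)) =
     distr M (borel \<Otimes>\<^sub>M borel) (\<lambda>\<omega>. (X 1 \<omega>, X 0 \<omega>))"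

definition H_fun :: "'a measure \<Rightarrow> (int \<Rightarrow> 'a \<Rightarrow> real) \<Rightarrow> nat \<Rightarrow> real \<Rightarrow> real \<Rightarrow> real" where
  "H_fun M X k u v =
     measure M {\<omega> \<in> space M. X 0 \<omega> > u \<and> X (int k) \<omega> > v} -
     measure M {\<omega> \<in> space M. X 0 \<omega> > u} * measure M {\<omega> \<in> space M. X (int k) \<omega> > v}"

text \<open>The coefficient is an extended nonnegative integral, so a divergent integral is \<open>\<infinity>\<close>
  (and not \<open>0\<close>, as it would be for the Bochner integral).\<close>

definition eta_coeff :: "'a measure \<Rightarrow> (int \<Rightarrow> 'a \<Rightarrow> real) \<Rightarrow> nat \<Rightarrow> ennreal" where
  "eta_coeff M X k = (\<integral>\<^sup>+u. (\<integral>\<^sup>+v. ennreal \<bar>H_fun M X k u v\<bar> \<partial>lborel) \<partial>lborel)"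

definition slowly_varying :: "(real \<Rightarrow> real) \<Rightarrow> bool" where
  "slowly_varying l \<longleftrightarrow> (\<forall>c>0. ((\<lambda>x. l (c * x) / l x) \<longlongrightarrow> 1) at_top)"

definition kernel_density_estimator ::
    "(real \<Rightarrow> real) \<Rightarrow> (nat \<Rightarrow> real) \<Rightarrow> (int \<Rightarrow> 'a \<Rightarrow> real) \<Rightarrow> nat \<Rightarrow> real \<Rightarrow> 'a \<Rightarrow> real" where
  "kernel_density_estimator K b X n x \<omega> =
     1 / (real n * b n) * (\<Sum>k=1..n. K ((x - X (int k) \<omega>) / b n))"

text \<open>The value \<open>c\<close> is used for the ratio where the estimator vanishes.\<close>

definition studentized_estimator ::
    "real \<Rightarrow> 'a measure \<Rightarrow> (real \<Rightarrow> real) \<Rightarrow> (nat \<Rightarrow> real) \<Rightarrow> (int \<Rightarrow> 'a \<Rightarrow> real) \<Rightarrow>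
     nat \<Rightarrow> real \<Rightarrow> 'a \<Rightarrow> real" where
  "studentized_estimator c M K b X n x \<omega> =
     (let fhat = kernel_density_estimator K b X n x in
      if fhat \<omega> = 0 then c
      else (fhat \<omega> - (\<integral>\<omega>'. fhat \<omega>' \<partial>M)) / sqrt (fhat \<omega> * (\<integral>u. (K u)\<^sup>2 \<partial>lborel)))"

text \<open>The normal law with mean vector \<open>\<mu>\<close> and covariance matrix \<open>S\<close>; meaningful for
  symmetric positive definite \<open>S\<close> only.\<close>

definition multivariate_normal :: "real^'m \<Rightarrow> real^'m^'m \<Rightarrow> (real^'m) measure" where
  "multivariate_normal \<mu> S = density lborel (\<lambda>z. ennreal
     (exp (- ((z - \<mu>) \<bullet> (matrix_inv S *v (z - \<mu>))) / 2) / sqrt ((2 * pi) ^ CARD('m) * det S)))"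

text \<open>Convergence in distribution of Borel random elements \<open>Y n\<close> to a law \<open>N\<close>, by bounded
  continuous test functions; the library's \<open>weak_conv_m\<close> covers only the real line.\<close>

definition converges_in_distribution ::
    "'a measure \<Rightarrow> (nat \<Rightarrow> 'a \<Rightarrow> 'b::topological_space) \<Rightarrow> 'b measure \<Rightarrow> bool" where
  "converges_in_distribution M Y N \<longleftrightarrow>
     (\<forall>n. Y n \<in> borel_measurable M) \<and>
     (\<forall>g::'b \<Rightarrow> real. continuous_on UNIV g \<and> bounded (range g) \<longrightarrow>
        (\<lambda>n. \<integral>z. g z \<partial>distr M borel (Y n)) \<longlonglongrightarrow> (\<integral>z. g z \<partial>N))"

end

theory Submission
  imports Defs
begin

text \<open>
Let \<open>Q\<close> be the transition operator and let \<open>G\<close> be a linear combination of the centred and rescaled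
kernels at the points \<open>x j\<close>. Then
\<open>\<Sum> G(X k) = \<Sum> (G(X k) - QG(X (k - 1))) + \<Sum> QG(X (k - 1))\<close>.
By reversibility the lag-\<open>k\<close> covariance of \<open>QG(X)\<close> is the lag-\<open>(k+2)\<close> covariance of \<open>G(X)\<close>. These covariances
are all dominated by the one at lag 2, which is \<open>O(b)\<close> because \<open>(X 0, X 2)\<close> has a locally bounded density;
by Hoeffding's covariance formula they are also at most a constant times \<open>b\<^bsup>-3\<^esup>\<close> times the mixing coefficient.
Cutting at lags of order \<open>1/b\<close> shows that they sum to \<open>o(1)\<close>, so the second sum is negligible in \<open>L\<^sup>2\<close>. The first
is a martingale with uniformly small increments, to which McLeish's argument applies; the law of large
numbers for \<open>G\<^sup>2\<close> is where \<open>n b\<^sup>4 \<rightarrow> \<infinity>\<close> enters.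
\<close>

section \<open>Convergence in distribution to the standard Gaussian law\<close>

text \<open>Lag 1 is the obstacle: nothing is assumed about a joint density of \<open>X 0\<close>
  and \<open>X 1\<close>, and the lag-one covariance of \<open>G\<close> is only compared with the
  variance. The martingale part absorbs it, because \<open>QG\<close> sees lags from 2 on. All
  exponents count derivatives: \<open>G\<close> is of order b^(-1/2) and each derivative costs 1/b.
  Thus |G'|^2 is of order b^(-3); with the cut at \<delta>/b the early lags contribute order
  \<delta>, and the tail, b^(-3) times the sum of 1/(k^4 l(k)), at most order 1/(\<delta>^3
  l(\<delta>/b)), so the growth of \<open>l\<close> settles the critical case. Likewise (G^2)' is of
  order b^(-2), its covariances are of order b^(-4), and averaging over n observations leaves 1/(n
  b^4). The vector statement is reached through characteristic functions of linear combinations; the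
  random denominator is exchanged for its limit by an L^1 estimate that rests on the L^2 consistency
  of the estimator.\<close>

definition gauss_density :: "'b::euclidean_space \<Rightarrow> real" where
  "gauss_density z = exp (- (norm z)\<^sup>2 / 2) / sqrt ((2 * pi) ^ DIM('b))"

text \<open>Set on an arbitrary Euclidean space, without determinants or inverse matrices; at
  \<open>real^'m\<close> it is the limit law of the theorem.\<close>

definition gauss_measure :: "'b::euclidean_space measure" where
  "gauss_measure = density lborel (\<lambda>z. ennreal (gauss_density z))"

lemma gauss_density_nonneg [simp]: "0 \<le> gauss_density z"
  by (simp add: gauss_density_def)

lemma gauss_density_le_0: "gauss_density z \<le> gauss_density (0::'b)" for z :: "'b::euclidean_space"
  by (simp add: gauss_density_def divide_right_mono)

lemma continuous_on_gauss_density: "continuous_on UNIV gauss_density"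
  unfolding gauss_density_def[abs_def] by (intro continuous_intros) auto

lemma borel_measurable_gauss_density [measurable]:
  "gauss_density \<in> borel_measurable borel"
  by (rule borel_measurable_continuous_onI[OF continuous_on_gauss_density])

lemma sets_gauss_measure [simp, measurable_cong]: "sets gauss_measure = sets borel"
  and space_gauss_measure [simp]: "space gauss_measure = UNIV"
  by (simp_all add: gauss_measure_def)

section \<open>The characteristic function of the Gaussian law\<close>

lemma norm_sq_Basis: "(norm z)\<^sup>2 = (\<Sum>b\<in>Basis. (z \<bullet> b)\<^sup>2)" for z :: "'b::euclidean_space"
  by (subst power2_norm_eq_inner, subst euclidean_inner) (simp add: power2_eq_square)

text \<open>The squared norm is a sum over the orthonormal basis, so the exponential factorises.
  Total mass and characteristic function thereby reduce to one dimension.\<close>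

lemma gauss_density_prod:
  "gauss_density z = (\<Prod>b\<in>Basis. std_normal_density (z \<bullet> b))" for z :: "'b::euclidean_space"
proof -
  have "(\<Prod>b\<in>Basis. std_normal_density (z \<bullet> b)) =
      (\<Prod>b\<in>(Basis::'b set). 1 / sqrt (2 * pi)) * exp (\<Sum>b\<in>Basis. - (z \<bullet> b)\<^sup>2 / 2)"
    by (simp only: std_normal_density_def prod.distrib exp_sum[OF finite_Basis])
  also have "(\<Sum>b\<in>Basis. - (z \<bullet> b)\<^sup>2 / 2) = - (norm z)\<^sup>2 / 2"
    by (simp add: norm_sq_Basis sum_negf sum_divide_distrib)
  finally show ?thesis
    by (simp only: gauss_density_def prod_constant real_sqrt_power power_one_over) simp
qed

lemma prob_space_gauss_measure: "prob_space (gauss_measure :: 'b::euclidean_space measure)"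
proof
  have "emeasure (gauss_measure :: 'b measure) (space gauss_measure) =
      (\<integral>\<^sup>+z. (\<Prod>b\<in>(Basis::'b set). ennreal (std_normal_density (z \<bullet> b))) \<partial>lborel)"
    by (simp add: gauss_measure_def emeasure_density gauss_density_prod prod_ennreal)
  also have "\<dots> = (\<Prod>b\<in>(Basis::'b set). \<integral>\<^sup>+x. ennreal (std_normal_density x) \<partial>lborel)"
    by (rule nn_integral_lborel_prod[of "\<lambda>_ x. ennreal (std_normal_density x)"]) auto
  also have "(\<integral>\<^sup>+x. ennreal (std_normal_density x) \<partial>lborel) = 1"
    by (subst nn_integral_eq_integral) auto
  finally show "emeasure (gauss_measure :: 'b measure) (space gauss_measure) = 1" by simp
qed

interpretation gauss: prob_space "gauss_measure :: 'b::euclidean_space measure"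
  by (rule prob_space_gauss_measure)

lemma borel_measurable_cis [measurable]: "cis \<in> borel_measurable borel"
  by (rule borel_measurable_continuous_onI) (intro continuous_intros)

lemma integral_std_normal_cis:
  "(\<integral>x. std_normal_density x *\<^sub>R cis (u * x) \<partial>lborel) = of_real (exp (- u\<^sup>2 / 2))"
proof -
  have "(\<integral>x. std_normal_density x *\<^sub>R cis (u * x) \<partial>lborel) = char std_normal_distribution u"
    by (simp add: char_def cis_conv_exp integral_density mult.commute)
  then show ?thesis by (simp add: char_std_normal_distribution)
qed

text \<open>\<open>lborel\<close> is an image of the product of one-dimensional Lebesgue measures,
  so the integral of a product over coordinates is a product of integrals, each a value of
  \<open>char std_normal_distribution\<close>.\<close>

lemma integral_gauss_cis:
  fixes t :: "'b::euclidean_space"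
  shows "(\<integral>w. cis (t \<bullet> w) \<partial>gauss_measure) = of_real (exp (- (norm t)\<^sup>2 / 2))"
proof -
  interpret product_sigma_finite "\<lambda>_::'b. lborel :: real measure" ..
  have cis_sum: "cis (\<Sum>b\<in>A. h b) = (\<Prod>b\<in>A. cis (h b))" if "finite A" for A :: "'b set" and h
    using that by (induction A) (auto simp: cis_mult[symmetric])
  let ?e = "\<lambda>f. \<Sum>b\<in>Basis. f b *\<^sub>R (b::'b)"
  have [simp]: "?e f \<bullet> b = f b" if "b \<in> Basis" for f b
    using that by (simp add: inner_sum_left inner_Basis if_distrib sum.delta' cong: if_cong)
  have "(\<integral>w. cis (t \<bullet> w) \<partial>gauss_measure) = (\<integral>w. gauss_density w *\<^sub>R cis (t \<bullet> w) \<partial>lborel)"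
    unfolding gauss_measure_def by (subst integral_density) auto
  also have "\<dots> = (\<integral>f. gauss_density (?e f) *\<^sub>R cis (t \<bullet> ?e f) \<partial>(\<Pi>\<^sub>M b\<in>Basis. lborel))"
    by (subst lborel_eq, subst integral_distr) auto
  also have "\<dots> = (\<integral>f. (\<Prod>b\<in>Basis. std_normal_density (f b) *\<^sub>R cis ((t \<bullet> b) * f b)) \<partial>(\<Pi>\<^sub>M b\<in>(Basis::'b set). lborel))"
  proof (intro Bochner_Integration.integral_cong refl)
    fix f :: "'b \<Rightarrow> real"
    have "t \<bullet> ?e f = (\<Sum>b\<in>Basis. (t \<bullet> b) * f b)"
      by (simp add: inner_sum_right mult.commute)
    then show "gauss_density (?e f) *\<^sub>R cis (t \<bullet> ?e f) = (\<Prod>b\<in>Basis. std_normal_density (f b) *\<^sub>R cis ((t \<bullet> b) * f b))"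
      by (simp add: gauss_density_prod cis_sum scaleR_conv_of_real prod.distrib)
  qed
  also have "\<dots> = (\<Prod>b\<in>(Basis::'b set). \<integral>x. std_normal_density x *\<^sub>R cis ((t \<bullet> b) * x) \<partial>lborel)"
  proof (rule product_integral_prod)
    show "integrable lborel (\<lambda>x. std_normal_density x *\<^sub>R cis ((t \<bullet> b) * x))" for b
    proof (rule Bochner_Integration.integrable_bound[OF integrable_normal_density[where \<mu>=0 and \<sigma>=1]])
      show "(\<lambda>x. std_normal_density x *\<^sub>R cis ((t \<bullet> b) * x)) \<in> borel_measurable lborel" by measurable
    qed auto
  qed auto
  also have "\<dots> = (\<Prod>b\<in>(Basis::'b set). of_real (exp (- (t \<bullet> b)\<^sup>2 / 2)))"
    by (simp add: integral_std_normal_cis)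
  also have "\<dots> = of_real (exp (\<Sum>b\<in>Basis. - (t \<bullet> b)\<^sup>2 / 2))"
    by (simp add: exp_sum)
  also have "(\<Sum>b\<in>Basis. - (t \<bullet> b)\<^sup>2 / 2) = - (norm t)\<^sup>2 / 2"
    by (simp add: norm_sq_Basis sum_negf sum_divide_distrib)
  finally show ?thesis .
qed

section \<open>Smoothing by convolution with a Gaussian of scale \<open>s\<close>\<close>

abbreviation gauss_smooth :: "real \<Rightarrow> ('b::euclidean_space \<Rightarrow> real) \<Rightarrow> 'b \<Rightarrow> real" where
  "gauss_smooth s g y \<equiv> (\<integral>w. g (y + s *\<^sub>R w) \<partial>gauss_measure)"

text \<open>Substitution z = y + s w. The Jacobian stays as an explicit factor and is divided out
  only after the limit in \<open>n\<close> has been taken.\<close>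

lemma gauss_density_mollify:
  fixes g :: "'b::euclidean_space \<Rightarrow> real"
  assumes [measurable]: "g \<in> borel_measurable borel" and "s > 0"
  shows "(\<integral>z. g z * gauss_density ((z - y) /\<^sub>R s) \<partial>lborel) =
    s ^ DIM('b) * gauss_smooth s g y"
proof -
  have "(\<integral>z. g z * gauss_density ((z - y) /\<^sub>R s) \<partial>lborel) =
     (\<integral>z. g z * gauss_density ((z - y) /\<^sub>R s) \<partial>density (distr lborel borel (\<lambda>x. y + s *\<^sub>R x)) (\<lambda>_. ennreal (\<bar>s\<bar> ^ DIM('b))))"
    using \<open>s > 0\<close> lborel_affine[of s y] by (simp add: ennreal_power)
  also have "\<dots> = (\<integral>w. s ^ DIM('b) * (gauss_density w * g (y + s *\<^sub>R w)) \<partial>lborel)"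
    using \<open>s > 0\<close> by (subst integral_density) (auto simp: integral_distr mult_ac)
  also have "\<dots> = s ^ DIM('b) * gauss_smooth s g y"
    unfolding gauss_measure_def by (subst integral_density) auto
  finally show ?thesis .
qed

text \<open>Rewriting the Gaussian density itself as a Fourier integral expresses the density of a
  Gaussian perturbation through the characteristic function of the perturbed law.\<close>

abbreviation gauss_conv :: "real \<Rightarrow> 'b::euclidean_space measure \<Rightarrow> 'b \<Rightarrow> real" where
  "gauss_conv s N z \<equiv> (\<integral>y. gauss_density ((z - y) /\<^sub>R s) \<partial>N)"

lemma gauss_density_fourier:
  fixes N :: "'b::euclidean_space measure"
  assumes "prob_space N" and [measurable_cong]: "sets N = sets borel"
  shows "complex_of_real (gauss_conv s N z) =
    gauss_density (0::'b) *\<^sub>R (\<integral>w. cis ((z /\<^sub>R s) \<bullet> w) * (\<integral>y. cis ((- w /\<^sub>R s) \<bullet> y) \<partial>N) \<partial>gauss_measure)"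
proof -
  interpret N: prob_space N by fact
  interpret P: pair_prob_space N "gauss_measure :: 'b measure" ..
  \<comment> \<open>The Gaussian integral read backwards: exp(-|u|^2/2) is itself a characteristic
    function. A value of the density thus becomes a Fourier integral without any inversion
    theorem.\<close>
  have gd: "complex_of_real (gauss_density u) = gauss_density (0::'b) *\<^sub>R (\<integral>w. cis (u \<bullet> w) \<partial>gauss_measure)" for u :: 'b
    unfolding integral_gauss_cis by (simp add: gauss_density_def scaleR_conv_of_real)
  have "complex_of_real (gauss_conv s N z) = (\<integral>y. complex_of_real (gauss_density ((z - y) /\<^sub>R s)) \<partial>N)"
    by simp
  also have "\<dots> = gauss_density (0::'b) *\<^sub>R (\<integral>y. (\<integral>w. cis (((z - y) /\<^sub>R s) \<bullet> w) \<partial>gauss_measure) \<partial>N)"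
    unfolding gd by simp
  also have "(\<integral>y. (\<integral>w. cis (((z - y) /\<^sub>R s) \<bullet> w) \<partial>gauss_measure) \<partial>N) =
      (\<integral>w. (\<integral>y. cis (((z - y) /\<^sub>R s) \<bullet> w) \<partial>N) \<partial>gauss_measure)"
  proof (rule P.Fubini_integral[symmetric])
    show "integrable (N \<Otimes>\<^sub>M gauss_measure) (\<lambda>(y, w). cis (((z - y) /\<^sub>R s) \<bullet> w))"
      by (rule P.integrable_const_bound[of _ 1]) (auto simp: split_beta)
  qed
  also have "\<dots> = (\<integral>w. cis ((z /\<^sub>R s) \<bullet> w) * (\<integral>y. cis ((- w /\<^sub>R s) \<bullet> y) \<partial>N) \<partial>gauss_measure)"
  proof (intro Bochner_Integration.integral_cong refl)
    fix w :: 'b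
    have "cis (((z - y) /\<^sub>R s) \<bullet> w) = cis ((z /\<^sub>R s) \<bullet> w) * cis ((- w /\<^sub>R s) \<bullet> y)" for y
      by (simp add: cis_mult inner_diff_left right_diff_distrib inner_commute[of _ w] inner_diff_right)
    then show "(\<integral>y. cis (((z - y) /\<^sub>R s) \<bullet> w) \<partial>N) = cis ((z /\<^sub>R s) \<bullet> w) * (\<integral>y. cis ((- w /\<^sub>R s) \<bullet> y) \<partial>N)"
      by simp
  qed
  finally show ?thesis .
qed

text \<open>Smoothing is self-adjoint: Fubini moves the Gaussian from the law to the test function.
  The bounded support in \<open>gB\<close> makes the integrand integrable against the infinite
  Lebesgue measure.\<close>

lemma gauss_mollified_integral:
  fixes N :: "'b::euclidean_space measure" and g :: "'b \<Rightarrow> real"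
  assumes "prob_space N" and [measurable_cong]: "sets N = sets borel"
    and [measurable]: "g \<in> borel_measurable borel"
    and gB: "\<And>z. \<bar>g z\<bar> \<le> B * indicator (cball 0 R) z" and "s > 0"
  shows "(\<integral>z. g z * gauss_conv s N z \<partial>lborel) =
    s ^ DIM('b) * (\<integral>y. gauss_smooth s g y \<partial>N)"
proof -
  interpret N: prob_space N by fact
  interpret P: pair_sigma_finite N "lborel :: 'b measure" ..
  have "emeasure lborel (cball (0::'b) R) < \<infinity>" by (rule emeasure_lborel_cball_finite)
  then have intI: "integrable lborel (indicator (cball (0::'b) R) :: 'b \<Rightarrow> real)"
    by simp
  have int1: "integrable (N \<Otimes>\<^sub>M lborel) (\<lambda>p. B * gauss_density (0::'b) * (indicator (cball (0::'b) R) (snd p) :: real))"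
    by (rule P.Fubini_integrable) (use intI in \<open>auto simp: split_beta\<close>)
  have int: "integrable (N \<Otimes>\<^sub>M lborel) (\<lambda>(y, z). g z * gauss_density ((z - y) /\<^sub>R s))"
  proof (rule Bochner_Integration.integrable_bound[OF int1])
    show "(\<lambda>(y, z). g z * gauss_density ((z - y) /\<^sub>R s)) \<in> borel_measurable (N \<Otimes>\<^sub>M lborel)"
      by measurable
    have "norm (g z * gauss_density ((z - y) /\<^sub>R s)) \<le> (B * indicator (cball 0 R) z) * gauss_density (0::'b)" for y z
      using gB[of z] gauss_density_le_0[of "(z - y) /\<^sub>R s"] by (simp only: real_norm_def abs_mult) (intro mult_mono, auto)
    then show "AE x in N \<Otimes>\<^sub>M lborel. norm (case x of (y, z) \<Rightarrow> g z * gauss_density ((z - y) /\<^sub>R s))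
       \<le> norm (B * gauss_density (0::'b) * (indicator (cball (0::'b) R) (snd x) :: real))"
      by (auto simp: mult_ac intro!: order_trans[OF _ abs_ge_self])
  qed
  have "(\<integral>z. g z * gauss_conv s N z \<partial>lborel) = (\<integral>z. (\<integral>y. g z * gauss_density ((z - y) /\<^sub>R s) \<partial>N) \<partial>lborel)"
    by simp
  also have "\<dots> = (\<integral>y. (\<integral>z. g z * gauss_density ((z - y) /\<^sub>R s) \<partial>lborel) \<partial>N)"
    by (rule P.Fubini_integral[OF int])
  also have "\<dots> = s ^ DIM('b) * (\<integral>y. gauss_smooth s g y \<partial>N)"
    using \<open>s > 0\<close> by (simp add: gauss_density_mollify)
  finally show ?thesis .
qed

text \<open>In the Fourier representation of the smoothed density only the characteristic function
  of \<open>N n\<close> depends on \<open>n\<close>, and its modulus is at most 1; dominated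
  convergence gives the smoothed densities pointwise. They are bounded by
  \<open>gauss_density 0\<close>, so a second dominated convergence over the ball of radius
  \<open>R\<close> gives the integrals.\<close>

lemma gauss_mollified_tendsto:
  fixes N :: "nat \<Rightarrow> 'b::euclidean_space measure" and g :: "'b \<Rightarrow> real"
  assumes N: "\<And>n. prob_space (N n)" "\<And>n. sets (N n) = sets borel"
    and char: "\<And>t. (\<lambda>n. \<integral>y. cis (t \<bullet> y) \<partial>N n) \<longlonglongrightarrow> of_real (exp (- (norm t)\<^sup>2 / 2))"
    and g[measurable]: "g \<in> borel_measurable borel"
    and gB: "\<And>z. \<bar>g z\<bar> \<le> B * indicator (cball 0 R) z" and "s > 0"
  shows "(\<lambda>n. \<integral>y. gauss_smooth s g y \<partial>N n) \<longlonglongrightarrow>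
    (\<integral>y. gauss_smooth s g y \<partial>gauss_measure)"
proof -
  have cis_m[measurable]: "(\<lambda>w. \<integral>y. cis ((- w /\<^sub>R s) \<bullet> y) \<partial>Q) \<in> borel_measurable borel"
    if "prob_space Q" and [measurable_cong]: "sets Q = sets borel" for Q :: "'b measure"
  proof -
    interpret Q: prob_space Q by fact
    show ?thesis by measurable
  qed
  have dens_m[measurable]: "(\<lambda>z. gauss_conv s Q z) \<in> borel_measurable borel"
    if "prob_space Q" and [measurable_cong]: "sets Q = sets borel" for Q :: "'b measure"
  proof -
    interpret Q: prob_space Q by fact
    show ?thesis by measurable
  qed
  have cis_le: "cmod (\<integral>y. cis (u \<bullet> y) \<partial>Q) \<le> 1" if "prob_space Q" for Q :: "'b measure" and u :: 'b
  proof -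
    interpret Q: prob_space Q by fact
    have "cmod (\<integral>y. cis (u \<bullet> y) \<partial>Q) \<le> (\<integral>y. cmod (cis (u \<bullet> y)) \<partial>Q)" by (rule integral_norm_bound)
    then show ?thesis by (simp add: Q.prob_space)
  qed
  have char': "(\<lambda>n. \<integral>y. cis (t \<bullet> y) \<partial>N n) \<longlonglongrightarrow> (\<integral>y. cis (t \<bullet> y) \<partial>gauss_measure)" for t
    using char[of t] by (simp add: integral_gauss_cis)
  have ptw: "(\<lambda>n. gauss_conv s (N n) z) \<longlonglongrightarrow> gauss_conv s gauss_measure z" for z :: 'b
  proof -
    have "(\<lambda>n. complex_of_real (gauss_conv s (N n) z)) \<longlonglongrightarrow>
        complex_of_real (gauss_conv s gauss_measure z)"
      unfolding gauss_density_fourier[OF N] gauss_density_fourier[OF prob_space_gauss_measure sets_gauss_measure]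
    proof (intro tendsto_scaleR tendsto_const integral_dominated_convergence[where w="\<lambda>_. 1"] AE_I2)
      show "(\<lambda>w. cis ((z /\<^sub>R s) \<bullet> w) * (\<integral>y. cis ((- w /\<^sub>R s) \<bullet> y) \<partial>gauss_measure)) \<in> borel_measurable gauss_measure"
        using cis_m[OF prob_space_gauss_measure sets_gauss_measure] by measurable
      show "(\<lambda>w. cis ((z /\<^sub>R s) \<bullet> w) * (\<integral>y. cis ((- w /\<^sub>R s) \<bullet> y) \<partial>N n)) \<in> borel_measurable gauss_measure" for n
        using cis_m[OF N, of n] by measurable
      show "(\<lambda>n. cis ((z /\<^sub>R s) \<bullet> w) * (\<integral>y. cis ((- w /\<^sub>R s) \<bullet> y) \<partial>N n)) \<longlonglongrightarrow>
          cis ((z /\<^sub>R s) \<bullet> w) * (\<integral>y. cis ((- w /\<^sub>R s) \<bullet> y) \<partial>gauss_measure)" for w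
        by (intro tendsto_mult tendsto_const char')
      show "cmod (cis ((z /\<^sub>R s) \<bullet> w) * (\<integral>y. cis ((- w /\<^sub>R s) \<bullet> y) \<partial>N n)) \<le> 1" for n w
        using cis_le[OF N(1), of n "- w /\<^sub>R s"] by (simp add: norm_mult)
    qed simp
    then show ?thesis by (simp only: tendsto_of_real_iff)
  qed
  have dens_le: "gauss_conv s Q z \<le> gauss_density (0::'b)"
    if "prob_space Q" "sets Q = sets borel" for Q :: "'b measure" and z
  proof -
    interpret Q: prob_space Q by fact
    note that(2)[measurable_cong]
    have "gauss_conv s Q z \<le> (\<integral>y. gauss_density (0::'b) \<partial>Q)"
      by (intro integral_mono Q.integrable_const_bound[of _ "gauss_density (0::'b)"])
         (auto simp: gauss_density_le_0)
    then show ?thesis by (simp add: Q.prob_space)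
  qed
  have "(\<lambda>n. \<integral>z. g z * gauss_conv s (N n) z \<partial>lborel) \<longlonglongrightarrow>
     (\<integral>z. g z * gauss_conv s gauss_measure z \<partial>lborel)"
  proof (intro integral_dominated_convergence[where w="\<lambda>z. B * indicator (cball 0 R) z * gauss_density (0::'b)"] AE_I2)
    show "integrable lborel (\<lambda>z. B * indicator (cball 0 R) z * gauss_density (0::'b))"
      by (intro integrable_mult_left integrable_mult_right integrable_real_indicator)
         (use emeasure_lborel_cball_finite in auto)
    show "(\<lambda>n. g z * gauss_conv s (N n) z) \<longlonglongrightarrow> g z * gauss_conv s gauss_measure z" for z
      by (intro tendsto_mult tendsto_const ptw)
    show "norm (g z * gauss_conv s (N n) z) \<le> B * indicator (cball 0 R) z * gauss_density (0::'b)" for n z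
      using gB[of z] dens_le[OF N, of n z] order_trans[OF abs_ge_zero gB[of z]]
      by (simp only: real_norm_def abs_mult) (intro mult_mono, auto)
    show "(\<lambda>z. g z * gauss_conv s (N n) z) \<in> borel_measurable lborel" for n
      using dens_m[OF N, of n] by measurable
    show "(\<lambda>z. g z * gauss_conv s gauss_measure z) \<in> borel_measurable lborel"
      using dens_m[OF prob_space_gauss_measure sets_gauss_measure] by measurable
  qed
  then have "(\<lambda>n. s ^ DIM('b) * (\<integral>y. gauss_smooth s g y \<partial>N n)) \<longlonglongrightarrow>
     s ^ DIM('b) * (\<integral>y. gauss_smooth s g y \<partial>gauss_measure)"
    unfolding gauss_mollified_integral[OF N g gB \<open>s > 0\<close>]
      gauss_mollified_integral[OF prob_space_gauss_measure sets_gauss_measure g gB \<open>s > 0\<close>] .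
  then have "(\<lambda>n. (s ^ DIM('b) * (\<integral>y. gauss_smooth s g y \<partial>N n)) / s ^ DIM('b)) \<longlonglongrightarrow>
     (s ^ DIM('b) * (\<integral>y. gauss_smooth s g y \<partial>gauss_measure)) / s ^ DIM('b)"
    using \<open>s > 0\<close> by (intro tendsto_divide tendsto_const) auto
  then show ?thesis using \<open>s > 0\<close> by simp
qed

section \<open>From smoothed test functions to all bounded continuous ones\<close>

lemma tendsto_approximable:
  fixes a :: "nat \<Rightarrow> real"
  assumes "\<And>\<epsilon>. \<epsilon> > 0 \<Longrightarrow> \<exists>a' l'. a' \<longlonglongrightarrow> l' \<and> (\<forall>n. \<bar>a n - a' n\<bar> \<le> \<epsilon>) \<and> \<bar>l - l'\<bar> \<le> \<epsilon>"
  shows "a \<longlonglongrightarrow> l"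
proof (rule LIMSEQ_I)
  fix r :: real assume "r > 0"
  obtain a' l' where a: "a' \<longlonglongrightarrow> l'" "\<And>n. \<bar>a n - a' n\<bar> \<le> r / 4" "\<bar>l - l'\<bar> \<le> r / 4"
    using assms[of "r / 4"] \<open>r > 0\<close> by auto
  obtain n0 where n0: "\<And>n. n \<ge> n0 \<Longrightarrow> \<bar>a' n - l'\<bar> < r / 4"
    using LIMSEQ_D[OF a(1), of "r / 4"] \<open>r > 0\<close> by auto
  have "norm (a n - l) < r" if "n \<ge> n0" for n
    using n0[OF that] a(2)[of n] a(3) unfolding real_norm_def by linarith
  then show "\<exists>n0. \<forall>n\<ge>n0. norm (a n - l) < r" by blast
qed

text \<open>The displacement s w is split at size \<delta>: uniform continuity handles the small
  ones, the Gaussian tail together with the bound \<open>B\<close> the large ones.\<close>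

lemma gauss_mollifier_approx:
  fixes g :: "'b::euclidean_space \<Rightarrow> real"
  assumes cont: "continuous_on UNIV g" and gB: "\<And>z. \<bar>g z\<bar> \<le> B"
    and uc: "uniformly_continuous_on UNIV g" and "\<epsilon> > 0"
  shows "\<exists>s>0. \<forall>y. \<bar>g y - gauss_smooth s g y\<bar> \<le> \<epsilon>"
proof -
  have [measurable]: "g \<in> borel_measurable borel" by (rule borel_measurable_continuous_onI[OF cont])
  have "B \<ge> 0" using gB[of 0] by linarith
  obtain \<delta> where \<delta>: "\<delta> > 0" "\<And>x y. dist x y < \<delta> \<Longrightarrow> \<bar>g x - g y\<bar> < \<epsilon> / 2"
    using uc \<open>\<epsilon> > 0\<close> unfolding uniformly_continuous_on_def dist_real_def
    by (metis UNIV_I half_gt_zero_iff)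
  have "(\<lambda>k. \<integral>w. indicator {w. norm w \<ge> \<delta> * real (Suc k)} w \<partial>(gauss_measure::'b measure)) \<longlonglongrightarrow> (\<integral>w. 0 \<partial>(gauss_measure::'b measure) :: real)"
  proof (intro integral_dominated_convergence[where w="\<lambda>_. 1"] AE_I2)
    fix w :: 'b
    obtain k0 :: nat where "norm w / \<delta> < real k0" using reals_Archimedean2 by blast
    have "norm w < \<delta> * real (Suc k)" if "k \<ge> k0" for k
    proof -
      have "norm w < \<delta> * real k0"
        using \<open>norm w / \<delta> < real k0\<close> \<delta>(1) by (simp add: divide_less_eq mult.commute)
      also have "\<dots> \<le> \<delta> * real (Suc k)" using that \<delta>(1) by (intro mult_left_mono) auto
      finally show ?thesis .
    qed
    then show "(\<lambda>k. indicator {w. norm w \<ge> \<delta> * real (Suc k)} w :: real) \<longlonglongrightarrow> 0"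
      by (intro tendsto_eventually eventually_sequentiallyI[of k0]) (auto simp: indicator_def not_le)
  qed (auto simp: indicator_def)
  \<comment> \<open>Large displacements cost at most 2B times the tail mass, which this choice keeps
    below \<epsilon>/2; the added 1 covers B = 0.\<close>
  moreover have "(\<epsilon> / (4 * B + 1)) > 0" using \<open>\<epsilon> > 0\<close> \<open>B \<ge> 0\<close> by simp
  ultimately obtain k where "norm ((\<integral>w. indicator {w. norm w \<ge> \<delta> * real (Suc k)} w \<partial>(gauss_measure::'b measure)) - (\<integral>w. 0 \<partial>(gauss_measure::'b measure) :: real)) < \<epsilon> / (4 * B + 1)"
    by (meson LIMSEQ_D order_refl)
  then have k: "(\<integral>w. indicator {w. norm w \<ge> \<delta> * real (Suc k)} w \<partial>(gauss_measure::'b measure)) < \<epsilon> / (4 * B + 1)"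
    by (simp only: integral_zero diff_zero real_norm_def abs_less_iff)
  \<comment> \<open>With this scale, |s w| < \<delta> holds exactly when w lies outside the tail set
    just chosen.\<close>
  define s where "s = 1 / real (Suc k)"
  have "s > 0" by (simp add: s_def)
  have "\<bar>g y - gauss_smooth s g y\<bar> \<le> \<epsilon>" for y
  proof -
    have int: "integrable gauss_measure (\<lambda>w. g (y + s *\<^sub>R w))"
      by (rule gauss.integrable_const_bound[of _ B]) (auto simp: gB)
    have intI: "integrable gauss_measure (\<lambda>w::'b. indicator {w. norm w \<ge> \<delta> * real (Suc k)} w :: real)"
      by (rule gauss.integrable_const_bound[of _ 1]) (auto simp: indicator_def)
    have "\<bar>g y - gauss_smooth s g y\<bar> = \<bar>\<integral>w. g y - g (y + s *\<^sub>R w) \<partial>gauss_measure\<bar>"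
      using int gauss.prob_space[where 'b='b] by simp
    also have "\<dots> \<le> (\<integral>w. \<bar>g y - g (y + s *\<^sub>R w)\<bar> \<partial>gauss_measure)" by (rule integral_abs_bound)
    also have "\<dots> \<le> (\<integral>w. \<epsilon> / 2 + 2 * B * indicator {w. norm w \<ge> \<delta> * real (Suc k)} w \<partial>(gauss_measure :: 'b measure))"
    proof (rule integral_mono)
      fix w :: 'b
      show "\<bar>g y - g (y + s *\<^sub>R w)\<bar> \<le> \<epsilon> / 2 + 2 * B * indicator {w. norm w \<ge> \<delta> * real (Suc k)} w"
      proof (cases "norm w \<ge> \<delta> * real (Suc k)")
        case True
        then show ?thesis using gB[of y] gB[of "y + s *\<^sub>R w"] \<open>\<epsilon> > 0\<close> by simp
      next
        case False
        then have "dist y (y + s *\<^sub>R w) < \<delta>"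
          by (simp add: dist_norm s_def field_simps)
        then show ?thesis using \<delta>(2)[of y "y + s *\<^sub>R w"] False by simp
      qed
    qed (use int intI in auto)
    also have "\<dots> = \<epsilon> / 2 + 2 * B * (\<integral>w. indicator {w. norm w \<ge> \<delta> * real (Suc k)} w \<partial>(gauss_measure::'b measure))"
      using intI gauss.prob_space[where 'b='b] by simp
    also have "\<dots> \<le> \<epsilon> / 2 + 2 * B * (\<epsilon> / (4 * B + 1))"
      using k \<open>B \<ge> 0\<close> by (intro add_left_mono mult_left_mono) auto
    also have "\<dots> \<le> \<epsilon>" using \<open>B \<ge> 0\<close> \<open>\<epsilon> > 0\<close> by (simp add: field_simps)
    finally show ?thesis .
  qed
  then show ?thesis using \<open>s > 0\<close> by blast
qed

text \<open>One unit of room around the support: two points closer than 1 either both lie in the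
  ball of radius \<open>R + 1\<close>, where Heine-Cantor applies, or both lie outside the
  support.\<close>

lemma uniformly_continuous_compact_support:
  fixes g :: "'b::euclidean_space \<Rightarrow> real"
  assumes "continuous_on UNIV g" and supp: "\<And>z. norm z > R \<Longrightarrow> g z = 0"
  shows "uniformly_continuous_on UNIV g"
proof -
  have uc: "uniformly_continuous_on (cball 0 (R + 1)) g"
    using assms by (intro compact_uniformly_continuous continuous_on_subset[OF assms(1)]) auto
  show ?thesis
    unfolding uniformly_continuous_on_def
  proof (intro allI impI)
    fix e :: real assume "e > 0"
    then obtain d where d: "d > 0" "\<And>x x'. x \<in> cball 0 (R + 1) \<Longrightarrow> x' \<in> cball 0 (R + 1) \<Longrightarrow> dist x' x < d \<Longrightarrow> dist (g x') (g x) < e"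
      using uc unfolding uniformly_continuous_on_def by meson
    have "dist (g x') (g x) < e" if "dist x' x < min d 1" for x x'
    proof (cases "norm x \<le> R + 1 \<and> norm x' \<le> R + 1")
      case True then show ?thesis using d(2)[of x x'] that by auto
    next
      case False
      have "norm x \<le> norm x' + dist x' x" "norm x' \<le> norm x + dist x' x"
        by (metis dist_0_norm dist_commute dist_triangle add.commute)+
      then have "norm x > R" "norm x' > R" using False that by auto
      then show ?thesis using supp \<open>e > 0\<close> by simp
    qed
    then show "\<exists>d>0. \<forall>x\<in>UNIV. \<forall>x'\<in>UNIV. dist x' x < d \<longrightarrow> dist (g x') (g x) < e"
      using d(1) by (intro exI[of _ "min d 1"]) auto
  qed
qed

text \<open>The mollification error is uniform in the point, hence the same for every law
  \<open>N n\<close> and for the limit, as \<open>tendsto_approximable\<close> requires.\<close>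

lemma tendsto_integral_gauss_compact_support:
  fixes N :: "nat \<Rightarrow> 'b::euclidean_space measure" and g :: "'b \<Rightarrow> real"
  assumes N: "\<And>n. prob_space (N n)" "\<And>n. sets (N n) = sets borel"
    and char: "\<And>t. (\<lambda>n. \<integral>y. cis (t \<bullet> y) \<partial>N n) \<longlonglongrightarrow> of_real (exp (- (norm t)\<^sup>2 / 2))"
    and cont: "continuous_on UNIV g"
    and gB: "\<And>z. \<bar>g z\<bar> \<le> B" and supp: "\<And>z. norm z > R \<Longrightarrow> g z = 0"
  shows "(\<lambda>n. \<integral>y. g y \<partial>N n) \<longlonglongrightarrow> (\<integral>y. g y \<partial>gauss_measure)"
proof (rule tendsto_approximable)
  fix \<epsilon> :: real assume "\<epsilon> > 0"
  have g[measurable]: "g \<in> borel_measurable borel" by (rule borel_measurable_continuous_onI[OF cont])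
  have gB': "\<bar>g z\<bar> \<le> B * indicator (cball 0 R) z" for z
    using gB[of z] supp[of z] by (auto simp: indicator_def not_le)
  obtain s where s: "s > 0" "\<And>y. \<bar>g y - gauss_smooth s g y\<bar> \<le> \<epsilon>"
    using gauss_mollifier_approx[OF cont gB uniformly_continuous_compact_support[OF cont supp] \<open>\<epsilon> > 0\<close>] by blast
  have close: "\<bar>(\<integral>y. g y \<partial>Q) - (\<integral>y. gauss_smooth s g y \<partial>Q)\<bar> \<le> \<epsilon>"
    if "prob_space Q" and sQ: "sets Q = sets borel" for Q :: "'b measure"
  proof -
    interpret Q: prob_space Q by fact
    note sQ[measurable_cong]
    have i1: "integrable Q g" by (rule Q.integrable_const_bound[of _ B]) (auto simp: gB)
    have m: "(\<lambda>y. \<integral>w. g (y + s *\<^sub>R w) \<partial>gauss_measure) \<in> borel_measurable Q"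
      by measurable
    have "\<bar>\<integral>w. g (y + s *\<^sub>R w) \<partial>gauss_measure\<bar> \<le> B + \<epsilon>" for y
      using s(2)[of y] gB[of y] by linarith
    then have i2: "integrable Q (\<lambda>y. \<integral>w. g (y + s *\<^sub>R w) \<partial>gauss_measure)"
      by (intro Q.integrable_const_bound[of _ "B + \<epsilon>"] m) auto
    have "\<bar>(\<integral>y. g y \<partial>Q) - (\<integral>y. gauss_smooth s g y \<partial>Q)\<bar>
       = \<bar>\<integral>y. g y - gauss_smooth s g y \<partial>Q\<bar>" using i1 i2 by simp
    also have "\<dots> \<le> (\<integral>y. \<bar>g y - gauss_smooth s g y\<bar> \<partial>Q)" by (rule integral_abs_bound)
    also have "\<dots> \<le> (\<integral>y. \<epsilon> \<partial>Q)" using i1 i2 s(2) by (intro integral_mono) auto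
    finally show ?thesis by (simp add: Q.prob_space)
  qed
  show "\<exists>a' l'. a' \<longlonglongrightarrow> l' \<and> (\<forall>n. \<bar>(\<integral>y. g y \<partial>N n) - a' n\<bar> \<le> \<epsilon>) \<and> \<bar>(\<integral>y. g y \<partial>gauss_measure) - l'\<bar> \<le> \<epsilon>"
    using gauss_mollified_tendsto[OF N char g gB' s(1)] close[OF N]
      close[OF prob_space_gauss_measure sets_gauss_measure] by blast
qed

text \<open>Tightness is inherited from the limit: the cutoff \<open>\<xi> k\<close> is itself a
  compactly supported test function, so if its Gaussian mean is close to 1, then so are its means
  under \<open>N n\<close> for large \<open>n\<close>. No mass escapes, and \<open>g\<close> may be
  replaced by \<open>g * \<xi> k\<close>.\<close>

theorem levy_continuity_gauss:
  fixes N :: "nat \<Rightarrow> 'b::euclidean_space measure" and g :: "'b \<Rightarrow> real"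
  assumes N: "\<And>n. prob_space (N n)" "\<And>n. sets (N n) = sets borel"
    and char: "\<And>t. (\<lambda>n. \<integral>y. cis (t \<bullet> y) \<partial>N n) \<longlonglongrightarrow> of_real (exp (- (norm t)\<^sup>2 / 2))"
    and cont: "continuous_on UNIV g" and gB: "\<And>z. \<bar>g z\<bar> \<le> B"
  shows "(\<lambda>n. \<integral>y. g y \<partial>N n) \<longlonglongrightarrow> (\<integral>y. g y \<partial>gauss_measure)"
proof (rule LIMSEQ_I)
  fix r :: real assume "r > 0"
  have "B \<ge> 0" using gB[of 0] by linarith
  define \<xi> where "\<xi> k z = max 0 (min 1 (real k + 1 - norm z))" for k :: nat and z :: 'b
  have \<xi>: "0 \<le> \<xi> k z" "\<xi> k z \<le> 1" for k z by (auto simp: \<xi>_def)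
  have c\<xi>: "continuous_on UNIV (\<xi> k)" for k
    unfolding \<xi>_def[abs_def] by (intro continuous_intros)
  have s\<xi>: "\<xi> k z = 0" if "norm z > real k + 1" for k z
    using that by (simp add: \<xi>_def)
  have [measurable]: "g \<in> borel_measurable borel" "\<xi> k \<in> borel_measurable borel" for k
    using cont c\<xi> by (auto intro: borel_measurable_continuous_onI)
  have "(\<lambda>k. \<integral>z. \<xi> k z \<partial>gauss_measure) \<longlonglongrightarrow> (\<integral>z. 1 \<partial>(gauss_measure :: 'b measure))"
  proof (intro integral_dominated_convergence[where w="\<lambda>_. 1"] AE_I2)
    fix z :: 'b
    obtain k0 :: nat where "norm z < real k0" using reals_Archimedean2 by blast
    then show "(\<lambda>k. \<xi> k z) \<longlonglongrightarrow> 1"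
      by (intro tendsto_eventually eventually_sequentiallyI[of k0]) (auto simp: \<xi>_def)
  qed (use \<xi> in auto)
  then obtain k where "norm ((\<integral>z. \<xi> k z \<partial>gauss_measure) - (\<integral>z. 1 \<partial>(gauss_measure :: 'b measure))) < r / (8 * B + 8)"
    using \<open>B \<ge> 0\<close> \<open>r > 0\<close> LIMSEQ_D[of _ _ "r / (8 * B + 8)"] by fastforce
  then have k: "1 - (\<integral>z. \<xi> k z \<partial>gauss_measure) < r / (8 * B + 8)"
    using gauss.prob_space[where 'b='b] by simp
  have \<xi>lim: "(\<lambda>n. \<integral>y. \<xi> k y \<partial>N n) \<longlonglongrightarrow> (\<integral>y. \<xi> k y \<partial>gauss_measure)"
    using \<xi> s\<xi> by (intro tendsto_integral_gauss_compact_support[OF N char c\<xi>, of k 1 "real k + 1"]) auto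
  have glim: "(\<lambda>n. \<integral>y. g y * \<xi> k y \<partial>N n) \<longlonglongrightarrow> (\<integral>y. g y * \<xi> k y \<partial>gauss_measure)"
  proof (rule tendsto_integral_gauss_compact_support[OF N char, of _ B "real k + 1"])
    show "\<bar>g z * \<xi> k z\<bar> \<le> B" for z
      using mult_mono[OF gB[of z] \<xi>(2)[of k z] \<open>B \<ge> 0\<close> \<xi>(1)] \<xi>(1)[of k z] by (simp add: abs_mult)
  qed (use s\<xi> in \<open>auto intro!: continuous_intros cont c\<xi>\<close>)
  have close: "\<bar>(\<integral>y. g y \<partial>Q) - (\<integral>y. g y * \<xi> k y \<partial>Q)\<bar> \<le> B * (1 - (\<integral>y. \<xi> k y \<partial>Q))"
    if "prob_space Q" and sQ: "sets Q = sets borel" for Q :: "'b measure"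
  proof -
    interpret Q: prob_space Q by fact
    note sQ[measurable_cong]
    have i: "integrable Q g" "integrable Q (\<xi> k)" "integrable Q (\<lambda>y. g y * \<xi> k y)"
      using gB \<xi> mult_mono[OF gB \<xi>(2) \<open>B \<ge> 0\<close> \<xi>(1)]
      by (auto intro!: Q.integrable_const_bound[of _ B] Q.integrable_const_bound[of "\<xi> k" 1] simp: abs_mult)
    have "\<bar>(\<integral>y. g y \<partial>Q) - (\<integral>y. g y * \<xi> k y \<partial>Q)\<bar> = \<bar>\<integral>y. g y * (1 - \<xi> k y) \<partial>Q\<bar>"
      using i by (simp add: right_diff_distrib)
    also have "\<dots> \<le> (\<integral>y. \<bar>g y * (1 - \<xi> k y)\<bar> \<partial>Q)" by (rule integral_abs_bound)
    also have "\<dots> \<le> (\<integral>y. B * (1 - \<xi> k y) \<partial>Q)"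
    proof (rule integral_mono)
      show "integrable Q (\<lambda>y. \<bar>g y * (1 - \<xi> k y)\<bar>)"
        using i by (intro integrable_abs) (simp add: right_diff_distrib)
      show "\<bar>g y * (1 - \<xi> k y)\<bar> \<le> B * (1 - \<xi> k y)" for y
        using gB[of y] \<xi>[of k y] by (simp add: abs_mult mult_right_mono)
    qed (use i in simp)
    also have "\<dots> = B * (1 - (\<integral>y. \<xi> k y \<partial>Q))" using i by (simp add: Q.prob_space)
    finally show ?thesis .
  qed
  \<comment> \<open>The cutoff costs at most 2 B \<epsilon> under \<open>N n\<close> and B
    \<epsilon> under the limit, each B \<epsilon> being at most r/8; together with r/4 for the
    truncated integrals this stays below r.\<close>
  define \<epsilon> where "\<epsilon> = r / (8 * B + 8)"
  have "\<epsilon> > 0" using \<open>B \<ge> 0\<close> \<open>r > 0\<close> by (simp add: \<epsilon>_def)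
  have B\<epsilon>: "B * \<epsilon> \<le> r / 8" using \<open>B \<ge> 0\<close> \<open>r > 0\<close> by (simp add: \<epsilon>_def field_simps)
  obtain n1 where n1: "\<And>n. n \<ge> n1 \<Longrightarrow> \<bar>(\<integral>y. \<xi> k y \<partial>N n) - (\<integral>y. \<xi> k y \<partial>gauss_measure)\<bar> < \<epsilon>"
    using LIMSEQ_D[OF \<xi>lim \<open>\<epsilon> > 0\<close>] by auto
  obtain n2 where n2: "\<And>n. n \<ge> n2 \<Longrightarrow> \<bar>(\<integral>y. g y * \<xi> k y \<partial>N n) - (\<integral>y. g y * \<xi> k y \<partial>gauss_measure)\<bar> < r / 4"
    using LIMSEQ_D[OF glim, of "r / 4"] \<open>r > 0\<close> by auto
  have "norm ((\<integral>y. g y \<partial>N n) - (\<integral>y. g y \<partial>gauss_measure)) < r" if "n \<ge> max n1 n2" for n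
  proof -
    have "B * (1 - (\<integral>y. \<xi> k y \<partial>N n)) \<le> B * (2 * \<epsilon>)"
      using n1[of n] k that \<open>B \<ge> 0\<close> by (intro mult_left_mono) (auto simp: \<epsilon>_def)
    moreover have "B * (1 - (\<integral>y. \<xi> k y \<partial>gauss_measure)) \<le> B * \<epsilon>"
      using k \<open>B \<ge> 0\<close> by (intro mult_left_mono) (auto simp: \<epsilon>_def)
    moreover have that': "n \<ge> n2" using that by simp
    ultimately show ?thesis
      using n2[OF that'] close[OF N, of n] close[OF prob_space_gauss_measure sets_gauss_measure] B\<epsilon> \<open>r > 0\<close>
      unfolding real_norm_def by linarith
  qed
  then show "\<exists>n0. \<forall>n\<ge>n0. norm ((\<integral>y. g y \<partial>N n) - (\<integral>y. g y \<partial>gauss_measure)) < r" by blast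
qed

section \<open>A quantitative martingale central limit theorem\<close>

text \<open>With w = i e + e^2/2 the quadratic terms of exp(w) cancel, since (i e)^2/2 = -e^2/2, and
  what is left after 1 + i e is cubic. The constant is 27/8 from the Taylor remainder plus 5/8 from
  the surplus terms of w^2/2.\<close>

lemma cis_exp_half_square_expansion:
  fixes e :: real
  assumes "\<bar>e\<bar> \<le> 1"
  shows "cmod (cis e * of_real (exp (e\<^sup>2 / 2)) - 1 - \<i> * of_real e) \<le> 4 * \<bar>e\<bar> ^ 3"
proof -
  define w :: complex where "w = \<i> * of_real e + of_real (e\<^sup>2 / 2)"
  have e2: "e\<^sup>2 \<le> \<bar>e\<bar>"
    using mult_mono[OF assms order_refl, of "\<bar>e\<bar>"] by (simp add: power2_eq_square)
  have "cmod w \<le> \<bar>e\<bar> + e\<^sup>2 / 2"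
    unfolding w_def by (rule order_trans[OF norm_triangle_ineq]) (simp add: norm_mult norm_power)
  then have wn: "cmod w \<le> 3 / 2 * \<bar>e\<bar>"
    using e2 by simp
  have re: "Re w = e\<^sup>2 / 2" by (simp add: w_def power2_eq_square)
  have "cmod (exp w - (\<Sum>i\<le>2. w ^ i / fact i)) \<le> exp \<bar>Re w\<bar> * (cmod w ^ Suc 2) / fact 2"
    by (rule Taylor_exp)
  also have "\<dots> \<le> 2 * (3 / 2 * \<bar>e\<bar>) ^ 3 / 2"
  proof -
    have "\<bar>Re w\<bar> \<le> 1 / 2" using e2 assms by (simp add: re)
    then have "exp \<bar>Re w\<bar> \<le> 2" using exp_half_le2 by (meson exp_le_cancel_iff order_trans)
    moreover have "cmod w ^ 3 \<le> (3 / 2 * \<bar>e\<bar>) ^ 3" using wn by (intro power_mono) auto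
    ultimately have "exp \<bar>Re w\<bar> * cmod w ^ 3 \<le> 2 * (3 / 2 * \<bar>e\<bar>) ^ 3" by (intro mult_mono) auto
    then have "exp \<bar>Re w\<bar> * cmod w ^ Suc 2 \<le> 2 * (3 / 2 * \<bar>e\<bar>) ^ 3" by (simp only: Suc_numeral semiring_norm)
    then show ?thesis by (simp only: fact_2 divide_right_mono)
  qed
  also have "\<dots> = 27 / 8 * \<bar>e\<bar> ^ 3" by (simp add: power3_eq_cube)
  finally have 1: "cmod (exp w - (\<Sum>i\<le>2. w ^ i / fact i)) \<le> 27 / 8 * \<bar>e\<bar> ^ 3" .
  have expw: "cis e * of_real (exp (e\<^sup>2 / 2)) = exp w"
    by (simp add: w_def exp_add cis_conv_exp exp_of_real[symmetric])
  have "(\<Sum>i\<le>2. w ^ i / fact i) = 1 + w + w\<^sup>2 / 2" by (simp add: numeral_2_eq_2)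
  also have "\<dots> = 1 + \<i> * of_real e + (\<i> * of_real (e ^ 3) / 2 + of_real (e ^ 4) / 8)"
    unfolding w_def by (simp add: power2_eq_square power3_eq_cube power4_eq_xxxx field_simps)
  finally have s: "(\<Sum>i\<le>2. w ^ i / fact i) = \<dots>" .
  have "\<bar>e\<bar> ^ 4 \<le> \<bar>e\<bar> ^ 3" using assms by (intro power_decreasing) auto
  then have 2: "cmod (\<i> * of_real (e ^ 3) / 2 + of_real (e ^ 4) / 8) \<le> 5 / 8 * \<bar>e\<bar> ^ 3"
    by (intro order_trans[OF norm_triangle_ineq]) (simp add: norm_mult norm_power norm_divide power_abs)
  have "cmod (cis e * of_real (exp (e\<^sup>2 / 2)) - 1 - \<i> * of_real e)
     = cmod ((exp w - (\<Sum>i\<le>2. w ^ i / fact i)) + (\<i> * of_real (e ^ 3) / 2 + of_real (e ^ 4) / 8))"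
    unfolding expw s by (simp add: algebra_simps)
  also have "\<dots> \<le> 27 / 8 * \<bar>e\<bar> ^ 3 + 5 / 8 * \<bar>e\<bar> ^ 3"
    by (rule order_trans[OF norm_triangle_ineq add_mono[OF 1 2]])
  finally show ?thesis by simp
qed

lemma abs_exp_half_diff_le:
  fixes a b c :: real
  assumes "a \<le> c" "b \<le> c"
  shows "\<bar>exp (a / 2) - exp (b / 2)\<bar> \<le> exp (c / 2) * \<bar>a - b\<bar>"
proof -
  have *: "exp (y / 2) - exp (x / 2) \<le> exp (c / 2) * (y - x)" if "x \<le> y" "y \<le> c" for x y :: real
  proof -
    have "1 - exp ((x - y) / 2) \<le> (y - x) / 2"
      using exp_ge_add_one_self[of "(x - y) / 2"] by (simp add: field_simps)
    also have "\<dots> \<le> y - x" using that by simp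
    finally have "exp (y / 2) * (1 - exp ((x - y) / 2)) \<le> exp (c / 2) * (y - x)"
      using that by (intro mult_mono) auto
    then show ?thesis by (simp add: algebra_simps mult_exp_exp add_divide_distrib[symmetric] flip: diff_divide_distrib)
  qed
  show ?thesis
    using *[of a b] *[of b a] assms by (cases "a \<le> b") auto
qed

text \<open>McLeish's argument. \<open>T k\<close> multiplies the exponential of the partial sum by
  exp(V'/2), so by the cubic expansion its expectation moves by at most a multiple of \<delta> times
  E (e k)^2 per step, and these add up to \<delta> (s + 2). At the end the compensator is compared
  with exp(s/2). The martingale property enters only as orthogonality to bounded variables of the
  past.\<close>

lemma (in prob_space) martingale_cis_bound:
  fixes d :: "nat \<Rightarrow> 'a \<Rightarrow> real" and F :: "nat \<Rightarrow> 'a measure"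
  assumes sub: "\<And>k. subalgebra M (F k)"
    and mono: "\<And>j k. j \<le> k \<Longrightarrow> sets (F j) \<subseteq> sets (F k)"
    and adapted: "\<And>k. d k \<in> borel_measurable (F (Suc k))"
    and bound: "\<And>k \<omega>. \<bar>d k \<omega>\<bar> \<le> \<delta>" and "\<delta> \<le> 1"
    and mart: "\<And>k Z B. Z \<in> borel_measurable (F k) \<Longrightarrow> (\<And>\<omega>. \<bar>Z \<omega>\<bar> \<le> B) \<Longrightarrow>
        expectation (\<lambda>\<omega>. Z \<omega> * d k \<omega>) = 0"
    and "s \<ge> 0"
  shows "cmod (expectation (\<lambda>\<omega>. cis (\<Sum>k<n. d k \<omega>)) - of_real (exp (- s / 2)))
     \<le> exp ((s + 2) / 2) * (4 * \<delta> * (s + 2) + 2 * expectation (\<lambda>\<omega>. \<bar>(\<Sum>k<n. (d k \<omega>)\<^sup>2) - s\<bar>))"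
proof -
  have measM: "f \<in> borel_measurable M" if "f \<in> borel_measurable (F k)" for k and f :: "'a \<Rightarrow> 'c::topological_space"
    using measurable_from_subalg[OF sub that] .
  have measF: "f \<in> borel_measurable (F k)" if "f \<in> borel_measurable (F j)" "j \<le> k" for j k and f :: "'a \<Rightarrow> 'c::topological_space"
    using that mono[of j k] sub[of j] sub[of k] unfolding measurable_def subalgebra_def by auto
  have dF: "d j \<in> borel_measurable (F k)" if "j < k" for j k
    using measF[OF adapted] that by simp
  have dM[measurable]: "d j \<in> borel_measurable M" for j by (rule measM[OF adapted])
  have "\<delta> \<ge> 0" using bound[of 0 undefined] by linarith
  define V where "V k \<omega> = (\<Sum>j<k. (d j \<omega>)\<^sup>2)" for k \<omega>
  \<comment> \<open>Stopping the martingale when the quadratic variation exceeds \<open>s + 1\<close> keeps the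
    exponential compensator bounded.\<close>
  define e where "e k \<omega> = (if V k \<omega> \<le> s + 1 then d k \<omega> else 0)" for k \<omega>
  define S where "S k \<omega> = (\<Sum>j<k. e j \<omega>)" for k \<omega>
  define V' where "V' k \<omega> = (\<Sum>j<k. (e j \<omega>)\<^sup>2)" for k \<omega>
  define T where "T k \<omega> = cis (S k \<omega>) * complex_of_real (exp (V' k \<omega> / 2))" for k \<omega>
  define B where "B = exp ((s + 2) / 2)"
  have B: "B > 0" by (simp add: B_def)
  have VF: "V k \<in> borel_measurable (F k)" for k
    unfolding V_def by (intro borel_measurable_sum borel_measurable_power dF) auto
  have IF: "(\<lambda>\<omega>. if V k \<omega> \<le> s + 1 then 1 else (0::real)) \<in> borel_measurable (F k)" for k
    using VF[of k] by measurable
  have eF: "e j \<in> borel_measurable (F k)" if "j < k" for j k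
  proof -
    have "(\<lambda>\<omega>. (if V j \<omega> \<le> s + 1 then 1 else 0) * d j \<omega>) \<in> borel_measurable (F k)"
      using measF[OF IF[of j], of k] dF[OF that] that by (intro borel_measurable_times) auto
    moreover have "(\<lambda>\<omega>. (if V j \<omega> \<le> s + 1 then 1 else 0) * d j \<omega>) = e j" by (auto simp: e_def)
    ultimately show ?thesis by simp
  qed
  have SF: "S k \<in> borel_measurable (F k)" for k
    unfolding S_def by (intro borel_measurable_sum eF) auto
  have VF': "V' k \<in> borel_measurable (F k)" for k
    unfolding V'_def by (intro borel_measurable_sum borel_measurable_power eF) auto
  have [measurable]: "V k \<in> borel_measurable M" "S k \<in> borel_measurable M" "V' k \<in> borel_measurable M" for k
    using measM[OF VF] measM[OF SF] measM[OF VF'] by auto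
  have eM[measurable]: "e k \<in> borel_measurable M" for k using measM[OF eF[of k "Suc k"]] by simp
  have e_le: "\<bar>e k \<omega>\<bar> \<le> \<delta>" for k \<omega> using bound[of k \<omega>] \<open>\<delta> \<ge> 0\<close> by (auto simp: e_def)
  have d2: "(d k \<omega>)\<^sup>2 \<le> 1" for k \<omega>
    using bound[of k \<omega>] \<open>\<delta> \<le> 1\<close> by (simp add: abs_square_le_1)
  have V'V: "V' k \<omega> \<le> V k \<omega>" for k \<omega> unfolding V_def V'_def by (intro sum_mono) (auto simp: e_def)
  have V'_le: "V' k \<omega> \<le> s + 2" for k \<omega>
  proof (induction k)
    case 0 then show ?case using \<open>s \<ge> 0\<close> by (simp add: V'_def)
  next
    case (Suc k)
    have "V' (Suc k) \<omega> = V' k \<omega> + (e k \<omega>)\<^sup>2" by (simp add: V'_def)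
    then show ?case using Suc V'V[of k \<omega>] d2[of k \<omega>] by (auto simp: e_def split: if_splits)
  qed
  have same: "S k \<omega> = (\<Sum>j<k. d j \<omega>) \<and> V' k \<omega> = V k \<omega>" if "V k \<omega> \<le> s + 1" for k \<omega>
  proof -
    have "e j \<omega> = d j \<omega>" if "j < k" for j
    proof -
      have "V j \<omega> \<le> V k \<omega>" unfolding V_def using that by (intro sum_mono2) auto
      then show ?thesis using \<open>V k \<omega> \<le> s + 1\<close> by (simp add: e_def)
    qed
    then show ?thesis by (simp add: S_def V_def V'_def)
  qed
  have TB: "cmod (T k \<omega>) \<le> B" for k \<omega>
    using V'_le[of k \<omega>] by (simp add: T_def norm_mult B_def)
  have [measurable]: "T k \<in> borel_measurable M" for k unfolding T_def by measurable
  have intT: "integrable M (T k)" for k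
    by (rule integrable_const_bound[of _ B]) (auto simp: TB)
  have inte: "integrable M (\<lambda>\<omega>. T k \<omega> * (\<i> * of_real (e k \<omega>)))" for k
  proof (rule integrable_const_bound[of _ "B * \<delta>"])
    show "AE \<omega> in M. cmod (T k \<omega> * (\<i> * of_real (e k \<omega>))) \<le> B * \<delta>"
      using TB e_le B by (auto simp: norm_mult intro!: mult_mono)
  qed measurable
  \<comment> \<open>The stopping indicator depends on \<open>V k\<close> only, so it can be moved
    from \<open>e k\<close> into the test variable of \<open>mart\<close>. That hypothesis is real,
    hence the split into real and imaginary parts.\<close>
  have zero: "expectation (\<lambda>\<omega>. T k \<omega> * (\<i> * of_real (e k \<omega>))) = 0" for k
  proof -
    have part: "expectation (\<lambda>\<omega>. h (S k \<omega>) * exp (V' k \<omega> / 2) * e k \<omega>) = 0"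
      if h: "h \<in> borel_measurable borel" "\<And>x. \<bar>h x\<bar> \<le> 1" for h :: "real \<Rightarrow> real"
    proof -
      let ?Z = "\<lambda>\<omega>. h (S k \<omega>) * exp (V' k \<omega> / 2) * (if V k \<omega> \<le> s + 1 then 1 else 0)"
      have "?Z \<in> borel_measurable (F k)"
        using IF[of k] SF[of k] VF'[of k] h(1) by measurable
      moreover have "\<bar>?Z \<omega>\<bar> \<le> B" for \<omega>
      proof -
        have "\<bar>h (S k \<omega>) * exp (V' k \<omega> / 2)\<bar> \<le> 1 * B"
          unfolding abs_mult using h(2) V'_le[of k \<omega>] by (intro mult_mono) (auto simp: B_def)
        then show ?thesis using B by auto
      qed
      ultimately have "expectation (\<lambda>\<omega>. ?Z \<omega> * d k \<omega>) = 0" by (rule mart)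
      moreover have "?Z \<omega> * d k \<omega> = h (S k \<omega>) * exp (V' k \<omega> / 2) * e k \<omega>" for \<omega>
        by (simp add: e_def)
      ultimately show ?thesis by simp
    qed
    show ?thesis
    proof (rule complex_eqI)
      have "Re (expectation (\<lambda>\<omega>. T k \<omega> * (\<i> * of_real (e k \<omega>))))
          = expectation (\<lambda>\<omega>. Re (T k \<omega> * (\<i> * of_real (e k \<omega>))))"
        by (rule integral_Re[OF inte, symmetric])
      also have "\<dots> = expectation (\<lambda>\<omega>. - sin (S k \<omega>) * exp (V' k \<omega> / 2) * e k \<omega>)"
        by (simp add: T_def)
      also have "\<dots> = 0" using part[of "\<lambda>x. - sin x"] by simp
      finally show "Re (expectation (\<lambda>\<omega>. T k \<omega> * (\<i> * of_real (e k \<omega>)))) = Re 0" by simp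
      have "Im (expectation (\<lambda>\<omega>. T k \<omega> * (\<i> * of_real (e k \<omega>))))
          = expectation (\<lambda>\<omega>. Im (T k \<omega> * (\<i> * of_real (e k \<omega>))))"
        by (rule integral_Im[OF inte, symmetric])
      also have "\<dots> = expectation (\<lambda>\<omega>. cos (S k \<omega>) * exp (V' k \<omega> / 2) * e k \<omega>)"
        by (simp add: T_def)
      also have "\<dots> = 0" using part[of cos] by simp
      finally show "Im (expectation (\<lambda>\<omega>. T k \<omega> * (\<i> * of_real (e k \<omega>)))) = Im 0" by simp
    qed
  qed
  have inte2: "integrable M (\<lambda>\<omega>. (e k \<omega>)\<^sup>2)" for k
    using e_le \<open>\<delta> \<ge> 0\<close> by (intro integrable_const_bound[of _ "\<delta>\<^sup>2"]) (auto simp: abs_le_square_iff[symmetric])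
  have step: "cmod (expectation (T (Suc k)) - expectation (T k)) \<le> 4 * B * \<delta> * expectation (\<lambda>\<omega>. (e k \<omega>)\<^sup>2)" for k
  proof -
    have Tstep: "T (Suc k) \<omega> = T k \<omega> * (cis (e k \<omega>) * of_real (exp ((e k \<omega>)\<^sup>2 / 2)))" for \<omega>
      by (simp add: T_def S_def V'_def cis_mult[symmetric] add_divide_distrib exp_add)
    have "expectation (T (Suc k)) - expectation (T k)
       = expectation (\<lambda>\<omega>. T (Suc k) \<omega> - T k \<omega> - T k \<omega> * (\<i> * of_real (e k \<omega>)))"
      using intT inte zero by simp
    also have "cmod \<dots> \<le> expectation (\<lambda>\<omega>. cmod (T (Suc k) \<omega> - T k \<omega> - T k \<omega> * (\<i> * of_real (e k \<omega>))))"
      by (rule integral_norm_bound)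
    also have "\<dots> \<le> expectation (\<lambda>\<omega>. 4 * B * \<delta> * (e k \<omega>)\<^sup>2)"
    proof (rule integral_mono)
      show "integrable M (\<lambda>\<omega>. cmod (T (Suc k) \<omega> - T k \<omega> - T k \<omega> * (\<i> * of_real (e k \<omega>))))"
        using intT inte by (intro integrable_norm Bochner_Integration.integrable_diff) auto
      show "integrable M (\<lambda>\<omega>. 4 * B * \<delta> * (e k \<omega>)\<^sup>2)" using inte2 by simp
      fix \<omega>
      have "T (Suc k) \<omega> - T k \<omega> - T k \<omega> * (\<i> * of_real (e k \<omega>))
        = T k \<omega> * (cis (e k \<omega>) * of_real (exp ((e k \<omega>)\<^sup>2 / 2)) - 1 - \<i> * of_real (e k \<omega>))"
        by (simp add: Tstep algebra_simps)
      moreover have "cmod (cis (e k \<omega>) * of_real (exp ((e k \<omega>)\<^sup>2 / 2)) - 1 - \<i> * of_real (e k \<omega>)) \<le> 4 * \<bar>e k \<omega>\<bar> ^ 3"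
        using e_le[of k \<omega>] \<open>\<delta> \<le> 1\<close> by (intro cis_exp_half_square_expansion) auto
      moreover have "\<bar>e k \<omega>\<bar> ^ 3 \<le> \<delta> * (e k \<omega>)\<^sup>2"
        using mult_right_mono[OF e_le[of k \<omega>], of "(e k \<omega>)\<^sup>2"] by (simp add: power3_eq_cube power2_eq_square abs_mult)
      ultimately have "cmod (T (Suc k) \<omega> - T k \<omega> - T k \<omega> * (\<i> * of_real (e k \<omega>))) \<le> B * (4 * (\<delta> * (e k \<omega>)\<^sup>2))"
        using TB[of k \<omega>] B by (simp only: norm_mult) (intro mult_mono, auto)
      then show "cmod (T (Suc k) \<omega> - T k \<omega> - T k \<omega> * (\<i> * of_real (e k \<omega>))) \<le> 4 * B * \<delta> * (e k \<omega>)\<^sup>2"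
        by (simp add: mult_ac)
    qed
    finally show ?thesis by simp
  qed
  have "cmod (expectation (T n) - 1) \<le> (\<Sum>k<n. 4 * B * \<delta> * expectation (\<lambda>\<omega>. (e k \<omega>)\<^sup>2))"
  proof (induction n)
    case 0 then show ?case by (simp add: T_def S_def V'_def prob_space)
  next
    case (Suc n)
    have "cmod (expectation (T (Suc n)) - 1) \<le> cmod (expectation (T (Suc n)) - expectation (T n)) + cmod (expectation (T n) - 1)"
      using norm_triangle_ineq[of "expectation (T (Suc n)) - expectation (T n)" "expectation (T n) - 1"] by simp
    then show ?case using Suc step[of n] by simp
  qed
  also have "\<dots> = 4 * B * \<delta> * expectation (V' n)"
    unfolding V'_def using inte2 by (subst Bochner_Integration.integral_sum) (auto simp: sum_distrib_left)
  also have "\<dots> \<le> 4 * B * \<delta> * (s + 2)"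
  proof (intro mult_left_mono)
    have "expectation (V' n) \<le> expectation (\<lambda>_. s + 2)"
      by (intro integral_mono) (use inte2 V'_le in \<open>auto simp: V'_def[abs_def]\<close>)
    then show "expectation (V' n) \<le> s + 2" by (simp add: prob_space)
  qed (use B \<open>\<delta> \<ge> 0\<close> in auto)
  finally have 1: "cmod (expectation (T n) - 1) \<le> 4 * B * \<delta> * (s + 2)" .
  have intV: "integrable M (V n)"
    unfolding V_def by (intro Bochner_Integration.integrable_sum integrable_const_bound[of _ 1]) (auto simp: d2)
  have intcis: "integrable M (\<lambda>\<omega>. cis (\<Sum>k<n. d k \<omega>))"
    by (intro integrable_const_bound[of _ 1]) auto
  \<comment> \<open>While \<open>V n\<close> is at most s + 1, nothing was stopped and only the
    compensators differ. Otherwise |V n - s| exceeds 1, so the trivial bound 2B is good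
    enough.\<close>
  have pw: "cmod (of_real (exp (s / 2)) * cis (\<Sum>k<n. d k \<omega>) - T n \<omega>) \<le> 2 * B * \<bar>V n \<omega> - s\<bar>" for \<omega>
  proof (cases "V n \<omega> \<le> s + 1")
    case True
    then have "of_real (exp (s / 2)) * cis (\<Sum>k<n. d k \<omega>) - T n \<omega>
        = cis (\<Sum>k<n. d k \<omega>) * of_real (exp (s / 2) - exp (V n \<omega> / 2))"
      using same[OF True] by (simp add: T_def algebra_simps)
    then have "cmod (of_real (exp (s / 2)) * cis (\<Sum>k<n. d k \<omega>) - T n \<omega>) = \<bar>exp (s / 2) - exp (V n \<omega> / 2)\<bar>"
      by (simp only: norm_mult norm_cis norm_of_real) simp
    also have "\<dots> \<le> B * \<bar>s - V n \<omega>\<bar>"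
      unfolding B_def using True by (intro abs_exp_half_diff_le) auto
    also have "\<dots> \<le> 2 * B * \<bar>V n \<omega> - s\<bar>" using B by (simp add: abs_minus_commute mult_right_mono)
    finally show ?thesis .
  next
    case False
    have "cmod (of_real (exp (s / 2)) * cis (\<Sum>k<n. d k \<omega>) - T n \<omega>) \<le> exp (s / 2) + B"
      using TB[of n \<omega>] by (intro order_trans[OF norm_triangle_ineq4]) (simp add: norm_mult)
    also have "\<dots> \<le> 2 * B" by (simp add: B_def)
    also have "\<dots> \<le> 2 * B * \<bar>V n \<omega> - s\<bar>" using False B by simp
    finally show ?thesis .
  qed
  have "cmod (of_real (exp (s / 2)) * expectation (\<lambda>\<omega>. cis (\<Sum>k<n. d k \<omega>)) - expectation (T n))
     = cmod (expectation (\<lambda>\<omega>. of_real (exp (s / 2)) * cis (\<Sum>k<n. d k \<omega>) - T n \<omega>))"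
    using intT intcis by simp
  also have "\<dots> \<le> expectation (\<lambda>\<omega>. cmod (of_real (exp (s / 2)) * cis (\<Sum>k<n. d k \<omega>) - T n \<omega>))"
    by (rule integral_norm_bound)
  also have "\<dots> \<le> expectation (\<lambda>\<omega>. 2 * B * \<bar>V n \<omega> - s\<bar>)"
    using intT intcis intV pw by (intro integral_mono) auto
  finally have 2: "cmod (of_real (exp (s / 2)) * expectation (\<lambda>\<omega>. cis (\<Sum>k<n. d k \<omega>)) - expectation (T n))
     \<le> 2 * B * expectation (\<lambda>\<omega>. \<bar>V n \<omega> - s\<bar>)" by simp
  have "cmod (expectation (\<lambda>\<omega>. cis (\<Sum>k<n. d k \<omega>)) - of_real (exp (- s / 2)))
     = exp (- s / 2) * cmod (of_real (exp (s / 2)) * expectation (\<lambda>\<omega>. cis (\<Sum>k<n. d k \<omega>)) - 1)"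
  proof -
    have "expectation (\<lambda>\<omega>. cis (\<Sum>k<n. d k \<omega>)) - of_real (exp (- s / 2))
      = of_real (exp (- s / 2)) * (of_real (exp (s / 2)) * expectation (\<lambda>\<omega>. cis (\<Sum>k<n. d k \<omega>)) - 1)"
      by (simp add: right_diff_distrib mult.assoc[symmetric] of_real_mult[symmetric] mult_exp_exp del: of_real_mult)
    then show ?thesis by (simp only: norm_mult norm_of_real) simp
  qed
  also have "\<dots> \<le> 1 * cmod (of_real (exp (s / 2)) * expectation (\<lambda>\<omega>. cis (\<Sum>k<n. d k \<omega>)) - 1)"
    using \<open>s \<ge> 0\<close> by (intro mult_right_mono) auto
  also have "\<dots> \<le> 2 * B * expectation (\<lambda>\<omega>. \<bar>V n \<omega> - s\<bar>) + 4 * B * \<delta> * (s + 2)"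
    using norm_triangle_ineq[of "of_real (exp (s / 2)) * expectation (\<lambda>\<omega>. cis (\<Sum>k<n. d k \<omega>)) - expectation (T n)" "expectation (T n) - 1"] 1 2
    by simp
  finally show ?thesis by (simp add: B_def V_def algebra_simps)
qed

section \<open>Reversible Markov chains\<close>

text \<open>The Doob-Dynkin factorisation. It is clear for simple functions, whose level sets are
  preimages under \<open>Y\<close>; taking \<open>lim\<close> of the factors gives a total
  measurable function, with arbitrary values where they do not converge, which happens only off the
  range of \<open>Y\<close>.\<close>

lemma measurable_vimage_factor:
  fixes W :: "'a \<Rightarrow> real"
  assumes Y: "Y \<in> \<Omega> \<rightarrow> space N"
    and W: "W \<in> borel_measurable (vimage_algebra \<Omega> Y N)"
  shows "\<exists>\<zeta>\<in>borel_measurable N. \<forall>\<omega>\<in>\<Omega>. W \<omega> = \<zeta> (Y \<omega>)"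
proof -
  let ?F = "vimage_algebra \<Omega> Y N"
  have simple: "\<exists>\<zeta>\<in>borel_measurable N. \<forall>\<omega>\<in>\<Omega>. s \<omega> = \<zeta> (Y \<omega>)"
    if s: "simple_function ?F s" for s :: "'a \<Rightarrow> real"
  proof -
    have fin: "finite (s ` \<Omega>)" using simple_functionD(1)[OF s] by simp
    have "\<exists>A\<in>sets N. s -` {c} \<inter> \<Omega> = Y -` A \<inter> \<Omega>" for c
      using simple_functionD(2)[OF s, of "{c}"] sets_vimage_algebra2[OF Y] by auto
    then obtain A where A: "\<And>c. A c \<in> sets N" "\<And>c. s -` {c} \<inter> \<Omega> = Y -` A c \<inter> \<Omega>" by metis
    have sum: "s \<omega> = (\<Sum>c\<in>s ` \<Omega>. c * indicator (A c) (Y \<omega>))" if "\<omega> \<in> \<Omega>" for \<omega>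
    proof -
      have e: "indicator (A c) (Y \<omega>) = (if c = s \<omega> then 1 else 0 :: real)" for c
        using A(2)[of c] that by (auto simp: indicator_def)
      have "(\<Sum>c\<in>s ` \<Omega>. c * indicator (A c) (Y \<omega>)) = (\<Sum>c\<in>s ` \<Omega>. if c = s \<omega> then c else 0)"
        by (intro sum.cong refl, subst e) simp
      also have "\<dots> = s \<omega>"
        using fin that by (subst sum.delta) auto
      finally show ?thesis by simp
    qed
    show ?thesis
    proof (intro bexI ballI)
      show "(\<lambda>y. \<Sum>c\<in>s ` \<Omega>. c * indicator (A c) y) \<in> borel_measurable N" using A(1) by measurable
    qed (rule sum)
  qed
  obtain s where s: "\<And>i. simple_function ?F (s i)" "\<And>\<omega>. \<omega> \<in> space ?F \<Longrightarrow> (\<lambda>i. s i \<omega>) \<longlonglongrightarrow> W \<omega>"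
    using borel_measurable_implies_sequence_metric[OF W, of 0] by blast
  from simple[OF s(1)] obtain \<zeta> where \<zeta>: "\<And>i. \<zeta> i \<in> borel_measurable N" "\<And>i \<omega>. \<omega> \<in> \<Omega> \<Longrightarrow> s i \<omega> = \<zeta> i (Y \<omega>)"
    by metis
  show ?thesis
  proof (intro bexI ballI)
    show "(\<lambda>y. lim (\<lambda>i. \<zeta> i y)) \<in> borel_measurable N" using \<zeta>(1) by measurable
    show "W \<omega> = lim (\<lambda>i. \<zeta> i (Y \<omega>))" if "\<omega> \<in> \<Omega>" for \<omega>
      using limI[OF s(2)[of \<omega>]] that by (simp add: \<zeta>(2))
  qed
qed

context prob_space
begin

lemma subalgebra_vimage:
  assumes "Y \<in> borel_measurable M"
  shows "subalgebra M (vimage_algebra (space M) Y borel)"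
  using measurable_iff_sets[of Y M borel] assms by (simp add: subalgebra_def)

lemma sigma_finite_subalgebraI: "subalgebra M F \<Longrightarrow> sigma_finite_subalgebra M F"
  by (intro finite_measure_subalgebra_is_sigma_finite finite_measure_subalgebra.intro
      finite_measure_subalgebra_axioms.intro finite_measure_axioms)

lemma bounded_integrable:
  fixes h :: "'a \<Rightarrow> real"
  assumes "h \<in> borel_measurable M" "\<And>\<omega>. \<bar>h \<omega>\<bar> \<le> C"
  shows "integrable M h"
  using assms by (intro integrable_const_bound[of _ C]) auto

text \<open>\<open>\<zeta>\<close> is a version of the regression of \<open>W\<close> on
  \<open>Y\<close>, tested against bounded functions of \<open>Y\<close>. Clipping to [-C, C]
  changes it on a null set only and makes the bound hold everywhere, which keeps later integrability
  proofs trivial.\<close>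

lemma bounded_factor:
  fixes W Y :: "'a \<Rightarrow> real"
  assumes W[measurable]: "W \<in> borel_measurable M" and WC: "\<And>\<omega>. \<bar>W \<omega>\<bar> \<le> C"
    and Y[measurable]: "Y \<in> borel_measurable M"
  shows "\<exists>\<zeta>\<in>borel_measurable borel. (\<forall>y. \<bar>\<zeta> y\<bar> \<le> C) \<and>
    (\<forall>\<xi>\<in>borel_measurable borel. (\<exists>D. \<forall>y. \<bar>\<xi> y\<bar> \<le> D) \<longrightarrow>
      expectation (\<lambda>\<omega>. W \<omega> * \<xi> (Y \<omega>)) = expectation (\<lambda>\<omega>. \<zeta> (Y \<omega>) * \<xi> (Y \<omega>)))"
proof -
  let ?F = "vimage_algebra (space M) Y borel"
  interpret F: sigma_finite_subalgebra M ?F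
    by (intro sigma_finite_subalgebraI subalgebra_vimage Y)
  have intW: "integrable M W" by (rule bounded_integrable[OF W WC])
  obtain \<zeta> where \<zeta>[measurable]: "\<zeta> \<in> borel_measurable borel"
    and \<zeta>Y: "\<And>\<omega>. \<omega> \<in> space M \<Longrightarrow> real_cond_exp M ?F W \<omega> = \<zeta> (Y \<omega>)"
    using measurable_vimage_factor[of Y "space M" borel "real_cond_exp M ?F W"] by auto
  have "C \<ge> 0" using WC[of undefined] by linarith
  have "AE \<omega> in M. real_cond_exp M ?F W \<omega> \<le> C"
    by (rule F.real_cond_exp_le_c[OF intW]) (use WC in \<open>auto simp: abs_le_iff\<close>)
  moreover have "AE \<omega> in M. real_cond_exp M ?F W \<omega> \<ge> - C"
    by (rule F.real_cond_exp_ge_c[OF intW]) (use WC in \<open>auto simp: abs_le_iff minus_le_iff\<close>)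
  ultimately have AE: "AE \<omega> in M. max (- C) (min C (\<zeta> (Y \<omega>))) = real_cond_exp M ?F W \<omega>"
    using AE_space by eventually_elim (use \<zeta>Y in auto)
  show ?thesis
  proof (intro bexI[of _ "\<lambda>y. max (- C) (min C (\<zeta> y))"] conjI ballI impI allI)
    show "\<bar>max (- C) (min C (\<zeta> y))\<bar> \<le> C" for y using \<open>C \<ge> 0\<close> by auto
    fix \<xi> :: "real \<Rightarrow> real" assume \<xi>[measurable]: "\<xi> \<in> borel_measurable borel" and "\<exists>D. \<forall>y. \<bar>\<xi> y\<bar> \<le> D"
    then obtain D where D: "\<And>y. \<bar>\<xi> y\<bar> \<le> D" by blast
    have "D \<ge> 0" using D[of 0] by linarith
    have \<xi>F: "(\<lambda>\<omega>. \<xi> (Y \<omega>)) \<in> borel_measurable ?F"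
      by (rule measurable_compose[OF measurable_vimage_algebra1 \<xi>]) auto
    have "integrable M (\<lambda>\<omega>. \<xi> (Y \<omega>) * W \<omega>)"
      by (rule bounded_integrable[of _ "D * C"]) (auto simp: abs_mult intro!: mult_mono D WC \<open>D \<ge> 0\<close>)
    from F.real_cond_exp_intg(2)[OF this \<xi>F W]
    have "expectation (\<lambda>\<omega>. W \<omega> * \<xi> (Y \<omega>)) = expectation (\<lambda>\<omega>. \<xi> (Y \<omega>) * real_cond_exp M ?F W \<omega>)"
      by (simp add: mult.commute)
    also have "\<dots> = expectation (\<lambda>\<omega>. max (- C) (min C (\<zeta> (Y \<omega>))) * \<xi> (Y \<omega>))"
      by (rule integral_cong_AE) (use AE in \<open>auto elim: eventually_mono\<close>)
    finally show "expectation (\<lambda>\<omega>. W \<omega> * \<xi> (Y \<omega>)) = expectation (\<lambda>\<omega>. max (- C) (min C (\<zeta> (Y \<omega>))) * \<xi> (Y \<omega>))" .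
  qed measurable
qed

text \<open>The hypothesis \<open>zero\<close> says that the conditional expectation of
  \<open>W\<close> given \<open>Y\<close> vanishes; a bounded function of \<open>Y\<close> can be
  pulled out of it.\<close>

lemma integral_zero_from_indicators:
  fixes W Y :: "'a \<Rightarrow> real" and \<phi> :: "real \<Rightarrow> real"
  assumes W: "integrable M W" and Y[measurable]: "Y \<in> borel_measurable M"
    and zero: "\<And>A. A \<in> sets borel \<Longrightarrow> expectation (\<lambda>\<omega>. W \<omega> * indicator A (Y \<omega>)) = 0"
    and \<phi>[measurable]: "\<phi> \<in> borel_measurable borel" and \<phi>B: "\<And>y. \<bar>\<phi> y\<bar> \<le> B"
  shows "expectation (\<lambda>\<omega>. W \<omega> * \<phi> (Y \<omega>)) = 0"
proof -
  let ?F = "vimage_algebra (space M) Y borel"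
  interpret F: sigma_finite_subalgebra M ?F
    by (intro sigma_finite_subalgebraI subalgebra_vimage Y)
  have AE: "AE \<omega> in M. real_cond_exp M ?F W \<omega> = 0"
  proof (rule F.real_cond_exp_charact[OF _ W])
    fix A assume "A \<in> sets ?F"
    then obtain A' where A': "A' \<in> sets borel" "A = Y -` A' \<inter> space M"
      by (auto simp: sets_vimage_algebra2)
    have "(\<integral>\<omega>\<in>A. W \<omega> \<partial>M) = expectation (\<lambda>\<omega>. W \<omega> * indicator A' (Y \<omega>))"
      unfolding set_lebesgue_integral_def
      by (intro Bochner_Integration.integral_cong) (auto simp: A' indicator_def)
    then show "(\<integral>\<omega>\<in>A. W \<omega> \<partial>M) = (\<integral>\<omega>\<in>A. 0 \<partial>M)"
      using zero[OF A'(1)] by (simp add: set_lebesgue_integral_def)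
  qed auto
  note W' = borel_measurable_integrable[OF W]
  have "integrable M (\<lambda>\<omega>. B * norm (W \<omega>))" using W by simp
  then have "integrable M (\<lambda>\<omega>. \<phi> (Y \<omega>) * W \<omega>)"
    by (rule Bochner_Integration.integrable_bound) (use W' in \<open>auto simp: abs_mult intro!: mult_right_mono order_trans[OF \<phi>B abs_ge_self]\<close>)
  moreover have "(\<lambda>\<omega>. \<phi> (Y \<omega>)) \<in> borel_measurable ?F"
    by (rule measurable_compose[OF measurable_vimage_algebra1 \<phi>]) auto
  ultimately have "expectation (\<lambda>\<omega>. \<phi> (Y \<omega>) * real_cond_exp M ?F W \<omega>) = expectation (\<lambda>\<omega>. \<phi> (Y \<omega>) * W \<omega>)"
    using W' by (intro F.real_cond_exp_intg(2))
  moreover have "expectation (\<lambda>\<omega>. \<phi> (Y \<omega>) * real_cond_exp M ?F W \<omega>) = expectation (\<lambda>\<omega>. 0)"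
    by (rule integral_cong_AE) (use AE in \<open>auto elim: eventually_mono\<close>)
  ultimately show ?thesis by (simp add: mult.commute)
qed

end

section \<open>The chain, its past and its transition operator\<close>

locale stationary_reversible_chain = prob_space M for M :: "'a measure" +
  fixes X :: "int \<Rightarrow> 'a \<Rightarrow> real"
  assumes stationary: "stationary_process M X"
    and markov: "markov_chain M X"
    and rev: "reversible M X"
begin

lemma X_measurable [measurable]: "X k \<in> borel_measurable M"
  using stationary by (simp add: stationary_process_def)

text \<open>Two coordinates are read off the joint law over the set \<open>{i, j}\<close>, which
  also covers i = j.\<close>

lemma stationary_pair:
  fixes h :: "real \<times> real \<Rightarrow> real"
  assumes [measurable]: "h \<in> borel_measurable (borel \<Otimes>\<^sub>M borel)"
  shows "expectation (\<lambda>\<omega>. h (X (i + k) \<omega>, X (j + k) \<omega>)) = expectation (\<lambda>\<omega>. h (X i \<omega>, X j \<omega>))"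
proof -
  let ?P = "PiM {i, j} (\<lambda>_. borel :: real measure)"
  have eq: "distr M ?P (\<lambda>\<omega>. \<lambda>l\<in>{i, j}. X (l + k) \<omega>) = distr M ?P (\<lambda>\<omega>. \<lambda>l\<in>{i, j}. X l \<omega>)"
    using stationary by (simp add: stationary_process_def)
  have m: "(\<lambda>f. h (f i, f j)) \<in> borel_measurable ?P" by measurable
  have "expectation (\<lambda>\<omega>. h (X (i + k) \<omega>, X (j + k) \<omega>))
     = (\<integral>f. h (f i, f j) \<partial>distr M ?P (\<lambda>\<omega>. \<lambda>l\<in>{i, j}. X (l + k) \<omega>))"
    by (subst integral_distr[OF _ m]) auto
  also have "\<dots> = expectation (\<lambda>\<omega>. h (X i \<omega>, X j \<omega>))"
    unfolding eq by (subst integral_distr[OF _ m]) auto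
  finally show ?thesis .
qed

lemma stationary_prod:
  fixes \<phi> \<psi> :: "real \<Rightarrow> real"
  assumes [measurable]: "\<phi> \<in> borel_measurable borel" "\<psi> \<in> borel_measurable borel"
  shows "expectation (\<lambda>\<omega>. \<phi> (X (i + k) \<omega>) * \<psi> (X (j + k) \<omega>)) = expectation (\<lambda>\<omega>. \<phi> (X i \<omega>) * \<psi> (X j \<omega>))"
  using stationary_pair[of "\<lambda>(a, b). \<phi> a * \<psi> b" i k j] by simp

lemma stationary_single:
  fixes \<phi> :: "real \<Rightarrow> real"
  assumes "\<phi> \<in> borel_measurable borel"
  shows "expectation (\<lambda>\<omega>. \<phi> (X k \<omega>)) = expectation (\<lambda>\<omega>. \<phi> (X 0 \<omega>))"
  using stationary_prod[OF assms, of "\<lambda>_. 1" 0 k 0] by simp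

lemma reversible_prod:
  fixes \<phi> \<psi> :: "real \<Rightarrow> real"
  assumes [measurable]: "\<phi> \<in> borel_measurable borel" "\<psi> \<in> borel_measurable borel"
  shows "expectation (\<lambda>\<omega>. \<phi> (X 0 \<omega>) * \<psi> (X 1 \<omega>)) = expectation (\<lambda>\<omega>. \<phi> (X 1 \<omega>) * \<psi> (X 0 \<omega>))"
proof -
  have m: "(\<lambda>(a, b). \<phi> a * \<psi> b) \<in> borel_measurable (borel \<Otimes>\<^sub>M borel)" by measurable
  have "expectation (\<lambda>\<omega>. \<phi> (X 0 \<omega>) * \<psi> (X 1 \<omega>)) = (\<integral>(a, b). \<phi> a * \<psi> b \<partial>distr M (borel \<Otimes>\<^sub>M borel) (\<lambda>\<omega>. (X 0 \<omega>, X 1 \<omega>)))"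
    by (subst integral_distr[OF _ m]) auto
  also have "\<dots> = expectation (\<lambda>\<omega>. \<phi> (X 1 \<omega>) * \<psi> (X 0 \<omega>))"
    using rev unfolding reversible_def by (simp, subst integral_distr[OF _ m]) auto
  finally show ?thesis .
qed

abbreviation past :: "int \<Rightarrow> 'a measure" where "past \<equiv> past_algebra M X"

lemma space_past [simp]: "space (past k) = space M"
  and sets_past: "sets (past k) = sigma_sets (space M) (\<Union>j\<in>{..k}. {X j -` A \<inter> space M | A. A \<in> sets borel})"
  by (auto simp: past_algebra_def space_measure_of_conv intro!: sets_measure_of)

lemma subalgebra_past: "subalgebra M (past k)"
  unfolding subalgebra_def sets_past by (auto intro!: sets.sigma_sets_subset)

lemma past_mono: "j \<le> k \<Longrightarrow> sets (past j) \<subseteq> sets (past k)"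
  unfolding sets_past by (rule sigma_sets_mono') force

lemma X_past: "j \<le> k \<Longrightarrow> X j \<in> borel_measurable (past k)"
  by (rule measurableI) (auto simp: sets_past)

text \<open>The transition operator applied to \<open>\<phi>\<close>, as one Borel function that
  serves all times. It is defined by the regression of \<open>\<phi> (X 1)\<close> on
  \<open>X 0\<close>. A past variable \<open>Z\<close> is replaced by its regression
  \<open>\<zeta> (X k)\<close>, which the Markov property allows; what remains involves two
  consecutive times only and is moved to times 0 and 1 by stationarity.\<close>

lemma markov_operator:
  fixes \<phi> :: "real \<Rightarrow> real"
  assumes \<phi>[measurable]: "\<phi> \<in> borel_measurable borel" and \<phi>C: "\<And>y. \<bar>\<phi> y\<bar> \<le> C"
  obtains \<psi> :: "real \<Rightarrow> real" where "\<psi> \<in> borel_measurable borel" "\<And>y. \<bar>\<psi> y\<bar> \<le> C"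
    "\<And>k Z D. Z \<in> borel_measurable (past k) \<Longrightarrow> (\<And>\<omega>. \<bar>Z \<omega>\<bar> \<le> D) \<Longrightarrow>
      expectation (\<lambda>\<omega>. Z \<omega> * \<phi> (X (k + 1) \<omega>)) = expectation (\<lambda>\<omega>. Z \<omega> * \<psi> (X k \<omega>))"
proof -
  obtain \<psi> :: "real \<Rightarrow> real" where \<psi>[measurable]: "\<psi> \<in> borel_measurable borel" and \<psi>C: "\<And>y. \<bar>\<psi> y\<bar> \<le> C"
    and \<psi>I: "\<And>\<xi> D. \<xi> \<in> borel_measurable borel \<Longrightarrow> (\<And>y. \<bar>\<xi> y\<bar> \<le> D) \<Longrightarrow>
      expectation (\<lambda>\<omega>. \<phi> (X 1 \<omega>) * \<xi> (X 0 \<omega>)) = expectation (\<lambda>\<omega>. \<psi> (X 0 \<omega>) * \<xi> (X 0 \<omega>))"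
    using bounded_factor[of "\<lambda>\<omega>. \<phi> (X 1 \<omega>)" C "X 0"] \<phi>C by (auto; blast)
  have key: "expectation (\<lambda>\<omega>. Z \<omega> * \<phi> (X (k + 1) \<omega>)) = expectation (\<lambda>\<omega>. Z \<omega> * \<psi> (X k \<omega>))"
    if ZF: "Z \<in> borel_measurable (past k)" and ZD: "\<And>\<omega>. \<bar>Z \<omega>\<bar> \<le> D" for k Z D
  proof -
    have Z[measurable]: "Z \<in> borel_measurable M" by (rule measurable_from_subalg[OF subalgebra_past ZF])
    obtain \<zeta> :: "real \<Rightarrow> real" where \<zeta>[measurable]: "\<zeta> \<in> borel_measurable borel" and \<zeta>D: "\<And>y. \<bar>\<zeta> y\<bar> \<le> D"
      and \<zeta>I: "\<And>\<xi> E. \<xi> \<in> borel_measurable borel \<Longrightarrow> (\<And>y. \<bar>\<xi> y\<bar> \<le> E) \<Longrightarrow>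
        expectation (\<lambda>\<omega>. Z \<omega> * \<xi> (X k \<omega>)) = expectation (\<lambda>\<omega>. \<zeta> (X k \<omega>) * \<xi> (X k \<omega>))"
      using bounded_factor[of Z D "X k"] ZD by (auto; blast)
    have iZ: "integrable M Z" "integrable M (\<lambda>\<omega>. \<zeta> (X k \<omega>))"
      using ZD \<zeta>D by (auto intro!: bounded_integrable)
    have D0: "D \<ge> 0" using ZD[of undefined] by linarith
    have C0: "C \<ge> 0" using \<phi>C[of 0] by linarith
    let ?V = "vimage_algebra (space M) (X k) borel"
    interpret V: sigma_finite_subalgebra M ?V
      by (intro sigma_finite_subalgebraI subalgebra_vimage X_measurable)
    interpret P: sigma_finite_subalgebra M "past k"
      by (intro sigma_finite_subalgebraI subalgebra_past)
    \<comment> \<open>Given the past, the event has conditional probability \<open>p (X k)\<close>,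
      and against a function of \<open>X k\<close> the variables \<open>Z\<close> and
      \<open>\<zeta> (X k)\<close> have the same integral.\<close>
    have ind: "expectation (\<lambda>\<omega>. (Z \<omega> - \<zeta> (X k \<omega>)) * indicator A (X (k + 1) \<omega>)) = 0"
      if A[measurable]: "A \<in> sets borel" for A
    proof -
      let ?I = "\<lambda>\<omega>. indicator A (X (k + 1) \<omega>) :: real"
      have AE: "AE \<omega> in M. real_cond_exp M (past k) ?I \<omega> = real_cond_exp M ?V ?I \<omega>"
        using markov A by (simp add: markov_chain_def)
      obtain p :: "real \<Rightarrow> real" where p[measurable]: "p \<in> borel_measurable borel" "\<And>y. \<bar>p y\<bar> \<le> 1"
        and pI: "\<And>\<xi> E. \<xi> \<in> borel_measurable borel \<Longrightarrow> (\<And>y. \<bar>\<xi> y\<bar> \<le> E) \<Longrightarrow>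
          expectation (\<lambda>\<omega>. ?I \<omega> * \<xi> (X k \<omega>)) = expectation (\<lambda>\<omega>. p (X k \<omega>) * \<xi> (X k \<omega>))"
        using bounded_factor[of ?I 1 "X k"] by (auto simp: indicator_def; blast)
      have pV: "AE \<omega> in M. real_cond_exp M ?V ?I \<omega> = p (X k \<omega>)"
      proof (rule V.real_cond_exp_charact)
        fix B assume "B \<in> sets ?V"
        then obtain B' where B'[measurable]: "B' \<in> sets borel" and B: "B = X k -` B' \<inter> space M"
          by (auto simp: sets_vimage_algebra2)
        have *: "(\<integral>\<omega>\<in>B. h \<omega> \<partial>M) = expectation (\<lambda>\<omega>. h \<omega> * indicator B' (X k \<omega>))" for h :: "'a \<Rightarrow> real"
          unfolding set_lebesgue_integral_def
          by (intro Bochner_Integration.integral_cong) (auto simp: B indicator_def)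
        show "(\<integral>\<omega>\<in>B. ?I \<omega> \<partial>M) = (\<integral>\<omega>\<in>B. p (X k \<omega>) \<partial>M)"
          unfolding * by (rule pI[of _ 1]) (auto simp: indicator_def)
      next
        show "integrable M ?I" by (rule bounded_integrable[of _ 1]) (auto simp: indicator_def)
        show "integrable M (\<lambda>\<omega>. p (X k \<omega>))" by (rule bounded_integrable[of _ 1]) (auto simp: p)
        show "(\<lambda>\<omega>. p (X k \<omega>)) \<in> borel_measurable ?V"
          by (rule measurable_compose[OF measurable_vimage_algebra1 p(1)]) auto
      qed
      have i1: "integrable M (\<lambda>\<omega>. Z \<omega> * ?I \<omega>)"
        by (rule bounded_integrable[of _ "D * 1"]) (auto simp: abs_mult indicator_def ZD D0)
      have i2: "integrable M (\<lambda>\<omega>. \<zeta> (X k \<omega>) * ?I \<omega>)"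
        by (rule bounded_integrable[of _ "D * 1"]) (auto simp: abs_mult indicator_def \<zeta>D D0)
      have "expectation (\<lambda>\<omega>. Z \<omega> * ?I \<omega>) = expectation (\<lambda>\<omega>. Z \<omega> * real_cond_exp M (past k) ?I \<omega>)"
        by (rule P.real_cond_exp_intg(2)[OF i1 ZF, symmetric]) measurable
      also have "\<dots> = expectation (\<lambda>\<omega>. Z \<omega> * p (X k \<omega>))"
        by (rule integral_cong_AE) (use AE pV in \<open>auto elim: eventually_elim2\<close>)
      also have "\<dots> = expectation (\<lambda>\<omega>. \<zeta> (X k \<omega>) * p (X k \<omega>))"
        by (rule \<zeta>I[OF p])
      also have "\<dots> = expectation (\<lambda>\<omega>. ?I \<omega> * \<zeta> (X k \<omega>))"
        by (subst pI[OF \<zeta> \<zeta>D]) (simp add: mult.commute)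
      finally show ?thesis using i1 i2 by (simp add: left_diff_distrib mult.commute)
    qed
    have "expectation (\<lambda>\<omega>. (Z \<omega> - \<zeta> (X k \<omega>)) * \<phi> (X (k + 1) \<omega>)) = 0"
      by (rule integral_zero_from_indicators[OF _ _ ind \<phi> \<phi>C]) (use iZ in auto)
    moreover have "integrable M (\<lambda>\<omega>. Z \<omega> * \<phi> (X (k + 1) \<omega>))" "integrable M (\<lambda>\<omega>. \<zeta> (X k \<omega>) * \<phi> (X (k + 1) \<omega>))"
      by (auto intro!: bounded_integrable[of _ "D * C"] mult_mono simp: abs_mult ZD \<zeta>D \<phi>C D0)
    ultimately have "expectation (\<lambda>\<omega>. Z \<omega> * \<phi> (X (k + 1) \<omega>)) = expectation (\<lambda>\<omega>. \<zeta> (X (0 + k) \<omega>) * \<phi> (X (1 + k) \<omega>))"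
      by (simp add: left_diff_distrib add.commute)
    also have "\<dots> = expectation (\<lambda>\<omega>. \<phi> (X 1 \<omega>) * \<zeta> (X 0 \<omega>))"
      unfolding stationary_prod[OF \<zeta> \<phi>] by (simp add: mult.commute)
    also have "\<dots> = expectation (\<lambda>\<omega>. \<zeta> (X 0 \<omega>) * \<psi> (X 0 \<omega>))"
      by (subst \<psi>I[OF \<zeta> \<zeta>D]) (simp add: mult.commute)
    also have "\<dots> = expectation (\<lambda>\<omega>. \<zeta> (X (0 + k) \<omega>) * \<psi> (X (0 + k) \<omega>))"
      by (rule stationary_prod[OF \<zeta> \<psi>, symmetric])
    also have "\<dots> = expectation (\<lambda>\<omega>. Z \<omega> * \<psi> (X k \<omega>))"
      by (simp add: \<zeta>I[OF \<psi> \<psi>C])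
    finally show ?thesis .
  qed
  show thesis by (rule that[OF \<psi> \<psi>C key])
qed

end

lemma (in prob_space) expectation_cauchy_schwarz:
  fixes f g :: "'a \<Rightarrow> real"
  assumes f: "integrable M (\<lambda>\<omega>. (f \<omega>)\<^sup>2)" and g: "integrable M (\<lambda>\<omega>. (g \<omega>)\<^sup>2)"
    and fg: "integrable M (\<lambda>\<omega>. f \<omega> * g \<omega>)"
  shows "expectation (\<lambda>\<omega>. \<bar>f \<omega> * g \<omega>\<bar>) \<le>
    sqrt (expectation (\<lambda>\<omega>. (f \<omega>)\<^sup>2)) * sqrt (expectation (\<lambda>\<omega>. (g \<omega>)\<^sup>2))"
proof -
  define p q where "p = sqrt (expectation (\<lambda>\<omega>. (f \<omega>)\<^sup>2))" and "q = sqrt (expectation (\<lambda>\<omega>. (g \<omega>)\<^sup>2))"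
  have p: "p \<ge> 0" "p\<^sup>2 = expectation (\<lambda>\<omega>. (f \<omega>)\<^sup>2)" and q: "q \<ge> 0" "q\<^sup>2 = expectation (\<lambda>\<omega>. (g \<omega>)\<^sup>2)"
    by (simp_all add: p_def q_def)
  have "expectation (\<lambda>\<omega>. \<bar>f \<omega> * g \<omega>\<bar>) \<le> (p + e) * (q + e)" if "e > 0" for e
  proof -
    \<comment> \<open>The optimal weight in |f g| \<le> (a f^2 + g^2/a)/2 is q/p. Adding
      \<open>e\<close> keeps it defined and positive when a second moment vanishes; \<open>e\<close>
      is sent to 0 at the end.\<close>
    define a where "a = (q + e) / (p + e)"
    have a: "a > 0" using p q that by (simp add: a_def add_nonneg_pos)
    have pw: "\<bar>f \<omega> * g \<omega>\<bar> \<le> (a * (f \<omega>)\<^sup>2 + (g \<omega>)\<^sup>2 / a) / 2" for \<omega>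
    proof -
      have "0 \<le> (a * \<bar>f \<omega>\<bar> - \<bar>g \<omega>\<bar>)\<^sup>2 / a" using a by simp
      also have "\<dots> = a * (f \<omega>)\<^sup>2 + (g \<omega>)\<^sup>2 / a - 2 * \<bar>f \<omega> * g \<omega>\<bar>"
        using a by (simp add: power2_eq_square field_simps abs_mult)
      finally show ?thesis by simp
    qed
    have "expectation (\<lambda>\<omega>. \<bar>f \<omega> * g \<omega>\<bar>) \<le> expectation (\<lambda>\<omega>. (a * (f \<omega>)\<^sup>2 + (g \<omega>)\<^sup>2 / a) / 2)"
      using f g fg pw by (intro integral_mono) auto
    also have "\<dots> = (a * p\<^sup>2 + q\<^sup>2 / a) / 2" using f g by (simp add: p q)
    also have "\<dots> \<le> (a * (p + e)\<^sup>2 + (q + e)\<^sup>2 / a) / 2"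
      using p(1) q(1) that a by (intro divide_right_mono add_mono mult_left_mono power_mono) auto
    also have "\<dots> = (p + e) * (q + e)"
    proof -
      have "a * (p + e)\<^sup>2 = (p + e) * (q + e)" "(q + e)\<^sup>2 / a = (p + e) * (q + e)"
        using p(1) q(1) that by (simp_all add: a_def power2_eq_square add_nonneg_pos)
      then show ?thesis by (simp only: add_divide_distrib field_sum_of_halves)
    qed
    finally show ?thesis .
  qed
  moreover have "((\<lambda>e. (p + e) * (q + e)) \<longlongrightarrow> (p + 0) * (q + 0)) (at_right 0)"
    by (intro tendsto_intros)
  moreover have "\<forall>\<^sub>F e in at_right 0. e > (0::real)" by (rule eventually_at_right_less)
  ultimately have "expectation (\<lambda>\<omega>. \<bar>f \<omega> * g \<omega>\<bar>) \<le> (p + 0) * (q + 0)"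
    by (intro tendsto_lowerbound[of _ _ "at_right 0"]) (auto elim: eventually_mono)
  then show ?thesis by (simp add: p_def q_def)
qed

lemma (in prob_space) expectation_abs_le_sqrt:
  fixes f :: "'a \<Rightarrow> real"
  assumes "integrable M f" "integrable M (\<lambda>\<omega>. (f \<omega>)\<^sup>2)"
  shows "expectation (\<lambda>\<omega>. \<bar>f \<omega>\<bar>) \<le> sqrt (expectation (\<lambda>\<omega>. (f \<omega>)\<^sup>2))"
  using expectation_cauchy_schwarz[of f "\<lambda>_. 1"] assms by (simp add: prob_space)

lemma cmod_cis_diff_le: "cmod (cis a - cis b) \<le> \<bar>a - b\<bar>"
proof -
  have "cis a - cis b = cis b * (cis (a - b) - 1)"
    by (simp add: right_diff_distrib cis_mult)
  then have "cmod (cis a - cis b) = cmod (cis (a - b) - 1)"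
    by (simp add: norm_mult)
  also have "\<dots> \<le> \<bar>a - b\<bar>" using iexp_approx1[of "a - b" 0] by (simp add: cis_conv_exp)
  finally show ?thesis .
qed

section \<open>Autocovariances and the central limit bound\<close>

context stationary_reversible_chain
begin

text \<open>Not centred: a covariance only if \<open>\<phi> (X 0)\<close> has mean zero.\<close>

definition acf :: "(real \<Rightarrow> real) \<Rightarrow> nat \<Rightarrow> real" where
  "acf \<phi> k = expectation (\<lambda>\<omega>. \<phi> (X 0 \<omega>) * \<phi> (X (int k) \<omega>))"

lemma bounded_prod_integrable:
  fixes \<phi> \<psi> :: "real \<Rightarrow> real"
  assumes [measurable]: "\<phi> \<in> borel_measurable borel" "\<psi> \<in> borel_measurable borel"
    and C: "\<And>y. \<bar>\<phi> y\<bar> \<le> C" and D: "\<And>y. \<bar>\<psi> y\<bar> \<le> D"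
  shows "integrable M (\<lambda>\<omega>. \<phi> (X i \<omega>) * \<psi> (X j \<omega>))"
proof (rule bounded_integrable)
  show "\<bar>\<phi> (X i \<omega>) * \<psi> (X j \<omega>)\<bar> \<le> C * D" for \<omega>
    unfolding abs_mult using C[of 0] by (intro mult_mono C D) auto
qed measurable

lemma acf_shift:
  assumes "\<phi> \<in> borel_measurable borel" "i \<le> j"
  shows "expectation (\<lambda>\<omega>. \<phi> (X i \<omega>) * \<phi> (X j \<omega>)) = acf \<phi> (nat (j - i))"
  using stationary_prod[OF assms(1,1), of 0 i "j - i"] assms(2) by (simp add: acf_def)

lemma acf_0: "acf \<phi> 0 = expectation (\<lambda>\<omega>. (\<phi> (X 0 \<omega>))\<^sup>2)"
  by (simp add: acf_def power2_eq_square)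

lemma expectation_square:
  assumes "\<phi> \<in> borel_measurable borel"
  shows "expectation (\<lambda>\<omega>. (\<phi> (X i \<omega>))\<^sup>2) = acf \<phi> 0"
  using acf_shift[OF assms, of i i] by (simp add: power2_eq_square)

lemma acf_0_nonneg: "acf \<phi> 0 \<ge> 0"
  by (simp add: acf_0)

lemma acf_le_acf_0:
  assumes [measurable]: "\<phi> \<in> borel_measurable borel" and C: "\<And>y. \<bar>\<phi> y\<bar> \<le> C"
  shows "\<bar>acf \<phi> k\<bar> \<le> acf \<phi> 0"
proof -
  have i: "integrable M (\<lambda>\<omega>. (\<phi> (X j \<omega>))\<^sup>2)" for j
    unfolding power2_eq_square by (rule bounded_prod_integrable[OF assms(1,1) C C])
  have "\<bar>acf \<phi> k\<bar> \<le> expectation (\<lambda>\<omega>. \<bar>\<phi> (X 0 \<omega>) * \<phi> (X (int k) \<omega>)\<bar>)"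
    unfolding acf_def by (rule integral_abs_bound)
  also have "\<dots> \<le> sqrt (acf \<phi> 0) * sqrt (acf \<phi> 0)"
    using expectation_cauchy_schwarz[OF i i, of 0 "int k"] bounded_prod_integrable[OF assms(1,1) C C, of 0 "int k"]
    by (simp add: expectation_square)
  finally show ?thesis by (simp add: acf_0_nonneg)
qed

text \<open>The last term creates cross terms at lags 1 to n, bounded by the full sum of absolute
  values; that sum increases with n, so the induction can carry it as a common factor. The offset
  \<open>j\<close> is 0 for the one-step means and 1 for the observations.\<close>

lemma sum_second_moment:
  assumes \<phi>[measurable]: "\<phi> \<in> borel_measurable borel" and C: "\<And>y. \<bar>\<phi> y\<bar> \<le> C"
  shows "expectation (\<lambda>\<omega>. (\<Sum>k<n. \<phi> (X (int k + j) \<omega>))\<^sup>2) \<le> real n * (acf \<phi> 0 + 2 * (\<Sum>k=1..n. \<bar>acf \<phi> k\<bar>))"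
proof (induction n)
  case 0
  show ?case by simp
next
  case (Suc n)
  let ?S = "\<lambda>\<omega>. \<Sum>k<n. \<phi> (X (int k + j) \<omega>)" and ?Y = "\<lambda>\<omega>. \<phi> (X (int n + j) \<omega>)"
  have i: "integrable M (\<lambda>\<omega>. \<phi> (X a \<omega>) * \<phi> (X b \<omega>))" for a b
    by (rule bounded_prod_integrable[OF \<phi> \<phi> C C])
  have i2: "integrable M (\<lambda>\<omega>. (?Y \<omega>)\<^sup>2)" unfolding power2_eq_square by (rule i)
  have iS: "integrable M (\<lambda>\<omega>. (?S \<omega>)\<^sup>2)"
    unfolding power2_eq_square sum_product by (intro Bochner_Integration.integrable_sum i)
  have iSY: "integrable M (\<lambda>\<omega>. ?S \<omega> * ?Y \<omega>)"
    unfolding sum_distrib_right by (intro Bochner_Integration.integrable_sum i)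
  have SY: "expectation (\<lambda>\<omega>. ?S \<omega> * ?Y \<omega>) \<le> (\<Sum>k=1..n. \<bar>acf \<phi> k\<bar>)"
  proof -
    have "expectation (\<lambda>\<omega>. ?S \<omega> * ?Y \<omega>) = (\<Sum>k<n. acf \<phi> (n - k))"
      unfolding sum_distrib_right
      by (subst Bochner_Integration.integral_sum) (auto simp: i acf_shift of_nat_diff nat_diff_distrib intro!: sum.cong)
    also have "\<dots> = (\<Sum>k=1..n. acf \<phi> k)"
      by (rule sum.reindex_bij_witness[of _ "\<lambda>k. n - k" "\<lambda>k. n - k"]) auto
    also have "\<dots> \<le> (\<Sum>k=1..n. \<bar>acf \<phi> k\<bar>)" by (intro sum_mono) auto
    finally show ?thesis .
  qed
  have "expectation (\<lambda>\<omega>. (\<Sum>k<Suc n. \<phi> (X (int k + j) \<omega>))\<^sup>2) =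
      expectation (\<lambda>\<omega>. (?S \<omega>)\<^sup>2 + (?Y \<omega>)\<^sup>2 + 2 * (?S \<omega> * ?Y \<omega>))"
    by (simp add: power2_sum mult.assoc)
  also have "\<dots> = expectation (\<lambda>\<omega>. (?S \<omega>)\<^sup>2) + acf \<phi> 0 + 2 * expectation (\<lambda>\<omega>. ?S \<omega> * ?Y \<omega>)"
    using iS i2 iSY by (simp add: expectation_square)
  also have "\<dots> \<le> real n * (acf \<phi> 0 + 2 * (\<Sum>k=1..n. \<bar>acf \<phi> k\<bar>)) + acf \<phi> 0 + 2 * (\<Sum>k=1..n. \<bar>acf \<phi> k\<bar>)"
    using Suc SY by linarith
  also have "\<dots> = real (Suc n) * (acf \<phi> 0 + 2 * (\<Sum>k=1..n. \<bar>acf \<phi> k\<bar>))" by (simp add: algebra_simps)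
  also have "\<dots> \<le> real (Suc n) * (acf \<phi> 0 + 2 * (\<Sum>k=1..Suc n. \<bar>acf \<phi> k\<bar>))"
    by (intro mult_left_mono add_left_mono) auto
  finally show ?case .
qed

text \<open>Says that \<open>\<psi>\<close> is a version of Q \<phi>. A relation is used because
  versions are determined only up to null sets of the marginal law.\<close>

definition one_step_mean :: "(real \<Rightarrow> real) \<Rightarrow> (real \<Rightarrow> real) \<Rightarrow> bool" where
  "one_step_mean \<phi> \<psi> \<longleftrightarrow> (\<forall>k Z D. Z \<in> borel_measurable (past k) \<longrightarrow> (\<forall>\<omega>. \<bar>Z \<omega>\<bar> \<le> D) \<longrightarrow>
     expectation (\<lambda>\<omega>. Z \<omega> * \<phi> (X (k + 1) \<omega>)) = expectation (\<lambda>\<omega>. Z \<omega> * \<psi> (X k \<omega>)))"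

lemma one_step_meanD:
  assumes "one_step_mean \<phi> \<psi>" "Z \<in> borel_measurable (past k)" "\<And>\<omega>. \<bar>Z \<omega>\<bar> \<le> D"
  shows "expectation (\<lambda>\<omega>. Z \<omega> * \<phi> (X (k + 1) \<omega>)) = expectation (\<lambda>\<omega>. Z \<omega> * \<psi> (X k \<omega>))"
  using assms unfolding one_step_mean_def by blast

lemma one_step_mean_exists:
  fixes \<phi> :: "real \<Rightarrow> real"
  assumes "\<phi> \<in> borel_measurable borel" "\<And>y. \<bar>\<phi> y\<bar> \<le> C"
  shows "\<exists>\<psi>\<in>borel_measurable borel. (\<forall>y. \<bar>\<psi> y\<bar> \<le> C) \<and> one_step_mean \<phi> \<psi>"
proof -
  obtain \<psi> :: "real \<Rightarrow> real" where "\<psi> \<in> borel_measurable borel" "\<And>y. \<bar>\<psi> y\<bar> \<le> C"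
    "\<And>k Z D. Z \<in> borel_measurable (past k) \<Longrightarrow> (\<And>\<omega>. \<bar>Z \<omega>\<bar> \<le> D) \<Longrightarrow>
      expectation (\<lambda>\<omega>. Z \<omega> * \<phi> (X (k + 1) \<omega>)) = expectation (\<lambda>\<omega>. Z \<omega> * \<psi> (X k \<omega>))"
    by (rule markov_operator[OF assms]) blast
  then show ?thesis unfolding one_step_mean_def by (intro bexI[of _ \<psi>]) auto
qed

text \<open>Powers of the transition operator. The last transition is averaged out first, with
  \<open>Z\<close> regarded as a variable of a later past; the bound \<open>C\<close> survives every
  step.\<close>

lemma iterated_mean_exists:
  fixes \<phi> :: "real \<Rightarrow> real"
  assumes "\<phi> \<in> borel_measurable borel" "\<And>y. \<bar>\<phi> y\<bar> \<le> C"
  shows "\<exists>\<psi>\<in>borel_measurable borel. (\<forall>y. \<bar>\<psi> y\<bar> \<le> C) \<and>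
    (\<forall>k Z D. Z \<in> borel_measurable (past k) \<longrightarrow> (\<forall>\<omega>. \<bar>Z \<omega>\<bar> \<le> D) \<longrightarrow>
     expectation (\<lambda>\<omega>. Z \<omega> * \<phi> (X (k + int n) \<omega>)) = expectation (\<lambda>\<omega>. Z \<omega> * \<psi> (X k \<omega>)))"
  using assms
proof (induction n arbitrary: \<phi>)
  case 0
  then show ?case by (intro bexI[of _ \<phi>]) auto
next
  case (Suc n)
  obtain \<psi> where \<psi>: "\<psi> \<in> borel_measurable borel" "\<And>y. \<bar>\<psi> y\<bar> \<le> C" "one_step_mean \<phi> \<psi>"
    using one_step_mean_exists[OF Suc.prems] by blast
  have step: "expectation (\<lambda>\<omega>. Z \<omega> * \<phi> (X (k + int (Suc n)) \<omega>)) = expectation (\<lambda>\<omega>. Z \<omega> * \<psi> (X (k + int n) \<omega>))"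
    if "Z \<in> borel_measurable (past k)" "\<forall>\<omega>. \<bar>Z \<omega>\<bar> \<le> D" for k Z D
  proof -
    have "Z \<in> borel_measurable (past (k + int n))"
      using that(1) past_mono[of k "k + int n"] by (auto simp: measurable_def)
    from one_step_meanD[OF \<psi>(3) this, of D] that(2) show ?thesis by (simp add: ac_simps)
  qed
  show ?case using Suc.IH[OF \<psi>(1,2)] step by simp
qed

text \<open>Reversibility turns \<open>\<langle>Q \<phi>, Q\<^sup>k Q \<phi>\<rangle>\<close> into \<open>\<langle>\<phi>, Q\<^bsup>k+2\<^esup> \<phi>\<rangle>\<close>.\<close>

lemma acf_one_step_mean:
  assumes \<phi>[measurable]: "\<phi> \<in> borel_measurable borel" and \<phi>C: "\<And>y. \<bar>\<phi> y\<bar> \<le> C"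
    and \<psi>[measurable]: "\<psi> \<in> borel_measurable borel" and \<psi>C: "\<And>y. \<bar>\<psi> y\<bar> \<le> C"
    and mean: "one_step_mean \<phi> \<psi>"
  shows "acf \<psi> k = acf \<phi> (k + 2)"
proof -
  have comp: "(\<lambda>\<omega>. \<xi> (X i \<omega>)) \<in> borel_measurable (past j)"
    if "\<xi> \<in> borel_measurable borel" "i \<le> j" for \<xi> :: "real \<Rightarrow> real" and i j
    by (rule measurable_compose[OF X_past that(1)]) fact
  \<comment> \<open>\<open>\<theta>\<close> plays the role of Q^(k+1) \<phi>.\<close>
  obtain \<theta> where \<theta>[measurable]: "\<theta> \<in> borel_measurable borel" and \<theta>C: "\<And>y. \<bar>\<theta> y\<bar> \<le> C"
    and \<theta>I: "\<And>i Z D. Z \<in> borel_measurable (past i) \<Longrightarrow> \<forall>\<omega>. \<bar>Z \<omega>\<bar> \<le> D \<Longrightarrow>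
     expectation (\<lambda>\<omega>. Z \<omega> * \<phi> (X (i + int (k + 1)) \<omega>)) = expectation (\<lambda>\<omega>. Z \<omega> * \<theta> (X i \<omega>))"
    using iterated_mean_exists[OF \<phi> \<phi>C, of "k + 1"] by blast
  have "acf \<phi> (k + 2) = expectation (\<lambda>\<omega>. \<phi> (X (-1) \<omega>) * \<phi> (X (0 + int (k + 1)) \<omega>))"
    by (subst acf_shift) (auto simp: nat_add_distrib)
  also have "\<dots> = expectation (\<lambda>\<omega>. \<phi> (X (-1) \<omega>) * \<theta> (X 0 \<omega>))"
    by (rule \<theta>I[OF comp]) (auto intro: \<phi>C)
  also have "\<dots> = expectation (\<lambda>\<omega>. \<phi> (X 0 \<omega>) * \<theta> (X 1 \<omega>))"
    using stationary_prod[OF \<phi> \<theta>, of "-1" 1 0] by simp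
  \<comment> \<open>Here reversibility acts: the factor \<open>\<phi>\<close>, which was in the past
    of the other one, now stands at the later time and can be averaged to \<open>\<psi>\<close>.
    Undoing \<open>\<theta>\<close> and averaging once more treats the second factor.\<close>
  also have "\<dots> = expectation (\<lambda>\<omega>. \<theta> (X 0 \<omega>) * \<phi> (X (0 + 1) \<omega>))"
    unfolding reversible_prod[OF \<phi> \<theta>] by (simp add: mult.commute)
  also have "\<dots> = expectation (\<lambda>\<omega>. \<theta> (X 0 \<omega>) * \<psi> (X 0 \<omega>))"
    by (rule one_step_meanD[OF mean comp \<theta>C]) auto
  also have "\<dots> = expectation (\<lambda>\<omega>. \<psi> (X 0 \<omega>) * \<theta> (X 0 \<omega>))"
    by (simp add: mult.commute)
  also have "\<dots> = expectation (\<lambda>\<omega>. \<psi> (X 0 \<omega>) * \<phi> (X (0 + int (k + 1)) \<omega>))"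
    by (rule \<theta>I[OF comp, symmetric]) (auto intro: \<psi>C)
  also have "\<dots> = expectation (\<lambda>\<omega>. \<psi> (X 0 \<omega>) * \<phi> (X (int k + 1) \<omega>))"
    by (simp add: add.commute)
  also have "\<dots> = acf \<psi> k"
    unfolding acf_def by (rule one_step_meanD[OF mean comp \<psi>C]) auto
  finally show ?thesis by simp
qed

text \<open>The lag-two value is the second moment of Q \<phi> at \<open>X 0\<close>, hence
  nonnegative; the later lags are autocovariances of Q \<phi>, so Cauchy-Schwarz bounds them by
  it.\<close>

lemma acf_2_bounds:
  assumes "\<phi> \<in> borel_measurable borel" "\<And>y. \<bar>\<phi> y\<bar> \<le> C"
  shows "acf \<phi> 2 \<ge> 0" "\<bar>acf \<phi> (k + 2)\<bar> \<le> acf \<phi> 2"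
proof -
  obtain \<psi> where \<psi>: "\<psi> \<in> borel_measurable borel" "\<And>y. \<bar>\<psi> y\<bar> \<le> C" "one_step_mean \<phi> \<psi>"
    using one_step_mean_exists[OF assms] by blast
  note eq = acf_one_step_mean[OF assms \<psi>]
  have eq0: "acf \<psi> 0 = acf \<phi> 2" using eq[of 0] by (simp only: add_0)
  show "acf \<phi> 2 \<ge> 0" using acf_0_nonneg[of \<psi>] eq0 by simp
  show "\<bar>acf \<phi> (k + 2)\<bar> \<le> acf \<phi> 2"
    using acf_le_acf_0[OF \<psi>(1,2), of k] eq0 eq[of k] by simp
qed

text \<open>The increments \<open>d k\<close> are the observations minus their one-step means. Three
  errors are collected: the martingale bound itself; the replacement of the squared increments by
  squares of \<open>\<phi>\<close>, with the cross term bounded by Cauchy-Schwarz through lags 0 and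
  2; and the dropped one-step means, bounded in L^2 by covariances from lag 2 on.\<close>

lemma clt_bound:
  assumes \<phi>[measurable]: "\<phi> \<in> borel_measurable borel" and \<phi>C: "\<And>y. \<bar>\<phi> y\<bar> \<le> C"
    and "n > 0" and small: "2 * C / sqrt n \<le> 1" and "s \<ge> 0"
  shows "cmod (expectation (\<lambda>\<omega>. cis ((\<Sum>k<n. \<phi> (X (int k + 1) \<omega>)) / sqrt n)) - of_real (exp (- s / 2)))
    \<le> exp ((s + 2) / 2) * (4 * (2 * C / sqrt n) * (s + 2) +
         2 * (expectation (\<lambda>\<omega>. \<bar>(\<Sum>k<n. (\<phi> (X (int k + 1) \<omega>))\<^sup>2) / n - s\<bar>)
              + 2 * (sqrt (acf \<phi> 0) * sqrt (acf \<phi> 2)) + acf \<phi> 2))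
      + sqrt (acf \<phi> 2 + 2 * (\<Sum>k=1..n. \<bar>acf \<phi> (k + 2)\<bar>))"
proof -
  obtain \<psi> where \<psi>[measurable]: "\<psi> \<in> borel_measurable borel" and \<psi>C: "\<And>y. \<bar>\<psi> y\<bar> \<le> C" and mean: "one_step_mean \<phi> \<psi>"
    using one_step_mean_exists[OF \<phi> \<phi>C] by blast
  note \<psi>acf = acf_one_step_mean[OF \<phi> \<phi>C \<psi> \<psi>C mean]
  have \<psi>acf0: "acf \<psi> 0 = acf \<phi> 2" using \<psi>acf[of 0] by (simp only: add_0)
  have n: "real n > 0" using \<open>n > 0\<close> by simp
  define d where "d k \<omega> = (\<phi> (X (int k + 1) \<omega>) - \<psi> (X (int k) \<omega>)) / sqrt n" for k \<omega>
  define F where "F k = past (int k)" for k :: nat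
  let ?V = "\<lambda>\<omega>. \<Sum>k<n. (d k \<omega>)\<^sup>2"
  have [measurable]: "d k \<in> borel_measurable M" for k unfolding d_def by measurable
  have comp: "(\<lambda>\<omega>. \<xi> (X i \<omega>)) \<in> borel_measurable (past j)"
    if "\<xi> \<in> borel_measurable borel" "i \<le> j" for \<xi> :: "real \<Rightarrow> real" and i j
    by (rule measurable_compose[OF X_past that(1)]) fact
  have m: "cmod (expectation (\<lambda>\<omega>. cis (\<Sum>k<n. d k \<omega>)) - of_real (exp (- s / 2)))
     \<le> exp ((s + 2) / 2) * (4 * (2 * C / sqrt n) * (s + 2) + 2 * expectation (\<lambda>\<omega>. \<bar>?V \<omega> - s\<bar>))"
  proof (rule martingale_cis_bound[of F])
    show "subalgebra M (F k)" for k unfolding F_def by (rule subalgebra_past)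
    show "sets (F j) \<subseteq> sets (F k)" if "j \<le> k" for j k unfolding F_def using that by (intro past_mono) simp
    show "d k \<in> borel_measurable (F (Suc k))" for k
      unfolding d_def F_def by (intro borel_measurable_divide borel_measurable_diff comp \<phi> \<psi>) auto
    show "\<bar>d k \<omega>\<bar> \<le> 2 * C / sqrt n" for k \<omega>
      using \<phi>C[of "X (int k + 1) \<omega>"] \<psi>C[of "X (int k) \<omega>"] n
      by (auto simp: d_def divide_right_mono abs_divide)
    show "expectation (\<lambda>\<omega>. Z \<omega> * d k \<omega>) = 0" if Z: "Z \<in> borel_measurable (F k)" "\<And>\<omega>. \<bar>Z \<omega>\<bar> \<le> B" for k Z B
    proof -
      note ZM = measurable_from_subalg[OF subalgebra_past Z(1)[unfolded F_def]]
      have "integrable M (\<lambda>\<omega>. Z \<omega> * \<xi> (X j \<omega>))" if "\<xi> \<in> borel_measurable borel" "\<And>y. \<bar>\<xi> y\<bar> \<le> C" for \<xi> j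
      proof (rule bounded_integrable)
        show "\<bar>Z \<omega> * \<xi> (X j \<omega>)\<bar> \<le> B * C" for \<omega>
          unfolding abs_mult using Z(2)[of \<omega>] by (intro mult_mono Z that) auto
      qed (use ZM that(1) in measurable)
      from this[OF \<phi> \<phi>C] this[OF \<psi> \<psi>C]
      have "expectation (\<lambda>\<omega>. Z \<omega> * d k \<omega>) =
        (expectation (\<lambda>\<omega>. Z \<omega> * \<phi> (X (int k + 1) \<omega>)) - expectation (\<lambda>\<omega>. Z \<omega> * \<psi> (X (int k) \<omega>))) / sqrt n"
        by (simp add: d_def right_diff_distrib)
      then show ?thesis using one_step_meanD[OF mean Z(1)[unfolded F_def] Z(2)] by simp
    qed
  qed fact+
  have isq: "integrable M (\<lambda>\<omega>. (\<xi> (X j \<omega>))\<^sup>2)" if "\<xi> \<in> borel_measurable borel" "\<And>y. \<bar>\<xi> y\<bar> \<le> C" for \<xi> j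
    unfolding power2_eq_square by (rule bounded_prod_integrable[OF that(1,1) that(2,2)])
  have i\<phi>\<psi>: "integrable M (\<lambda>\<omega>. \<phi> (X i \<omega>) * \<psi> (X j \<omega>))" for i j
    by (rule bounded_prod_integrable[OF \<phi> \<psi> \<phi>C \<psi>C])
  define A where "A \<omega> = (\<Sum>k<n. (\<phi> (X (int k + 1) \<omega>))\<^sup>2) / n" for \<omega>
  define R where "R k \<omega> = 2 * \<bar>\<phi> (X (int k + 1) \<omega>) * \<psi> (X (int k) \<omega>)\<bar> + (\<psi> (X (int k) \<omega>))\<^sup>2" for k \<omega>
  have iR: "integrable M (R k)" for k unfolding R_def[abs_def] using isq[OF \<psi> \<psi>C] i\<phi>\<psi> by simp
  have iA: "integrable M A" unfolding A_def[abs_def] using isq[OF \<phi> \<phi>C] by simp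
  have Vpw: "\<bar>?V \<omega> - s\<bar> \<le> \<bar>A \<omega> - s\<bar> + (\<Sum>k<n. R k \<omega>) / n" for \<omega>
  proof -
    have "?V \<omega> = (\<Sum>k<n. (\<phi> (X (int k + 1) \<omega>))\<^sup>2 - 2 * (\<phi> (X (int k + 1) \<omega>) * \<psi> (X (int k) \<omega>)) + (\<psi> (X (int k) \<omega>))\<^sup>2) / n"
      using n unfolding sum_divide_distrib
      by (intro sum.cong refl) (simp add: d_def power_divide power2_diff mult.assoc)
    then have "?V \<omega> - s = (A \<omega> - s) + (\<Sum>k<n. - 2 * (\<phi> (X (int k + 1) \<omega>) * \<psi> (X (int k) \<omega>)) + (\<psi> (X (int k) \<omega>))\<^sup>2) / n"
      by (simp add: A_def sum.distrib sum_subtractf sum_negf add_divide_distrib diff_divide_distrib)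
    also have "\<bar>\<dots>\<bar> \<le> \<bar>A \<omega> - s\<bar> + \<bar>\<Sum>k<n. - 2 * (\<phi> (X (int k + 1) \<omega>) * \<psi> (X (int k) \<omega>)) + (\<psi> (X (int k) \<omega>))\<^sup>2\<bar> / n"
      by (rule order_trans[OF abs_triangle_ineq]) simp
    also have "\<bar>\<Sum>k<n. - 2 * (\<phi> (X (int k + 1) \<omega>) * \<psi> (X (int k) \<omega>)) + (\<psi> (X (int k) \<omega>))\<^sup>2\<bar> \<le> (\<Sum>k<n. R k \<omega>)"
      by (rule order_trans[OF sum_abs]) (intro sum_mono order_trans[OF abs_triangle_ineq], simp add: R_def abs_mult)
    finally show ?thesis using n by (simp add: divide_right_mono)
  qed
  have R_nonneg: "R k \<omega> \<ge> 0" for k \<omega> by (simp add: R_def)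
  have ER: "expectation (R k) \<le> 2 * (sqrt (acf \<phi> 0) * sqrt (acf \<phi> 2)) + acf \<phi> 2" for k
  proof -
    have "expectation (R k) = 2 * expectation (\<lambda>\<omega>. \<bar>\<phi> (X (int k + 1) \<omega>) * \<psi> (X (int k) \<omega>)\<bar>) + expectation (\<lambda>\<omega>. (\<psi> (X (int k) \<omega>))\<^sup>2)"
      unfolding R_def using isq[OF \<psi> \<psi>C] i\<phi>\<psi> by simp
    then show ?thesis
      using expectation_cauchy_schwarz[OF isq[OF \<phi> \<phi>C] isq[OF \<psi> \<psi>C] i\<phi>\<psi>, of "int k + 1" "int k"] \<psi>acf0
      by (simp add: expectation_square)
  qed
  have iB: "integrable M (\<lambda>\<omega>. \<bar>A \<omega> - s\<bar>)" "integrable M (\<lambda>\<omega>. (\<Sum>k<n. R k \<omega>) / n)"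
    using iA iR by simp_all
  have "expectation (\<lambda>\<omega>. \<bar>?V \<omega> - s\<bar>) \<le> expectation (\<lambda>\<omega>. \<bar>A \<omega> - s\<bar> + (\<Sum>k<n. R k \<omega>) / n)"
    by (rule integral_mono'[OF Bochner_Integration.integrable_add[OF iB] Vpw]) (simp add: R_nonneg sum_nonneg)
  also have "\<dots> = expectation (\<lambda>\<omega>. \<bar>A \<omega> - s\<bar>) + (\<Sum>k<n. expectation (R k)) / n"
    unfolding Bochner_Integration.integral_add[OF iB] integral_divide_zero
    by (subst Bochner_Integration.integral_sum) (simp_all only: iR)
  also have "(\<Sum>k<n. expectation (R k)) / n \<le> 2 * (sqrt (acf \<phi> 0) * sqrt (acf \<phi> 2)) + acf \<phi> 2"
    using sum_mono[of "{..<n}" "\<lambda>k. expectation (R k)" "\<lambda>_. 2 * (sqrt (acf \<phi> 0) * sqrt (acf \<phi> 2)) + acf \<phi> 2"] ER n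
    by (simp add: divide_le_eq mult.commute)
  finally have EV: "expectation (\<lambda>\<omega>. \<bar>?V \<omega> - s\<bar>) \<le> expectation (\<lambda>\<omega>. \<bar>A \<omega> - s\<bar>)
     + 2 * (sqrt (acf \<phi> 0) * sqrt (acf \<phi> 2)) + acf \<phi> 2" by simp
  let ?S = "\<lambda>\<omega>. (\<Sum>k<n. \<phi> (X (int k + 1) \<omega>)) / sqrt n" and ?P = "\<lambda>\<omega>. \<Sum>k<n. \<psi> (X (int k) \<omega>)"
  have icis: "integrable M (\<lambda>\<omega>. cis (h \<omega>))" if [measurable]: "h \<in> borel_measurable M" for h
    by (rule integrable_const_bound[of _ 1]) auto
  have iP: "integrable M ?P"
    by (intro Bochner_Integration.integrable_sum bounded_integrable[of _ C]) (auto simp: \<psi>C)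
  have iP2: "integrable M (\<lambda>\<omega>. (?P \<omega>)\<^sup>2)"
    unfolding power2_eq_square sum_product
    by (intro Bochner_Integration.integrable_sum bounded_prod_integrable[OF \<psi> \<psi> \<psi>C \<psi>C])
  have "cmod (expectation (\<lambda>\<omega>. cis (?S \<omega>)) - expectation (\<lambda>\<omega>. cis (\<Sum>k<n. d k \<omega>)))
      = cmod (expectation (\<lambda>\<omega>. cis (?S \<omega>) - cis (\<Sum>k<n. d k \<omega>)))"
    by (subst Bochner_Integration.integral_diff) (auto intro!: icis)
  also have "\<dots> \<le> expectation (\<lambda>\<omega>. cmod (cis (?S \<omega>) - cis (\<Sum>k<n. d k \<omega>)))"
    by (rule integral_norm_bound)
  also have "\<dots> \<le> expectation (\<lambda>\<omega>. \<bar>?P \<omega>\<bar> / sqrt n)"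
  proof (rule integral_mono)
    show "cmod (cis (?S \<omega>) - cis (\<Sum>k<n. d k \<omega>)) \<le> \<bar>?P \<omega>\<bar> / sqrt n" for \<omega>
    proof -
      have "?S \<omega> - (\<Sum>k<n. d k \<omega>) = ?P \<omega> / sqrt n"
        by (simp add: d_def sum_divide_distrib[symmetric] sum_subtractf diff_divide_distrib)
      then show ?thesis using cmod_cis_diff_le[of "?S \<omega>" "\<Sum>k<n. d k \<omega>"] by simp
    qed
  qed (use iP in \<open>auto intro!: icis integrable_norm Bochner_Integration.integrable_diff\<close>)
  also have "\<dots> \<le> sqrt (expectation (\<lambda>\<omega>. (?P \<omega>)\<^sup>2)) / sqrt n"
    using expectation_abs_le_sqrt[OF iP iP2] n by (simp add: divide_right_mono)
  also have "\<dots> = sqrt (expectation (\<lambda>\<omega>. (?P \<omega>)\<^sup>2) / n)" by (simp add: real_sqrt_divide)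
  also have "\<dots> \<le> sqrt (acf \<phi> 2 + 2 * (\<Sum>k=1..n. \<bar>acf \<phi> (k + 2)\<bar>))"
  proof (rule real_sqrt_le_mono)
    have "expectation (\<lambda>\<omega>. (?P \<omega>)\<^sup>2) \<le> real n * (acf \<psi> 0 + 2 * (\<Sum>k=1..n. \<bar>acf \<psi> k\<bar>))"
      using sum_second_moment[OF \<psi> \<psi>C, of 0 n] by (simp only: add_0_right)
    then show "expectation (\<lambda>\<omega>. (?P \<omega>)\<^sup>2) / n \<le> acf \<phi> 2 + 2 * (\<Sum>k=1..n. \<bar>acf \<phi> (k + 2)\<bar>)"
      by (simp only: add_0 \<psi>acf pos_divide_le_eq[OF n] mult.commute[of "real n"])
  qed
  finally have D: "cmod (expectation (\<lambda>\<omega>. cis (?S \<omega>)) - expectation (\<lambda>\<omega>. cis (\<Sum>k<n. d k \<omega>)))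
     \<le> sqrt (acf \<phi> 2 + 2 * (\<Sum>k=1..n. \<bar>acf \<phi> (k + 2)\<bar>))" .
  have tri: "cmod (z1 - z3) \<le> cmod (z1 - z2) + cmod (z2 - z3)" for z1 z2 z3
    using norm_triangle_ineq[of "z1 - z2" "z2 - z3"] by simp
  have "cmod (expectation (\<lambda>\<omega>. cis (?S \<omega>)) - of_real (exp (- s / 2)))
    \<le> cmod (expectation (\<lambda>\<omega>. cis (?S \<omega>)) - expectation (\<lambda>\<omega>. cis (\<Sum>k<n. d k \<omega>)))
      + cmod (expectation (\<lambda>\<omega>. cis (\<Sum>k<n. d k \<omega>)) - of_real (exp (- s / 2)))"
    by (rule tri)
  also have "\<dots> \<le> sqrt (acf \<phi> 2 + 2 * (\<Sum>k=1..n. \<bar>acf \<phi> (k + 2)\<bar>)) +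
     exp ((s + 2) / 2) * (4 * (2 * C / sqrt n) * (s + 2) + 2 * expectation (\<lambda>\<omega>. \<bar>?V \<omega> - s\<bar>))"
    using D m by (rule add_mono)
  also have "\<dots> \<le> sqrt (acf \<phi> 2 + 2 * (\<Sum>k=1..n. \<bar>acf \<phi> (k + 2)\<bar>)) +
     exp ((s + 2) / 2) * (4 * (2 * C / sqrt n) * (s + 2) + 2 * (expectation (\<lambda>\<omega>. \<bar>A \<omega> - s\<bar>)
     + 2 * (sqrt (acf \<phi> 0) * sqrt (acf \<phi> 2)) + acf \<phi> 2))"
    using EV by (intro add_left_mono mult_left_mono) auto
  finally show ?thesis by (simp only: A_def add.commute)
qed

end

section \<open>Hoeffding's covariance formula\<close>

text \<open>The derivative need not be continuous; it is measurable as the pointwise limit of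
  difference quotients with steps 1/(n+1).\<close>

lemma borel_measurable_derivative:
  fixes g g' :: "real \<Rightarrow> real"
  assumes der: "\<And>x. (g has_real_derivative g' x) (at x)"
  shows "g \<in> borel_measurable borel" "g' \<in> borel_measurable borel"
proof -
  have "isCont g x" for x using der[of x] by (rule DERIV_isCont)
  then show g[measurable]: "g \<in> borel_measurable borel"
    by (intro borel_measurable_continuous_onI) (auto simp: continuous_on_eq_continuous_within intro: continuous_at_imp_continuous_at_within)
  show "g' \<in> borel_measurable borel"
  proof (rule borel_measurable_LIMSEQ_real)
    fix x :: real
    have "((\<lambda>h. (g (x + h) - g x) / h) \<longlongrightarrow> g' x) (at 0)"
      using der[of x] by (simp add: DERIV_def)
    moreover have "filterlim (\<lambda>n. 1 / real (Suc n)) (at 0) sequentially"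
      unfolding filterlim_at using LIMSEQ_inverse_real_of_nat by (simp add: inverse_eq_divide)
    ultimately show "(\<lambda>n. (g (x + 1 / real (Suc n)) - g x) / (1 / real (Suc n))) \<longlonglongrightarrow> g' x"
      by (rule filterlim_compose)
  qed measurable
qed

text \<open>A layer representation: the dependence on \<open>x\<close> is carried by the indicator
  of u < x, so expectations of \<open>g\<close> become integrals of tail probabilities. The
  derivative is only bounded, hence the gauge-integral form of the fundamental theorem; truncation
  at \<open>R\<close> makes the weight integrable.\<close>

lemma truncated_ftc:
  fixes g g' :: "real \<Rightarrow> real"
  assumes der: "\<And>x. (g has_real_derivative g' x) (at x)" and L: "\<And>x. \<bar>g' x\<bar> \<le> L" and "R > 0"
  shows "g (max (- R) (min R x)) = g (- R) + (\<integral>u. indicator {- R..R} u * g' u * indicator {u<..} x \<partial>lborel)"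
proof -
  note [measurable] = borel_measurable_derivative[OF der]
  let ?T = "max (- R) (min R x)"
  have T: "- R \<le> ?T" "?T \<le> R" using \<open>R > 0\<close> by auto
  have "(g' has_integral (g ?T - g (- R))) {- R..?T}"
    using T(1) der by (intro fundamental_theorem_of_calculus)
      (auto simp: has_real_derivative_iff_has_vector_derivative[symmetric] intro: has_field_derivative_at_within)
  moreover have si: "set_integrable lborel {- R..?T} g'"
    unfolding set_integrable_def
  proof (rule Bochner_Integration.integrable_bound[of _ "\<lambda>u. L * indicator {- R..?T} u"])
    show "integrable lborel (\<lambda>u. L * indicator {- R..?T} u)"
      using T by (intro integrable_mult_right integrable_real_indicator) auto
    show "AE u in lborel. norm (indicat_real {- R..?T} u *\<^sub>R g' u) \<le> norm (L * indicator {- R..?T} u)"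
      using L by (auto simp: indicator_def intro!: order_trans[OF L abs_ge_self])
  qed measurable
  ultimately have "g ?T - g (- R) = (\<integral>u. indicator {- R..?T} u * g' u \<partial>lborel)"
    using set_borel_integral_eq_integral(2)[OF si] by (simp add: integral_unique set_lebesgue_integral_def)
  also have "\<dots> = (\<integral>u. indicator {- R..R} u * g' u * indicator {u<..} x \<partial>lborel)"
  proof (rule integral_cong_AE)
    \<comment> \<open>The strict indicator and the closed intervals can disagree at these three
      points only.\<close>
    have "AE u in lborel. u \<noteq> x \<and> u \<noteq> - R \<and> u \<noteq> R"
      using AE_lborel_singleton[of x] AE_lborel_singleton[of "- R"] AE_lborel_singleton[of R] by eventually_elim auto
    then show "AE u in lborel. indicator {- R..?T} u * g' u = indicator {- R..R} u * g' u * indicator {u<..} x"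
      by eventually_elim (auto simp: indicator_def)
    show "(\<lambda>u. indicator {- R..R} u * g' u * indicator {u<..} x) \<in> borel_measurable lborel"
    proof -
      have "(\<lambda>u. indicator {- R..R} u * g' u * indicator {..<x} u) \<in> borel_measurable lborel" by measurable
      then show ?thesis by (simp add: indicator_def)
    qed
  qed measurable
  finally show ?thesis by simp
qed

text \<open>Fubini in the layer variable. \<open>W\<close> will be 1 for marginal probabilities, an
  indicator for joint ones, and the second factor of the covariance for the outer layer.\<close>

lemma (in prob_space) expectation_layer:
  fixes Y W :: "'a \<Rightarrow> real" and a :: "real \<Rightarrow> real"
  assumes Y[measurable]: "Y \<in> borel_measurable M" and W[measurable]: "W \<in> borel_measurable M"
    and WC: "\<And>\<omega>. \<bar>W \<omega>\<bar> \<le> C" and a: "integrable lborel a"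
  shows "expectation (\<lambda>\<omega>. W \<omega> * (\<integral>u. a u * indicator {u<..} (Y \<omega>) \<partial>lborel)) =
      (\<integral>u. a u * expectation (\<lambda>\<omega>. W \<omega> * indicator {u<..} (Y \<omega>)) \<partial>lborel)"
    and "integrable lborel (\<lambda>u. a u * expectation (\<lambda>\<omega>. W \<omega> * indicator {u<..} (Y \<omega>)))"
proof -
  interpret P: pair_sigma_finite M "lborel :: real measure" ..
  note am[measurable] = borel_measurable_integrable[OF a]
  have ind: "indicator {u<..} y = (if u < y then 1 else 0 :: real)" for u y :: real by (simp add: indicator_def)
  have int1: "integrable (M \<Otimes>\<^sub>M lborel) (\<lambda>p. C * \<bar>a (snd p)\<bar>)"
    by (rule P.Fubini_integrable) (use a in auto)
  have int: "integrable (M \<Otimes>\<^sub>M lborel) (\<lambda>(\<omega>, u). W \<omega> * (a u * indicator {u<..} (Y \<omega>)))"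
  proof (rule Bochner_Integration.integrable_bound[OF int1])
    show "(\<lambda>(\<omega>, u). W \<omega> * (a u * indicator {u<..} (Y \<omega>))) \<in> borel_measurable (M \<Otimes>\<^sub>M lborel)"
      unfolding ind by measurable
    have "\<bar>W \<omega> * (a u * indicator {u<..} (Y \<omega>))\<bar> \<le> C * \<bar>a u\<bar>" for \<omega> u
      using WC[of \<omega>] order_trans[OF abs_ge_zero WC[of \<omega>]] by (auto simp: ind abs_mult mult_right_mono)
    then show "AE p in M \<Otimes>\<^sub>M lborel. norm (case p of (\<omega>, u) \<Rightarrow> W \<omega> * (a u * indicator {u<..} (Y \<omega>))) \<le> norm (C * \<bar>a (snd p)\<bar>)"
      unfolding split_beta real_norm_def by (intro AE_I2 order_trans[OF _ abs_ge_self])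
  qed
  have e: "expectation (\<lambda>\<omega>. W \<omega> * (a u * indicator {u<..} (Y \<omega>))) = a u * expectation (\<lambda>\<omega>. W \<omega> * indicator {u<..} (Y \<omega>))" for u
    by (simp add: mult.left_commute[of _ "a u"])
  show "expectation (\<lambda>\<omega>. W \<omega> * (\<integral>u. a u * indicator {u<..} (Y \<omega>) \<partial>lborel)) =
      (\<integral>u. a u * expectation (\<lambda>\<omega>. W \<omega> * indicator {u<..} (Y \<omega>)) \<partial>lborel)"
    using P.Fubini_integral[OF int] by (simp add: e)
  show "integrable lborel (\<lambda>u. a u * expectation (\<lambda>\<omega>. W \<omega> * indicator {u<..} (Y \<omega>)))"
    using P.integrable_snd[OF int] by (simp add: e)
qed

text \<open>The constants \<open>g (- R)\<close> and \<open>h (- R)\<close> drop out of the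
  covariance. What is left is the double integral of the two derivatives, cut to [-R, R], against
  the difference between joint and product tail probabilities; the derivatives are then bounded by
  \<open>L\<close> and \<open>L'\<close>.\<close>

lemma (in prob_space) hoeffding_covariance_truncated:
  fixes Y Z :: "'a \<Rightarrow> real" and g h g' h' :: "real \<Rightarrow> real" and R :: real
  assumes Y[measurable]: "Y \<in> borel_measurable M" and Z[measurable]: "Z \<in> borel_measurable M"
    and g: "\<And>x. (g has_real_derivative g' x) (at x)" "\<And>x. \<bar>g' x\<bar> \<le> L"
    and h: "\<And>x. (h has_real_derivative h' x) (at x)" "\<And>x. \<bar>h' x\<bar> \<le> L'"
    and gC: "\<And>x. \<bar>g x\<bar> \<le> C" and hC: "\<And>x. \<bar>h x\<bar> \<le> C'" and "R > 0"
  defines "T \<equiv> \<lambda>x. max (- R) (min R x)"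
  shows "ennreal \<bar>expectation (\<lambda>\<omega>. g (T (Y \<omega>)) * h (T (Z \<omega>))) - expectation (\<lambda>\<omega>. g (T (Y \<omega>))) * expectation (\<lambda>\<omega>. h (T (Z \<omega>)))\<bar>
    \<le> ennreal (L * L') * (\<integral>\<^sup>+u. (\<integral>\<^sup>+v. ennreal \<bar>measure M {\<omega>\<in>space M. Y \<omega> > u \<and> Z \<omega> > v} -
        measure M {\<omega>\<in>space M. Y \<omega> > u} * measure M {\<omega>\<in>space M. Z \<omega> > v}\<bar> \<partial>lborel) \<partial>lborel)"
proof -
  note [measurable] = borel_measurable_derivative[OF g(1)] borel_measurable_derivative[OF h(1)]
  have [measurable]: "T \<in> borel_measurable borel" unfolding T_def by measurable
  define a where "a u = indicator {- R..R} u * g' u" for u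
  define b where "b v = indicator {- R..R} v * h' v" for v
  have [measurable]: "a \<in> borel_measurable borel" "b \<in> borel_measurable borel"
    unfolding a_def[abs_def] b_def[abs_def] by measurable
  have L: "L \<ge> 0" "L' \<ge> 0" using order_trans[OF abs_ge_zero g(2)] order_trans[OF abs_ge_zero h(2)] by auto
  have aL: "\<bar>a u\<bar> \<le> L" and bL: "\<bar>b u\<bar> \<le> L'" for u
    using g(2)[of u] h(2)[of u] L by (auto simp: a_def b_def indicator_def)
  have ii: "integrable lborel (\<lambda>u. c * indicator {- R..R} u :: real)" for c
    using \<open>R > 0\<close> by (intro integrable_mult_right integrable_real_indicator) auto
  have ia: "integrable lborel a"
    by (rule Bochner_Integration.integrable_bound[OF ii[of L]])
       (use g(2) in \<open>auto simp: a_def indicator_def intro: order_trans[OF _ abs_ge_self]\<close>)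
  have ib: "integrable lborel b"
    by (rule Bochner_Integration.integrable_bound[OF ii[of L']])
       (use h(2) in \<open>auto simp: b_def indicator_def intro: order_trans[OF _ abs_ge_self]\<close>)
  define A where "A \<omega> = (\<integral>u. a u * indicator {u<..} (Y \<omega>) \<partial>lborel)" for \<omega>
  define B where "B \<omega> = (\<integral>v. b v * indicator {v<..} (Z \<omega>) \<partial>lborel)" for \<omega>
  have gA: "g (T (Y \<omega>)) = g (- R) + A \<omega>" and hB: "h (T (Z \<omega>)) = h (- R) + B \<omega>" for \<omega>
    using truncated_ftc[OF g \<open>R > 0\<close>] truncated_ftc[OF h \<open>R > 0\<close>] by (simp_all add: T_def A_def B_def a_def b_def)
  have A: "A = (\<lambda>\<omega>. g (T (Y \<omega>)) - g (- R))" and B: "B = (\<lambda>\<omega>. h (T (Z \<omega>)) - h (- R))" by (auto simp: gA hB)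
  have [measurable]: "A \<in> borel_measurable M" "B \<in> borel_measurable M" unfolding A B by measurable
  have Bb: "\<bar>B \<omega>\<bar> \<le> 2 * C'" and Ab: "\<bar>A \<omega>\<bar> \<le> 2 * C" for \<omega>
    using hC[of "T (Z \<omega>)"] hC[of "- R"] gC[of "T (Y \<omega>)"] gC[of "- R"] unfolding A B by linarith+
  have iA: "integrable M A" "integrable M B" using Ab Bb by (auto intro!: bounded_integrable)
  have iAB: "integrable M (\<lambda>\<omega>. A \<omega> * B \<omega>)"
  proof (rule bounded_integrable)
    show "\<bar>A \<omega> * B \<omega>\<bar> \<le> (2 * C) * (2 * C')" for \<omega>
      unfolding abs_mult using Ab[of \<omega>] by (intro mult_mono Ab Bb) auto
  qed measurable
  let ?p = "\<lambda>u. expectation (\<lambda>\<omega>. indicator {u<..} (Y \<omega>)) :: real"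
  let ?q = "\<lambda>v. expectation (\<lambda>\<omega>. indicator {v<..} (Z \<omega>)) :: real"
  let ?r = "\<lambda>u v. expectation (\<lambda>\<omega>. indicator {u<..} (Y \<omega>) * indicator {v<..} (Z \<omega>)) :: real"
  have indm[measurable]: "(\<lambda>\<omega>. indicator {u<..} (W \<omega>) :: real) \<in> borel_measurable M" if "W \<in> borel_measurable M" for u and W :: "'a \<Rightarrow> real"
    using that by measurable
  have ind1: "\<bar>indicator S y :: real\<bar> \<le> 1" for S :: "real set" and y by (simp add: indicator_def)
  have one: "\<bar>1 :: real\<bar> \<le> 1" by simp
  have EA: "expectation A = (\<integral>u. a u * ?p u \<partial>lborel)" "integrable lborel (\<lambda>u. a u * ?p u)"
    using expectation_layer[OF Y _ one ia] by (simp_all add: A_def[abs_def])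
  have EB: "expectation B = (\<integral>v. b v * ?q v \<partial>lborel)" "integrable lborel (\<lambda>v. b v * ?q v)"
    using expectation_layer[OF Z _ one ib] by (simp_all add: B_def[abs_def])
  have EIB: "expectation (\<lambda>\<omega>. indicator {u<..} (Y \<omega>) * B \<omega>) = (\<integral>v. b v * ?r u v \<partial>lborel)"
    "integrable lborel (\<lambda>v. b v * ?r u v)" for u
    using expectation_layer[OF Z indm[OF Y] ind1 ib, of u] by (simp_all add: B_def[abs_def])
  have EAB: "expectation (\<lambda>\<omega>. A \<omega> * B \<omega>) = (\<integral>u. a u * (\<integral>v. b v * ?r u v \<partial>lborel) \<partial>lborel)"
    "integrable lborel (\<lambda>u. a u * (\<integral>v. b v * ?r u v \<partial>lborel))"
    using expectation_layer[where W=B, OF Y \<open>B \<in> borel_measurable M\<close> Bb ia] EIB(1)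
    by (simp_all add: A_def[abs_def] mult.commute)
  have "expectation (\<lambda>\<omega>. g (T (Y \<omega>)) * h (T (Z \<omega>))) - expectation (\<lambda>\<omega>. g (T (Y \<omega>))) * expectation (\<lambda>\<omega>. h (T (Z \<omega>)))
     = expectation (\<lambda>\<omega>. A \<omega> * B \<omega>) - expectation A * expectation B"
    unfolding gA hB using iA iAB by (simp add: algebra_simps prob_space)
  also have "\<dots> = (\<integral>u. a u * (\<integral>v. b v * ?r u v \<partial>lborel) \<partial>lborel) - (\<integral>u. a u * ?p u \<partial>lborel) * expectation B"
    by (simp only: EAB(1) EA(1))
  also have "\<dots> = (\<integral>u. a u * (\<integral>v. b v * ?r u v \<partial>lborel) - a u * ?p u * expectation B \<partial>lborel)"
    using EAB(2) EA(2) by simp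
  also have "\<dots> = (\<integral>u. a u * (\<integral>v. b v * (?r u v - ?p u * ?q v) \<partial>lborel) \<partial>lborel)"
  proof (intro Bochner_Integration.integral_cong refl)
    fix u
    have "(\<integral>v. b v * (?r u v - ?p u * ?q v) \<partial>lborel) = (\<integral>v. b v * ?r u v - ?p u * (b v * ?q v) \<partial>lborel)"
      by (simp add: algebra_simps)
    also have "\<dots> = (\<integral>v. b v * ?r u v \<partial>lborel) - ?p u * expectation B"
      using EIB(2) EB by simp
    finally have eq: "(\<integral>v. b v * (?r u v - ?p u * ?q v) \<partial>lborel) = (\<integral>v. b v * ?r u v \<partial>lborel) - ?p u * expectation B" .
    show "a u * (\<integral>v. b v * ?r u v \<partial>lborel) - a u * ?p u * expectation B = a u * (\<integral>v. b v * (?r u v - ?p u * ?q v) \<partial>lborel)"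
      unfolding eq by (simp only: right_diff_distrib mult.assoc)
  qed
  finally have cov: "expectation (\<lambda>\<omega>. g (T (Y \<omega>)) * h (T (Z \<omega>))) - expectation (\<lambda>\<omega>. g (T (Y \<omega>))) * expectation (\<lambda>\<omega>. h (T (Z \<omega>)))
     = (\<integral>u. a u * (\<integral>v. b v * (?r u v - ?p u * ?q v) \<partial>lborel) \<partial>lborel)" .
  \<comment> \<open>Holds for every \<open>f\<close>: a function that is not integrable has Bochner
    integral 0.\<close>
  have nb: "ennreal \<bar>\<integral>x. f x \<partial>lborel\<bar> \<le> (\<integral>\<^sup>+x. ennreal \<bar>f x\<bar> \<partial>lborel)" for f :: "real \<Rightarrow> real"
    using integral_norm_bound_ennreal[of lborel f] by (cases "integrable lborel f") (auto simp: not_integrable_integral_eq)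
  have ifs: "indicator {u<..} y = (if u < y then 1 else 0 :: real)" for u y :: real by (simp add: indicator_def)
  define H :: "real \<Rightarrow> real \<Rightarrow> real" where "H u v = ?r u v - ?p u * ?q v" for u v
  have Hm[measurable]: "(\<lambda>(u, v). H u v) \<in> borel_measurable (borel \<Otimes>\<^sub>M borel)"
    unfolding H_def ifs by measurable
  have H_eq: "H u v = measure M {\<omega>\<in>space M. Y \<omega> > u \<and> Z \<omega> > v} -
        measure M {\<omega>\<in>space M. Y \<omega> > u} * measure M {\<omega>\<in>space M. Z \<omega> > v}" for u v
  proof -
    have e: "expectation (\<lambda>\<omega>. indicator S \<omega>) = measure M S" if "S \<in> sets M" for S
      using that by simp
    have "?r u v = expectation (\<lambda>\<omega>. indicator {\<omega>\<in>space M. Y \<omega> > u \<and> Z \<omega> > v} \<omega>)"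
      "?p u = expectation (\<lambda>\<omega>. indicator {\<omega>\<in>space M. Y \<omega> > u} \<omega>)"
      "?q v = expectation (\<lambda>\<omega>. indicator {\<omega>\<in>space M. Z \<omega> > v} \<omega>)"
      by (auto intro!: Bochner_Integration.integral_cong simp: indicator_def)
    then show ?thesis unfolding H_def by (subst (asm) (1 2 3) e) auto
  qed
  have "ennreal \<bar>\<integral>u. a u * (\<integral>v. b v * H u v \<partial>lborel) \<partial>lborel\<bar>
      \<le> (\<integral>\<^sup>+u. ennreal \<bar>a u * (\<integral>v. b v * H u v \<partial>lborel)\<bar> \<partial>lborel)" by (rule nb)
  also have "\<dots> \<le> (\<integral>\<^sup>+u. ennreal L * (ennreal L' * (\<integral>\<^sup>+v. ennreal \<bar>H u v\<bar> \<partial>lborel)) \<partial>lborel)"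
  proof (rule nn_integral_mono)
    fix u :: real
    have "ennreal \<bar>\<integral>v. b v * H u v \<partial>lborel\<bar> \<le> (\<integral>\<^sup>+v. ennreal \<bar>b v * H u v\<bar> \<partial>lborel)" by (rule nb)
    also have "\<dots> \<le> (\<integral>\<^sup>+v. ennreal L' * ennreal \<bar>H u v\<bar> \<partial>lborel)"
    proof (rule nn_integral_mono)
      show "ennreal \<bar>b v * H u v\<bar> \<le> ennreal L' * ennreal \<bar>H u v\<bar>" for v
        unfolding abs_mult ennreal_mult[OF abs_ge_zero abs_ge_zero] by (intro mult_right_mono ennreal_leI bL) simp
    qed
    also have "\<dots> = ennreal L' * (\<integral>\<^sup>+v. ennreal \<bar>H u v\<bar> \<partial>lborel)" by (rule nn_integral_cmult) measurable
    finally show "ennreal \<bar>a u * (\<integral>v. b v * H u v \<partial>lborel)\<bar> \<le> ennreal L * (ennreal L' * (\<integral>\<^sup>+v. ennreal \<bar>H u v\<bar> \<partial>lborel))"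
      unfolding abs_mult ennreal_mult[OF abs_ge_zero abs_ge_zero] by (intro mult_mono ennreal_leI aL) auto
  qed
  also have "\<dots> = ennreal (L * L') * (\<integral>\<^sup>+u. (\<integral>\<^sup>+v. ennreal \<bar>H u v\<bar> \<partial>lborel) \<partial>lborel)"
    unfolding ennreal_mult[OF L] mult.assoc
    by (subst nn_integral_cmult, measurable)+
  finally show ?thesis unfolding cov H_def[symmetric] H_eq .
qed

text \<open>The truncated bound does not depend on the level, so the level goes to infinity on the
  left alone; the bounds on \<open>g\<close> and \<open>h\<close> dominate.\<close>

lemma (in prob_space) hoeffding_covariance:
  fixes Y Z :: "'a \<Rightarrow> real" and g h g' h' :: "real \<Rightarrow> real"
  assumes Y[measurable]: "Y \<in> borel_measurable M" and Z[measurable]: "Z \<in> borel_measurable M"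
    and g: "\<And>x. (g has_real_derivative g' x) (at x)" "\<And>x. \<bar>g' x\<bar> \<le> L"
    and h: "\<And>x. (h has_real_derivative h' x) (at x)" "\<And>x. \<bar>h' x\<bar> \<le> L'"
    and gC: "\<And>x. \<bar>g x\<bar> \<le> C" and hC: "\<And>x. \<bar>h x\<bar> \<le> C'"
  shows "ennreal \<bar>expectation (\<lambda>\<omega>. g (Y \<omega>) * h (Z \<omega>)) - expectation (\<lambda>\<omega>. g (Y \<omega>)) * expectation (\<lambda>\<omega>. h (Z \<omega>))\<bar>
    \<le> ennreal (L * L') * (\<integral>\<^sup>+u. (\<integral>\<^sup>+v. ennreal \<bar>measure M {\<omega>\<in>space M. Y \<omega> > u \<and> Z \<omega> > v} -
        measure M {\<omega>\<in>space M. Y \<omega> > u} * measure M {\<omega>\<in>space M. Z \<omega> > v}\<bar> \<partial>lborel) \<partial>lborel)"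
    (is "?l \<le> ?r")
proof -
  note [measurable] = borel_measurable_derivative[OF g(1)] borel_measurable_derivative[OF h(1)]
  define T where "T n x = max (- real (Suc n)) (min (real (Suc n)) x)" for n and x :: real
  have [measurable]: "T n \<in> borel_measurable borel" for n unfolding T_def[abs_def] by measurable
  have T: "(\<lambda>n. k (T n x)) \<longlonglongrightarrow> k x" for k :: "real \<Rightarrow> real" and x
  proof (rule tendsto_eventually)
    obtain n0 :: nat where "\<bar>x\<bar> < real n0" using reals_Archimedean2 by blast
    then show "\<forall>\<^sub>F n in sequentially. k (T n x) = k x"
      by (intro eventually_sequentiallyI[of n0]) (auto simp: T_def min_def max_def)
  qed
  have C: "C \<ge> 0" "C' \<ge> 0" using order_trans[OF abs_ge_zero gC] order_trans[OF abs_ge_zero hC] by auto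
  have "(\<lambda>n. expectation (\<lambda>\<omega>. g (T n (Y \<omega>)))) \<longlonglongrightarrow> expectation (\<lambda>\<omega>. g (Y \<omega>))"
    by (rule integral_dominated_convergence[where w="\<lambda>_. C"]) (auto intro: T gC)
  moreover have "(\<lambda>n. expectation (\<lambda>\<omega>. h (T n (Z \<omega>)))) \<longlonglongrightarrow> expectation (\<lambda>\<omega>. h (Z \<omega>))"
    by (rule integral_dominated_convergence[where w="\<lambda>_. C'"]) (auto intro: T hC)
  moreover have "(\<lambda>n. expectation (\<lambda>\<omega>. g (T n (Y \<omega>)) * h (T n (Z \<omega>)))) \<longlonglongrightarrow> expectation (\<lambda>\<omega>. g (Y \<omega>) * h (Z \<omega>))"
    by (rule integral_dominated_convergence[where w="\<lambda>_. C * C'"])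
       (auto intro!: tendsto_mult T mult_mono gC hC simp: abs_mult C)
  ultimately have "(\<lambda>n. ennreal \<bar>expectation (\<lambda>\<omega>. g (T n (Y \<omega>)) * h (T n (Z \<omega>)))
      - expectation (\<lambda>\<omega>. g (T n (Y \<omega>))) * expectation (\<lambda>\<omega>. h (T n (Z \<omega>)))\<bar>) \<longlonglongrightarrow> ?l"
    by (intro tendsto_ennrealI tendsto_intros)
  then show ?thesis
  proof (rule LIMSEQ_le_const2, intro exI allI impI)
    show "ennreal \<bar>expectation (\<lambda>\<omega>. g (T n (Y \<omega>)) * h (T n (Z \<omega>)))
      - expectation (\<lambda>\<omega>. g (T n (Y \<omega>))) * expectation (\<lambda>\<omega>. h (T n (Z \<omega>)))\<bar> \<le> ?r" for n
      unfolding T_def by (rule hoeffding_covariance_truncated[OF Y Z g h gC hC]) simp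
  qed
qed

text \<open>\<open>eta_coeff\<close> is the double integral of Hoeffding's formula for
  \<open>X 0\<close> and \<open>X k\<close>; by stationarity the two means agree and their product
  is a square.\<close>

lemma (in stationary_reversible_chain) acf_le_eta:
  fixes \<phi> \<phi>' :: "real \<Rightarrow> real"
  assumes \<phi>: "\<And>x. (\<phi> has_real_derivative \<phi>' x) (at x)" "\<And>x. \<bar>\<phi>' x\<bar> \<le> L" and C: "\<And>x. \<bar>\<phi> x\<bar> \<le> C"
    and eta: "eta_coeff M X k \<le> ennreal e" and "e \<ge> 0"
  shows "\<bar>acf \<phi> k - (expectation (\<lambda>\<omega>. \<phi> (X 0 \<omega>)))\<^sup>2\<bar> \<le> L\<^sup>2 * e"
proof -
  note m = borel_measurable_derivative(1)[OF \<phi>(1)]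
  have "ennreal \<bar>acf \<phi> k - expectation (\<lambda>\<omega>. \<phi> (X 0 \<omega>)) * expectation (\<lambda>\<omega>. \<phi> (X (int k) \<omega>))\<bar> \<le> ennreal (L * L) * eta_coeff M X k"
    unfolding acf_def eta_coeff_def H_fun_def
    by (rule hoeffding_covariance[OF X_measurable X_measurable \<phi> \<phi> C C])
  also have "\<dots> \<le> ennreal (L * L) * ennreal e" by (intro mult_left_mono eta) simp
  also have "\<dots> = ennreal (L * L * e)" using \<open>e \<ge> 0\<close> by (intro ennreal_mult[symmetric]) auto
  finally show ?thesis
    using \<open>e \<ge> 0\<close> stationary_single[OF m, of "int k"] by (simp add: power2_eq_square)
qed

section \<open>Local behaviour of kernels\<close>

text \<open>\<open>f\<close> is controlled only near \<open>x\<close>. Within distance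
  \<open>r\<close> the substitution u = x - b y and the dominating function (f x + 1) \<phi> apply;
  beyond it the kernel is at most \<phi>(r/b), which is o(b) by the tail condition. Stated for a
  general profile because it serves both \<open>K\<close> and its square.\<close>

lemma (in prob_space) kernel_local_limit:
  fixes \<phi> f :: "real \<Rightarrow> real" and X :: "'a \<Rightarrow> real" and b :: "nat \<Rightarrow> real"
  assumes \<phi>[measurable]: "\<phi> \<in> borel_measurable borel" and \<phi>0: "\<And>u. 0 \<le> \<phi> u" and \<phi>B: "\<And>u. \<phi> u \<le> B"
    and int: "integrable lborel \<phi>"
    and anti: "\<And>u v. 0 < u \<Longrightarrow> u \<le> \<bar>v\<bar> \<Longrightarrow> \<phi> v \<le> \<phi> u"
    and tail: "((\<lambda>u. u * \<phi> u) \<longlongrightarrow> 0) at_top"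
    and f0: "\<And>t. f t \<ge> 0" and X: "distributed M lborel X (\<lambda>t. ennreal (f t))"
    and cont: "isCont f x" and b0: "\<And>n. n \<ge> 1 \<Longrightarrow> b n > 0" and b: "b \<longlonglongrightarrow> 0"
  shows "(\<lambda>n. expectation (\<lambda>\<omega>. \<phi> ((x - X \<omega>) / b n)) / b n) \<longlonglongrightarrow> f x * (\<integral>u. \<phi> u \<partial>lborel)"
proof -
  have f[measurable]: "f \<in> borel_measurable borel"
    using distributed_real_measurable[OF _ X] f0 by simp
  have Xm[measurable]: "X \<in> borel_measurable M"
    using distributed_measurable[OF X] by simp
  obtain r where r: "r > 0" "\<And>u. \<bar>u - x\<bar> < r \<Longrightarrow> \<bar>f u - f x\<bar> < 1"
    using cont[unfolded continuous_at_eps_delta, rule_format, of 1] by (auto simp: dist_real_def)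
  define I where "I n y = f (x - b n * y) * \<phi> y * (if \<bar>b n * y\<bar> < r then 1 else 0)" for n y
  define J where "J n = expectation (\<lambda>\<omega>. \<phi> ((x - X \<omega>) / b n) * (if \<bar>X \<omega> - x\<bar> < r then 0 else 1)) / b n" for n
  have bd: "integrable M (\<lambda>\<omega>. \<phi> ((x - X \<omega>) / c) * (if P \<omega> then 1 else 0))"
    "integrable M (\<lambda>\<omega>. \<phi> ((x - X \<omega>) / c) * (if P \<omega> then 0 else 1))" if [measurable]: "Measurable.pred M P" for c P
    using \<phi>0 \<phi>B order_trans[OF \<phi>0 \<phi>B] by (auto intro!: integrable_const_bound[of _ B])
  have split: "expectation (\<lambda>\<omega>. \<phi> ((x - X \<omega>) / b n)) / b n = (\<integral>y. I n y \<partial>lborel) + J n" if "n \<ge> 1" for n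
  proof -
    have "expectation (\<lambda>\<omega>. \<phi> ((x - X \<omega>) / b n)) = expectation (\<lambda>\<omega>. \<phi> ((x - X \<omega>) / b n) * (if \<bar>X \<omega> - x\<bar> < r then 1 else 0)
        + \<phi> ((x - X \<omega>) / b n) * (if \<bar>X \<omega> - x\<bar> < r then 0 else 1))"
      by (intro Bochner_Integration.integral_cong) auto
    also have "\<dots> = expectation (\<lambda>\<omega>. \<phi> ((x - X \<omega>) / b n) * (if \<bar>X \<omega> - x\<bar> < r then 1 else 0)) + b n * J n"
      using b0[OF that] by (subst Bochner_Integration.integral_add) (auto intro!: bd simp: J_def)
    also have "expectation (\<lambda>\<omega>. \<phi> ((x - X \<omega>) / b n) * (if \<bar>X \<omega> - x\<bar> < r then 1 else 0))
       = (\<integral>u. f u * (\<phi> ((x - u) / b n) * (if \<bar>u - x\<bar> < r then 1 else 0)) \<partial>lborel)"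
      by (rule distributed_integral[OF X, symmetric]) (auto simp: f0)
    also have "\<dots> = b n * (\<integral>y. I n y \<partial>lborel)"
      using b0[OF that] by (subst lborel_integral_real_affine[of "- b n" _ x]) (auto simp: I_def[abs_def] mult.assoc)
    finally show ?thesis using b0[OF that] by (simp add: field_simps)
  qed
  have "(\<lambda>n. \<integral>y. I n y \<partial>lborel) \<longlonglongrightarrow> (\<integral>y. f x * \<phi> y \<partial>lborel)"
  proof (rule integral_dominated_convergence[where w="\<lambda>y. (f x + 1) * \<phi> y"])
    show "integrable lborel (\<lambda>y. (f x + 1) * \<phi> y)" using int by simp
    show "AE y in lborel. (\<lambda>n. I n y) \<longlonglongrightarrow> f x * \<phi> y"
    proof (rule AE_I2)
      fix y
      have by0: "(\<lambda>n. b n * y) \<longlonglongrightarrow> 0" using tendsto_mult_right[OF b, of y] by simp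
      then have "(\<lambda>n. x - b n * y) \<longlonglongrightarrow> x - 0" by (intro tendsto_diff tendsto_const)
      then have "(\<lambda>n. f (x - b n * y)) \<longlonglongrightarrow> f x" using cont by (auto intro: isCont_tendsto_compose)
      then have "(\<lambda>n. f (x - b n * y) * \<phi> y) \<longlonglongrightarrow> f x * \<phi> y" by (intro tendsto_mult tendsto_const)
      moreover have "\<forall>\<^sub>F n in sequentially. f (x - b n * y) * \<phi> y = I n y"
        using tendstoD[OF by0 \<open>r > 0\<close>] by eventually_elim (auto simp: I_def)
      ultimately show "(\<lambda>n. I n y) \<longlonglongrightarrow> f x * \<phi> y" by (rule Lim_transform_eventually)
    qed
    show "AE y in lborel. norm (I n y) \<le> (f x + 1) * \<phi> y" for n
    proof (rule AE_I2)
      fix y show "norm (I n y) \<le> (f x + 1) * \<phi> y"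
        using r(2)[of "x - b n * y"] \<phi>0[of y] f0[of "x - b n * y"] f0[of x]
        by (auto simp: I_def abs_mult intro!: mult_right_mono)
    qed
  qed (unfold I_def[abs_def], measurable)
  moreover have "J \<longlonglongrightarrow> 0"
  proof (rule tendsto_sandwich[where f="\<lambda>_. 0"])
    show "\<forall>\<^sub>F n in sequentially. 0 \<le> J n"
      using eventually_ge_at_top[of 1] by eventually_elim (use \<phi>0 b0 in \<open>auto simp: J_def intro!: divide_nonneg_pos integral_nonneg\<close>)
    \<comment> \<open>Writing \<phi>(r/b)/b as (r/b) \<phi>(r/b) / r puts the far part into the form
      of the tail hypothesis.\<close>
    show "\<forall>\<^sub>F n in sequentially. J n \<le> (r / b n * \<phi> (r / b n)) / r"
      using eventually_ge_at_top[of 1]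
    proof eventually_elim
      case (elim n)
      have "expectation (\<lambda>\<omega>. \<phi> ((x - X \<omega>) / b n) * (if \<bar>X \<omega> - x\<bar> < r then 0 else 1)) \<le> expectation (\<lambda>_. \<phi> (r / b n))"
      proof (rule integral_mono)
        show "\<phi> ((x - X \<omega>) / b n) * (if \<bar>X \<omega> - x\<bar> < r then 0 else 1) \<le> \<phi> (r / b n)" for \<omega>
          using b0[OF elim] r(1) \<phi>0[of "r / b n"] anti[of "r / b n" "(x - X \<omega>) / b n"]
          by (auto simp: abs_minus_commute divide_right_mono)
      qed (auto intro!: bd)
      then show ?case using b0[OF elim] r(1) by (simp add: J_def prob_space divide_right_mono)
    qed
    have "filterlim (\<lambda>n. r * inverse (b n)) at_top sequentially"
    proof (rule filterlim_tendsto_pos_mult_at_top[OF tendsto_const r(1)])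
      have "\<forall>\<^sub>F n in sequentially. b n > 0"
        using eventually_ge_at_top[of 1] by eventually_elim (rule b0)
      then show "filterlim (\<lambda>n. inverse (b n)) at_top sequentially"
        by (rule filterlim_inverse_at_top[OF b])
    qed
    then have "filterlim (\<lambda>n. r / b n) at_top sequentially" by (simp add: divide_inverse)
    from filterlim_compose[OF tail this]
    show "(\<lambda>n. (r / b n * \<phi> (r / b n)) / r) \<longlonglongrightarrow> 0" by (rule tendsto_divide_zero)
  qed auto
  ultimately have "(\<lambda>n. (\<integral>y. I n y \<partial>lborel) + J n) \<longlonglongrightarrow> (\<integral>y. f x * \<phi> y \<partial>lborel) + 0" by (rule tendsto_add)
  then have "(\<lambda>n. (\<integral>y. I n y \<partial>lborel) + J n) \<longlonglongrightarrow> f x * (\<integral>u. \<phi> u \<partial>lborel)" by simp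
  moreover have "\<forall>\<^sub>F n in sequentially. (\<integral>y. I n y \<partial>lborel) + J n = expectation (\<lambda>\<omega>. \<phi> ((x - X \<omega>) / b n)) / b n"
    using eventually_ge_at_top[of 1] by eventually_elim (simp add: split)
  ultimately show ?thesis by (rule Lim_transform_eventually)
qed

lemma nn_integral_kernel_scale:
  fixes K :: "real \<Rightarrow> real"
  assumes [measurable]: "K \<in> borel_measurable borel" and "\<And>u. 0 \<le> K u" "integrable lborel K" "(\<integral>u. K u \<partial>lborel) = 1" "h > 0"
  shows "(\<integral>\<^sup>+u. ennreal (K ((x - u) / h)) \<partial>lborel) = ennreal h"
proof -
  have "(\<integral>\<^sup>+u. ennreal (K ((x - u) / h)) \<partial>lborel) = ennreal \<bar>- h\<bar> * (\<integral>\<^sup>+y. ennreal (K ((x - (x + - h * y)) / h)) \<partial>lborel)"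
    using \<open>h > 0\<close> by (intro nn_integral_real_affine) auto
  also have "(\<integral>\<^sup>+y. ennreal (K ((x - (x + - h * y)) / h)) \<partial>lborel) = (\<integral>\<^sup>+y. ennreal (K y) \<partial>lborel)"
    using \<open>h > 0\<close> by simp
  also have "\<dots> = 1" using assms by (subst nn_integral_eq_integral) auto
  finally show ?thesis using \<open>h > 0\<close> by simp
qed

text \<open>On the square of half-width \<open>r\<close> the density is at most \<open>C\<close> and
  each kernel integrates to \<open>h\<close>. Off the square one coordinate is at least
  \<open>r\<close> away, so one kernel value is at most K(r/h) and the other at most
  \<open>B\<close>.\<close>

lemma (in prob_space) kernel_pair_bound:
  fixes K :: "real \<Rightarrow> real" and f2 :: "real \<times> real \<Rightarrow> real" and X Y :: "'a \<Rightarrow> real"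
  assumes K[measurable]: "K \<in> borel_measurable borel" and K0: "\<And>u. 0 \<le> K u" and KB: "\<And>u. K u \<le> B"
    and Ki: "integrable lborel K" "(\<integral>u. K u \<partial>lborel) = 1"
    and anti: "\<And>u v. 0 < u \<Longrightarrow> u \<le> \<bar>v\<bar> \<Longrightarrow> K v \<le> K u"
    and f20: "\<And>p. f2 p \<ge> 0"
    and XY: "distributed M (lborel \<Otimes>\<^sub>M lborel) (\<lambda>\<omega>. (X \<omega>, Y \<omega>)) (\<lambda>p. ennreal (f2 p))"
    and loc: "\<And>s t. \<bar>s\<bar> < r \<Longrightarrow> \<bar>t\<bar> < r \<Longrightarrow> f2 (x + s, y + t) \<le> C" and "r > 0" and "h > 0"
  shows "expectation (\<lambda>\<omega>. K ((x - X \<omega>) / h) * K ((y - Y \<omega>) / h)) \<le> C * h\<^sup>2 + B * K (r / h)"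
proof -
  have pm: "(\<lambda>\<omega>. (X \<omega>, Y \<omega>)) \<in> M \<rightarrow>\<^sub>M (lborel \<Otimes>\<^sub>M lborel)" using distributed_measurable[OF XY] .
  have [measurable]: "X \<in> borel_measurable M" "Y \<in> borel_measurable M"
    using measurable_compose[OF pm measurable_fst] measurable_compose[OF pm measurable_snd] by simp_all
  have f2m[measurable]: "f2 \<in> borel_measurable (lborel \<Otimes>\<^sub>M lborel)"
    using distributed_real_measurable[OF _ XY] f20 by simp
  have B: "B \<ge> 0" using order_trans[OF K0 KB] .
  have C: "C \<ge> 0" using order_trans[OF f20 loc[of 0 0]] \<open>r > 0\<close> by simp
  let ?I = "\<lambda>u v. if \<bar>u - x\<bar> < r \<and> \<bar>v - y\<bar> < r then 1 else 0 :: real"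
  let ?k = "\<lambda>u v. K ((x - u) / h) * K ((y - v) / h) * ?I u v"
  have kb: "0 \<le> ?k u v" "?k u v \<le> B * B" for u v
    using K0 KB B by (auto intro!: mult_mono)
  have ik: "integrable M (\<lambda>\<omega>. ?k (X \<omega>) (Y \<omega>))"
    using kb by (intro integrable_const_bound[of _ "B * B"]) auto
  have "ennreal (expectation (\<lambda>\<omega>. ?k (X \<omega>) (Y \<omega>))) = (\<integral>\<^sup>+\<omega>. ennreal (?k (X \<omega>) (Y \<omega>)) \<partial>M)"
    using kb by (intro nn_integral_eq_integral[symmetric] ik) auto
  also have "\<dots> = (\<integral>\<^sup>+p. ennreal (f2 p) * ennreal (?k (fst p) (snd p)) \<partial>(lborel \<Otimes>\<^sub>M lborel))"
    using distributed_nn_integral[OF XY, of "\<lambda>p. ennreal (?k (fst p) (snd p))"] by simp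
  also have "\<dots> \<le> (\<integral>\<^sup>+p. ennreal C * (ennreal (K ((x - fst p) / h)) * ennreal (K ((y - snd p) / h))) \<partial>(lborel \<Otimes>\<^sub>M lborel))"
  proof (rule nn_integral_mono)
    fix p :: "real \<times> real"
    have "f2 p * ?k (fst p) (snd p) \<le> C * (K ((x - fst p) / h) * K ((y - snd p) / h))"
      using loc[of "fst p - x" "snd p - y"] K0 C by (auto intro!: mult_mono)
    then show "ennreal (f2 p) * ennreal (?k (fst p) (snd p)) \<le> ennreal C * (ennreal (K ((x - fst p) / h)) * ennreal (K ((y - snd p) / h)))"
      using f20 kb K0 C by (simp add: ennreal_mult[symmetric] ennreal_leI)
  qed
  also have "\<dots> = ennreal C * (\<integral>\<^sup>+u. (\<integral>\<^sup>+v. ennreal (K ((x - u) / h)) * ennreal (K ((y - v) / h)) \<partial>lborel) \<partial>lborel)"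
    by (subst nn_integral_cmult, measurable) (subst lborel.nn_integral_fst[symmetric], auto)
  also have "\<dots> = ennreal C * (ennreal h * ennreal h)"
    by (simp add: nn_integral_cmult nn_integral_multc nn_integral_kernel_scale[OF K K0 Ki \<open>h > 0\<close>])
  also have "\<dots> = ennreal (C * h\<^sup>2)" using C \<open>h > 0\<close> by (simp add: ennreal_mult power2_eq_square)
  finally have E: "expectation (\<lambda>\<omega>. ?k (X \<omega>) (Y \<omega>)) \<le> C * h\<^sup>2" using C by (simp add: ennreal_le_iff)
  have "expectation (\<lambda>\<omega>. K ((x - X \<omega>) / h) * K ((y - Y \<omega>) / h)) \<le> expectation (\<lambda>\<omega>. ?k (X \<omega>) (Y \<omega>) + B * K (r / h))"
  proof (rule integral_mono)
    show "integrable M (\<lambda>\<omega>. K ((x - X \<omega>) / h) * K ((y - Y \<omega>) / h))"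
      using K0 KB B by (intro integrable_const_bound[of _ "B * B"]) (auto intro!: mult_mono)
    fix \<omega>
    have "K ((x - X \<omega>) / h) * K ((y - Y \<omega>) / h) \<le> B * K (r / h)" if "\<not> (\<bar>X \<omega> - x\<bar> < r \<and> \<bar>Y \<omega> - y\<bar> < r)"
    proof (cases "\<bar>X \<omega> - x\<bar> < r")
      case False
      then have "K ((x - X \<omega>) / h) \<le> K (r / h)"
        using \<open>h > 0\<close> \<open>r > 0\<close> by (intro anti) (auto simp: abs_minus_commute divide_right_mono)
      then show ?thesis
        using mult_mono[OF _ KB[of "(y - Y \<omega>) / h"] K0[of "r / h"] K0] by (simp add: mult.commute)
    next
      case True
      then have "K ((y - Y \<omega>) / h) \<le> K (r / h)"
        using \<open>h > 0\<close> \<open>r > 0\<close> that by (intro anti) (auto simp: abs_minus_commute divide_right_mono)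
      then show ?thesis by (intro mult_mono KB B K0)
    qed
    then show "K ((x - X \<omega>) / h) * K ((y - Y \<omega>) / h) \<le> ?k (X \<omega>) (Y \<omega>) + B * K (r / h)"
      using mult_nonneg_nonneg[OF B K0[of "r / h"]] by auto
  qed (use ik in auto)
  also have "\<dots> \<le> C * h\<^sup>2 + B * K (r / h)" using E ik by (simp add: prob_space)
  finally show ?thesis .
qed

section \<open>Summation of covariances\<close>

text \<open>Each term is at most a difference of consecutive values of 1/k^3, so the sum telescopes;
  over a common denominator the gap has a numerator with positive coefficients only.\<close>

lemma sum_inverse_fourth_power_tail:
  assumes "N \<ge> 1" "N \<le> n"
  shows "(\<Sum>k\<in>{N<..n}. 1 / real k ^ 4) \<le> 1 / real N ^ 3 - 1 / real n ^ 3"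
  using \<open>N \<le> n\<close>
proof (induction n rule: dec_induct)
  case base
  then show ?case by simp
next
  case (step n)
  have n: "real n \<ge> 1" using step.hyps \<open>N \<ge> 1\<close> by simp
  have "{N<..Suc n} = insert (Suc n) {N<..n}" using step.hyps by auto
  then have "(\<Sum>k\<in>{N<..Suc n}. 1 / real k ^ 4) = 1 / real (Suc n) ^ 4 + (\<Sum>k\<in>{N<..n}. 1 / real k ^ 4)"
    by simp
  also have "1 / real (Suc n) ^ 4 \<le> 1 / real n ^ 3 - 1 / real (Suc n) ^ 3"
  proof -
    have frac: "1 / a ^ 3 - 1 / c ^ 3 - 1 / c ^ 4 = (c ^ 4 - a ^ 3 * c - a ^ 3) / (a ^ 3 * c ^ 4)"
      if "a \<noteq> 0" "c \<noteq> 0" for a c :: real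
      using that by (simp add: divide_simps power3_eq_cube power4_eq_xxxx) (simp add: algebra_simps)
    have "1 / real n ^ 3 - 1 / real (Suc n) ^ 3 - 1 / real (Suc n) ^ 4
        = (real (Suc n) ^ 4 - real n ^ 3 * real (Suc n) - real n ^ 3) / (real n ^ 3 * real (Suc n) ^ 4)"
      using n by (intro frac) auto
    also have "real (Suc n) ^ 4 - real n ^ 3 * real (Suc n) - real n ^ 3 = 2 * real n ^ 3 + 6 * real n ^ 2 + 4 * real n + 1"
      by (simp add: power2_eq_square power3_eq_cube power4_eq_xxxx algebra_simps)
    also have "\<dots> / (real n ^ 3 * real (Suc n) ^ 4) \<ge> 0" by (intro divide_nonneg_nonneg) auto
    finally show ?thesis by simp
  qed
  finally show ?case using step.IH by simp
qed

lemma sum_inverse_fourth_power_le: "(\<Sum>k=1..n. 1 / real k ^ 4) \<le> 2"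
proof (cases "n \<ge> 1")
  case True
  then have "{1..n} = insert 1 {1<..n}" by auto
  then have "(\<Sum>k=1..n. 1 / real k ^ 4) = 1 + (\<Sum>k\<in>{1<..n}. 1 / real k ^ 4)" by simp
  also have "\<dots> \<le> 1 + (1 / real 1 ^ 3 - 1 / real n ^ 3)"
    using sum_inverse_fourth_power_tail[of 1 n] True by (intro add_left_mono) auto
  also have "\<dots> \<le> 2" by simp
  finally show ?thesis .
qed simp

text \<open>The two bounds meet at lags of order 1/b. For fixed \<delta> the uniform bound up to
  \<delta>/b leaves about C \<delta>, while the powers of \<open>b\<close> cancel in the tail, where
  only the factor 1/l(\<delta>/b) tends to 0. Hence \<delta> is fixed before n grows.\<close>

lemma sum_covariances_tendsto_0:
  fixes a :: "nat \<Rightarrow> nat \<Rightarrow> real" and b :: "nat \<Rightarrow> real" and l :: "real \<Rightarrow> real"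
  assumes a0: "\<And>n k. a n k \<ge> 0"
    and near: "\<forall>\<^sub>F n in sequentially. \<forall>k. a n k \<le> C * b n"
    and far: "\<And>n k. n \<ge> 1 \<Longrightarrow> k \<ge> 1 \<Longrightarrow> a n k \<le> \<Lambda> / b n ^ 3 * (1 / (real k ^ 4 * l (real k)))"
    and "C \<ge> 0" "\<Lambda> \<ge> 0"
    and b0: "\<And>n. n \<ge> 1 \<Longrightarrow> b n > 0" and b: "b \<longlonglongrightarrow> 0"
    and l0: "\<And>t. t > 0 \<Longrightarrow> l t > 0" and mono: "mono_on {0<..} l" and l: "filterlim l at_top at_top"
  shows "(\<lambda>n. \<Sum>k=1..n. a n k) \<longlonglongrightarrow> 0"
proof (rule LIMSEQ_I)
  fix e :: real assume "e > 0"
  define \<delta> where "\<delta> = e / (2 * (C + 1))"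
  have \<delta>: "\<delta> > 0" "C * \<delta> \<le> e / 2" using \<open>e > 0\<close> \<open>C \<ge> 0\<close> by (auto simp: \<delta>_def field_simps)
  have b_ev: "\<forall>\<^sub>F n in sequentially. b n > 0"
    using eventually_ge_at_top[of 1] by eventually_elim (rule b0)
  have bound: "\<forall>\<^sub>F n in sequentially. (\<Sum>k=1..n. a n k) \<le> C * (\<delta> + b n) + \<Lambda> / \<delta> ^ 3 * inverse (l (\<delta> * inverse (b n)))"
    using near eventually_ge_at_top[of 1]
  proof eventually_elim
    case (elim n)
    note bn = b0[OF elim(2)]
    \<comment> \<open>Rounding up exceeds \<delta>/b by at most 1, which costs an additional C b and
      vanishes in the limit.\<close>
    define N where "N = nat \<lceil>\<delta> / b n\<rceil>"
    have \<delta>b: "\<delta> / b n > 0" using \<delta> bn by simp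
    have N: "real N \<ge> \<delta> / b n" "real N \<le> \<delta> / b n + 1" "N \<ge> 1"
      using \<delta>b unfolding N_def by linarith+
    have lN: "l (\<delta> / b n) \<le> l (real N)" "l (\<delta> / b n) > 0"
      using mono_onD[OF mono _ _ N(1)] \<delta>b N l0 by auto
    \<comment> \<open>\<open>N\<close> may exceed \<open>n\<close>; since the terms are nonnegative,
      the range is enlarged instead of distinguishing cases.\<close>
    have "(\<Sum>k=1..n. a n k) \<le> (\<Sum>k\<in>{1..N} \<union> {N<..max n N}. a n k)"
      using a0 by (intro sum_mono2) auto
    also have "\<dots> = (\<Sum>k=1..N. a n k) + (\<Sum>k\<in>{N<..max n N}. a n k)"
      by (intro sum.union_disjoint) auto
    also have "(\<Sum>k=1..N. a n k) \<le> (\<Sum>k=1..N. C * b n)" using elim(1) by (intro sum_mono) auto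
    also have "\<dots> = C * (real N * b n)" by simp
    also have "\<dots> \<le> C * (\<delta> + b n)"
      using N(2) bn \<open>C \<ge> 0\<close> by (intro mult_left_mono) (auto simp: field_simps)
    also have "(\<Sum>k\<in>{N<..max n N}. a n k) \<le> (\<Sum>k\<in>{N<..max n N}. \<Lambda> / b n ^ 3 * inverse (l (\<delta> / b n)) * (1 / real k ^ 4))"
    proof (rule sum_mono)
      fix k assume k: "k \<in> {N<..max n N}"
      then have k1: "k \<ge> 1" "real N \<le> real k" by auto
      have "l (\<delta> / b n) \<le> l (real k)"
        using mono_onD[OF mono, of "\<delta> / b n" "real k"] \<delta>b N k1 by auto
      then have "1 / (real k ^ 4 * l (real k)) \<le> 1 / (real k ^ 4 * l (\<delta> / b n))"
        using k1 lN by (intro divide_left_mono mult_left_mono mult_pos_pos) auto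
      then have "\<Lambda> / b n ^ 3 * (1 / (real k ^ 4 * l (real k))) \<le> \<Lambda> / b n ^ 3 * (1 / (real k ^ 4 * l (\<delta> / b n)))"
        using \<open>\<Lambda> \<ge> 0\<close> bn by (intro mult_left_mono) auto
      with far[OF elim(2) k1(1)] have "a n k \<le> \<Lambda> / b n ^ 3 * (1 / (real k ^ 4 * l (\<delta> / b n)))" by linarith
      then show "a n k \<le> \<Lambda> / b n ^ 3 * inverse (l (\<delta> / b n)) * (1 / real k ^ 4)"
        by (simp add: field_simps)
    qed
    also have "\<dots> = \<Lambda> / b n ^ 3 * inverse (l (\<delta> / b n)) * (\<Sum>k\<in>{N<..max n N}. 1 / real k ^ 4)"
      by (simp add: sum_distrib_left)
    also have "\<dots> \<le> \<Lambda> / b n ^ 3 * inverse (l (\<delta> / b n)) * (1 / (\<delta> / b n) ^ 3)"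
    proof (intro mult_left_mono)
      have "(\<Sum>k\<in>{N<..max n N}. 1 / real k ^ 4) \<le> 1 / real N ^ 3 - 1 / real (max n N) ^ 3"
        by (rule sum_inverse_fourth_power_tail) (use N in auto)
      also have "\<dots> \<le> 1 / real N ^ 3" by simp
      also have "\<dots> \<le> 1 / (\<delta> / b n) ^ 3"
        using N \<delta>b by (intro divide_left_mono power_mono mult_pos_pos zero_less_power) auto
      finally show "(\<Sum>k\<in>{N<..max n N}. 1 / real k ^ 4) \<le> 1 / (\<delta> / b n) ^ 3" .
    qed (use \<open>\<Lambda> \<ge> 0\<close> bn lN in auto)
    also have "\<dots> = \<Lambda> / \<delta> ^ 3 * inverse (l (\<delta> * inverse (b n)))"
      using bn \<delta> by (simp add: field_simps)
    finally show ?case by simp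
  qed
  have "filterlim (\<lambda>n. \<delta> * inverse (b n)) at_top sequentially"
    by (rule filterlim_tendsto_pos_mult_at_top[OF tendsto_const \<delta>(1) filterlim_inverse_at_top[OF b b_ev]])
  from tendsto_inverse_0_at_top[OF filterlim_compose[OF l this]]
  have "(\<lambda>n. C * (\<delta> + b n) + \<Lambda> / \<delta> ^ 3 * inverse (l (\<delta> * inverse (b n)))) \<longlonglongrightarrow> C * (\<delta> + 0) + \<Lambda> / \<delta> ^ 3 * 0"
    by (intro tendsto_intros b)
  moreover have "C * (\<delta> + 0) + \<Lambda> / \<delta> ^ 3 * 0 < e" using \<delta> \<open>e > 0\<close> by simp
  ultimately have "\<forall>\<^sub>F n in sequentially. C * (\<delta> + b n) + \<Lambda> / \<delta> ^ 3 * inverse (l (\<delta> * inverse (b n))) < e"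
    by (rule order_tendstoD(2))
  with bound have "\<forall>\<^sub>F n in sequentially. (\<Sum>k=1..n. a n k) < e" by eventually_elim linarith
  then obtain n0 where "\<And>n. n \<ge> n0 \<Longrightarrow> (\<Sum>k=1..n. a n k) < e" by (auto simp: eventually_sequentially)
  moreover have "norm ((\<Sum>k=1..n. a n k) - 0) = (\<Sum>k=1..n. a n k)" for n using a0 by (simp add: sum_nonneg)
  ultimately show "\<exists>n0. \<forall>n\<ge>n0. norm ((\<Sum>k=1..n. a n k) - 0) < e" by (metis)
qed

text \<open>Rationalising gives (1 - q) / (sqrt q + q), and for q at least 1/2 the denominator is at
  least 1.\<close>

lemma abs_inverse_sqrt_minus_1_le:
  fixes q :: real
  assumes "q \<ge> 1 / 2"
  shows "\<bar>1 / sqrt q - 1\<bar> \<le> \<bar>q - 1\<bar>"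
proof -
  have q: "q > 0" using assms by simp
  have "sqrt q \<ge> 1 / 2"
    using assms by (intro real_le_rsqrt) (simp add: power2_eq_square)
  then have s: "sqrt q * (1 + sqrt q) \<ge> 1" using assms q by (simp add: algebra_simps)
  have "1 / sqrt q - 1 = (1 - q) / (sqrt q * (1 + sqrt q))"
  proof -
    have "(1 / r - 1) * (r * (1 + r)) = 1 - r * r" if "r > 0" for r :: real
      using that by (simp add: field_simps)
    from this[of "sqrt q"] have "(1 / sqrt q - 1) * (sqrt q * (1 + sqrt q)) = 1 - q"
      using q by simp
    then show ?thesis using s by (subst nonzero_eq_divide_eq) auto
  qed
  then have "\<bar>1 / sqrt q - 1\<bar> = \<bar>q - 1\<bar> / (sqrt q * (1 + sqrt q))"
    using q by (simp add: abs_divide abs_mult abs_minus_commute)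
  also have "\<dots> \<le> \<bar>q - 1\<bar>" using s by (simp add: divide_le_eq mult_le_cancel_left1)
  finally show ?thesis .
qed

section \<open>The kernel density estimator\<close>

locale kernel_estimation = stationary_reversible_chain M X
  for M :: "'a measure" and X :: "int \<Rightarrow> 'a \<Rightarrow> real" +
  fixes f :: "real \<Rightarrow> real" and f2 :: "real \<times> real \<Rightarrow> real"
    and l K :: "real \<Rightarrow> real" and b :: "nat \<Rightarrow> real" and x :: "'m::finite \<Rightarrow> real"
  assumes f_nonneg: "\<And>t. f t \<ge> 0" and X_density: "distributed M lborel (X 0) (\<lambda>t. ennreal (f t))"
    and l_pos: "\<And>t. t > 0 \<Longrightarrow> l t > 0" and l_mono: "mono_on {0<..} l"
    and l_top: "filterlim l at_top at_top"
    and eta: "\<And>k. k \<ge> 1 \<Longrightarrow> eta_coeff M X k \<le> ennreal (1 / (real k ^ 4 * l (real k)))"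
    and b_pos: "\<And>n. n \<ge> 1 \<Longrightarrow> b n > 0" and b_0: "b \<longlonglongrightarrow> 0"
    and nb4: "filterlim (\<lambda>n. real n * b n ^ 4) at_top sequentially"
    and K_nonneg: "\<And>u. K u \<ge> 0" and K_sym: "\<And>u. K (- u) = K u" and K_antimono: "antimono_on {0<..} K"
    and K_int: "integrable lborel K" and K_one: "(\<integral>u. K u \<partial>lborel) = 1"
    and K_tail: "((\<lambda>u. u\<^sup>2 * K u) \<longlongrightarrow> 0) at_top"
    and K_diff: "\<And>u. K field_differentiable (at u)" and K_bdd: "bounded (range (deriv K))"
    and x_inj: "inj x"
    and f_cont: "\<And>j. isCont f (x j)" and f_nz: "\<And>j. f (x j) \<noteq> 0"
    and f2_nonneg: "\<And>p. f2 p \<ge> 0"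
    and X_density2: "distributed M (lborel \<Otimes>\<^sub>M lborel) (\<lambda>\<omega>. (X 0 \<omega>, X 2 \<omega>)) (\<lambda>p. ennreal (f2 p))"
    and f2_bdd: "\<And>i j. \<exists>r>0. \<exists>C. \<forall>s t. \<bar>s\<bar> < r \<and> \<bar>t\<bar> < r \<longrightarrow> \<bar>f2 (x i + s, x j + t)\<bar> < C"
begin

section \<open>Elementary properties of the kernel\<close>

lemma K_der: "(K has_real_derivative deriv K u) (at u)"
  using K_diff by (simp add: DERIV_deriv_iff_field_differentiable)

lemma K_measurable [measurable]: "K \<in> borel_measurable borel"
  by (rule borel_measurable_derivative(1)[OF K_der])

lemma K_abs: "K \<bar>v\<bar> = K v"
  using K_sym[of v] by (simp add: abs_if)

lemma K_anti: "0 < u \<Longrightarrow> u \<le> \<bar>v\<bar> \<Longrightarrow> K v \<le> K u"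
  using K_antimono unfolding monotone_on_def by (subst K_abs[symmetric]) auto

text \<open>Monotonicity is assumed on the open half-line; continuity at 0 extends the comparison to
  the origin.\<close>

lemma K_le_K0: "K v \<le> K 0"
proof (cases "v = 0")
  case False
  have "(K \<longlongrightarrow> K 0) (at_right 0)"
    using DERIV_isCont[OF K_der[of 0]] by (auto simp: isCont_def intro: tendsto_within_subset)
  moreover have "\<forall>\<^sub>F u in at_right 0. K v \<le> K u"
    using eventually_at_right_real[of 0 "\<bar>v\<bar>"] False by (auto elim!: eventually_mono intro: K_anti)
  ultimately show ?thesis by (intro tendsto_lowerbound[of K _ "at_right 0"]) auto
qed simp

definition dK_bound :: real where "dK_bound = (SOME D. \<forall>u. \<bar>deriv K u\<bar> \<le> D)"

lemma dK_le: "\<bar>deriv K u\<bar> \<le> dK_bound"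
proof -
  have "\<exists>D. \<forall>u. \<bar>deriv K u\<bar> \<le> D" using K_bdd by (auto simp: bounded_iff)
  then show ?thesis unfolding dK_bound_def by (rule someI2_ex) blast
qed

lemma K_tail1: "((\<lambda>u. u * K u) \<longlongrightarrow> 0) at_top"
proof (rule tendsto_sandwich[OF _ _ tendsto_const K_tail])
  show "\<forall>\<^sub>F u in at_top. 0 \<le> u * K u"
    using eventually_ge_at_top[of 0] by eventually_elim (simp add: K_nonneg)
  show "\<forall>\<^sub>F u in at_top. u * K u \<le> u\<^sup>2 * K u"
    using eventually_ge_at_top[of 1]
  proof eventually_elim
    case (elim u)
    then show ?case
      using mult_right_mono[of 1 u "u * K u"] K_nonneg[of u] by (simp add: power2_eq_square mult.assoc)
  qed
qed

lemma K2_le: "(K u)\<^sup>2 \<le> K 0 * K u"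
  unfolding power2_eq_square by (intro mult_right_mono K_le_K0 K_nonneg)

lemma K2_int: "integrable lborel (\<lambda>u. (K u)\<^sup>2)"
proof (rule Bochner_Integration.integrable_bound)
  show "integrable lborel (\<lambda>u. K 0 * K u)" using K_int by simp
qed (use K2_le in \<open>auto intro: order_trans[OF _ abs_ge_self]\<close>)

definition K_sq :: real where "K_sq = (\<integral>u. (K u)\<^sup>2 \<partial>lborel)"

lemma K_sq_pos: "K_sq > 0"
proof (rule ccontr)
  assume "\<not> K_sq > 0"
  moreover have "(\<integral>u. (K u)\<^sup>2 \<partial>lborel) \<ge> 0" by (intro Bochner_Integration.integral_nonneg) simp
  ultimately have "(\<integral>u. (K u)\<^sup>2 \<partial>lborel) = 0" unfolding K_sq_def by linarith
  then have "AE u in lborel. K u = 0"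
    using integral_nonneg_eq_0_iff_AE[OF K2_int] by simp
  then have "(\<integral>u. K u \<partial>lborel) = 0" by (subst integral_cong_AE[of _ _ "\<lambda>_. 0"]) auto
  then show False using K_one by simp
qed

lemma f_pos: "f (x j) > 0"
  using f_nonneg[of "x j"] f_nz[of j] by simp

lemma b_pos_eventually: "\<forall>\<^sub>F n in sequentially. n \<ge> 1 \<and> b n > 0"
  using eventually_ge_at_top[of 1] by eventually_elim (simp add: b_pos)

lemma inverse_b_top: "r > 0 \<Longrightarrow> filterlim (\<lambda>n. r / b n) at_top sequentially"
  unfolding divide_inverse
  using b_pos_eventually by (intro filterlim_tendsto_pos_mult_at_top[OF tendsto_const] filterlim_inverse_at_top[OF b_0])
    (auto elim: eventually_mono)

section \<open>The centred and rescaled kernels at the given points\<close>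

definition kmean :: "nat \<Rightarrow> 'm \<Rightarrow> real" where
  "kmean n j = expectation (\<lambda>\<omega>. K ((x j - X 0 \<omega>) / b n))"

definition kpair :: "nat \<Rightarrow> 'm \<Rightarrow> 'm \<Rightarrow> nat \<Rightarrow> real" where
  "kpair n i j k = expectation (\<lambda>\<omega>. K ((x i - X 0 \<omega>) / b n) * K ((x j - X (int k) \<omega>) / b n))"

abbreviation kcov :: "nat \<Rightarrow> 'm \<Rightarrow> 'm \<Rightarrow> nat \<Rightarrow> real" where
  "kcov n i j k \<equiv> (kpair n i j k - kmean n i * kmean n j) / b n"

text \<open>\<open>sqrt (b n)\<close> is the order of the standard deviation of one kernel value, so
  the variance of \<open>g\<close> has a finite limit, while its sup norm grows like
  b^(-1/2).\<close>

definition g :: "nat \<Rightarrow> 'm \<Rightarrow> real \<Rightarrow> real" where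
  "g n j u = (K ((x j - u) / b n) - kmean n j) / sqrt (b n)"

text \<open>The Cramer-Wold combination: the joint limit is reached through all coefficient vectors
  \<open>\<tau>\<close>.\<close>

definition G :: "('m \<Rightarrow> real) \<Rightarrow> nat \<Rightarrow> real \<Rightarrow> real" where
  "G \<tau> n u = (\<Sum>j\<in>UNIV. \<tau> j * g n j u)"

lemma g_measurable [measurable]: "g n j \<in> borel_measurable borel"
  unfolding g_def[abs_def] by measurable

lemma G_measurable [measurable]: "G \<tau> n \<in> borel_measurable borel"
  unfolding G_def[abs_def] by measurable

lemma K_integrable: "integrable M (\<lambda>\<omega>. K ((c - X i \<omega>) / h))"
  using K_nonneg K_le_K0 by (intro bounded_integrable[of _ "K 0"]) auto

lemma KK_integrable: "integrable M (\<lambda>\<omega>. K ((c - X i \<omega>) / h) * K ((c' - X j \<omega>) / h))"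
proof (rule bounded_integrable)
  show "\<bar>K ((c - X i \<omega>) / h) * K ((c' - X j \<omega>) / h)\<bar> \<le> K 0 * K 0" for \<omega>
    unfolding abs_mult using K_nonneg K_le_K0 by (intro mult_mono) auto
qed measurable

lemma kmean_bounds: "0 \<le> kmean n j" "kmean n j \<le> K 0"
proof -
  show "0 \<le> kmean n j" unfolding kmean_def by (intro Bochner_Integration.integral_nonneg) (simp add: K_nonneg)
  have "kmean n j \<le> expectation (\<lambda>_. K 0)"
    unfolding kmean_def by (intro integral_mono K_integrable) (auto simp: K_le_K0)
  then show "kmean n j \<le> K 0" by (simp add: prob_space)
qed

lemma kmean_shift: "expectation (\<lambda>\<omega>. K ((x j - X k \<omega>) / b n)) = kmean n j"
  unfolding kmean_def by (rule stationary_single[of "\<lambda>u. K ((x j - u) / b n)"]) measurable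

lemma g_bound: "n \<ge> 1 \<Longrightarrow> \<bar>g n j u\<bar> \<le> K 0 / sqrt (b n)"
  using b_pos[of n] K_nonneg[of "(x j - u) / b n"] K_le_K0[of "(x j - u) / b n"] kmean_bounds[of n j]
  unfolding g_def abs_divide by (simp add: divide_right_mono)

lemma G_bound: "n \<ge> 1 \<Longrightarrow> \<bar>G \<tau> n u\<bar> \<le> (\<Sum>j\<in>UNIV. \<bar>\<tau> j\<bar>) * K 0 / sqrt (b n)"
  unfolding G_def
  by (rule order_trans[OF sum_abs]) (auto simp: abs_mult sum_distrib_right sum_divide_distrib times_divide_eq_right[symmetric]
      simp del: times_divide_eq_right intro!: sum_mono mult_left_mono g_bound)

lemma E_g: "expectation (\<lambda>\<omega>. g n j (X k \<omega>)) = 0"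
  using kmean_shift K_integrable by (simp add: g_def prob_space)

lemma g_integrable: "integrable M (\<lambda>\<omega>. g n j (X k \<omega>))"
  unfolding g_def using K_integrable by simp

lemma gg_integrable: "integrable M (\<lambda>\<omega>. g n i (X k \<omega>) * g n j (X k' \<omega>))"
proof -
  have "integrable M (\<lambda>\<omega>. (K ((x i - X k \<omega>) / b n) * K ((x j - X k' \<omega>) / b n) - K ((x i - X k \<omega>) / b n) * kmean n j
      - kmean n i * K ((x j - X k' \<omega>) / b n) + kmean n i * kmean n j) / (sqrt (b n) * sqrt (b n)))"
    using K_integrable KK_integrable by simp
  then show ?thesis by (simp add: g_def algebra_simps)
qed

lemma E_G: "expectation (\<lambda>\<omega>. G \<tau> n (X k \<omega>)) = 0"
  unfolding G_def using g_integrable by (simp add: E_g)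

lemma E_gg:
  assumes "n \<ge> 1"
  shows "expectation (\<lambda>\<omega>. g n i (X 0 \<omega>) * g n j (X (int k) \<omega>)) = kcov n i j k"
proof -
  have "expectation (\<lambda>\<omega>. g n i (X 0 \<omega>) * g n j (X (int k) \<omega>)) =
    expectation (\<lambda>\<omega>. (K ((x i - X 0 \<omega>) / b n) * K ((x j - X (int k) \<omega>) / b n) - K ((x i - X 0 \<omega>) / b n) * kmean n j
      - kmean n i * K ((x j - X (int k) \<omega>) / b n) + kmean n i * kmean n j) / b n)"
    using b_pos[OF assms] by (intro Bochner_Integration.integral_cong) (auto simp: g_def algebra_simps)
  also have "\<dots> = kcov n i j k"
    using K_integrable KK_integrable by (simp add: kmean_shift kpair_def prob_space)
  finally show ?thesis .
qed

lemma acf_G: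
  assumes "n \<ge> 1"
  shows "acf (G \<tau> n) k = (\<Sum>i\<in>UNIV. \<Sum>j\<in>UNIV. \<tau> i * \<tau> j * kcov n i j k)"
proof -
  have "acf (G \<tau> n) k = expectation (\<lambda>\<omega>. \<Sum>i\<in>UNIV. \<Sum>j\<in>UNIV. \<tau> i * \<tau> j * (g n i (X 0 \<omega>) * g n j (X (int k) \<omega>)))"
    unfolding acf_def G_def by (simp add: sum_product algebra_simps)
  also have "\<dots> = (\<Sum>i\<in>UNIV. \<Sum>j\<in>UNIV. \<tau> i * \<tau> j * expectation (\<lambda>\<omega>. g n i (X 0 \<omega>) * g n j (X (int k) \<omega>)))"
    using gg_integrable by (simp add: Bochner_Integration.integral_sum)
  finally show ?thesis by (simp add: E_gg[OF assms])
qed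

lemma G_der:
  "(G \<tau> n has_real_derivative (\<Sum>j\<in>UNIV. \<tau> j * (- deriv K ((x j - u) / b n) / b n / sqrt (b n)))) (at u)"
  if "n \<ge> 1"
proof -
  have "((\<lambda>u. K ((x j - u) / b n)) has_real_derivative deriv K ((x j - u) / b n) * (- 1 / b n)) (at u)" for j
    by (rule DERIV_chain'[OF _ K_der, of "\<lambda>u. (x j - u) / b n"])
       (use b_pos[OF that] in \<open>auto intro!: derivative_eq_intros\<close>)
  then have "((\<lambda>u. K ((x j - u) / b n)) has_real_derivative - deriv K ((x j - u) / b n) / b n) (at u)" for j
    by simp
  then show ?thesis
    unfolding G_def[abs_def] g_def diff_divide_distrib[of _ _ "sqrt (b n)"]
    by (intro DERIV_sum DERIV_cmult) (rule DERIV_cong[OF DERIV_diff[OF DERIV_cdivide DERIV_const]], auto)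
qed

lemma G_der_bound:
  assumes "n \<ge> 1"
  shows "\<bar>\<Sum>j\<in>UNIV. \<tau> j * (- deriv K ((x j - u) / b n) / b n / sqrt (b n))\<bar> \<le> (\<Sum>j\<in>UNIV. \<bar>\<tau> j\<bar>) * (dK_bound / b n / sqrt (b n))"
proof (rule order_trans[OF sum_abs])
  have "\<bar>\<tau> j * (- deriv K ((x j - u) / b n) / b n / sqrt (b n))\<bar> \<le> \<bar>\<tau> j\<bar> * (dK_bound / b n / sqrt (b n))" for j
    unfolding abs_mult abs_divide abs_minus_cancel using b_pos[OF assms] dK_le
    by (intro mult_left_mono) (auto intro!: divide_right_mono)
  then show "(\<Sum>j\<in>UNIV. \<bar>\<tau> j * (- deriv K ((x j - u) / b n) / b n / sqrt (b n))\<bar>) \<le> (\<Sum>j\<in>UNIV. \<bar>\<tau> j\<bar>) * (dK_bound / b n / sqrt (b n))"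
    unfolding sum_distrib_right by (rule sum_mono)
qed

section \<open>Covariances at lags zero and two\<close>

lemma kmean_lim: "(\<lambda>n. kmean n j / b n) \<longlonglongrightarrow> f (x j)"
  using kernel_local_limit[OF K_measurable K_nonneg K_le_K0 K_int K_anti K_tail1 f_nonneg X_density f_cont b_pos b_0, of j]
  by (simp add: kmean_def K_one)

lemma kpair_diag_lim: "(\<lambda>n. kpair n j j 0 / b n) \<longlonglongrightarrow> f (x j) * K_sq"
proof -
  have "(\<lambda>n. expectation (\<lambda>\<omega>. (K ((x j - X 0 \<omega>) / b n))\<^sup>2) / b n) \<longlonglongrightarrow> f (x j) * (\<integral>u. (K u)\<^sup>2 \<partial>lborel)"
  proof (rule kernel_local_limit[of "\<lambda>u. (K u)\<^sup>2" "(K 0)\<^sup>2"])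
    show "((\<lambda>u. u * (K u)\<^sup>2) \<longlongrightarrow> 0) at_top"
    proof (rule tendsto_sandwich)
      show "\<forall>\<^sub>F u in at_top. 0 \<le> u * (K u)\<^sup>2"
        using eventually_ge_at_top[of 0] by eventually_elim simp
      show "\<forall>\<^sub>F u in at_top. u * (K u)\<^sup>2 \<le> K 0 * (u * K u)"
        using eventually_ge_at_top[of 0] by eventually_elim (use K2_le in \<open>simp add: mult.left_commute mult_left_mono\<close>)
      show "((\<lambda>u. K 0 * (u * K u)) \<longlongrightarrow> 0) at_top" using tendsto_mult_right_zero[OF K_tail1] .
    qed simp
  qed (auto intro!: power_mono K_nonneg K_le_K0 K2_int K_anti f_nonneg X_density f_cont b_pos b_0)
  then show ?thesis by (simp add: kpair_def K_sq_def power2_eq_square)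
qed

text \<open>With \<open>r\<close> half the distance of the two points, every observation is at least
  \<open>r\<close> away from one of them. That kernel value is at most K(r/b), which tends to 0, and
  the mean of the other is of order b.\<close>

lemma kpair_off_lim:
  assumes "i \<noteq> j"
  shows "(\<lambda>n. kpair n i j 0 / b n) \<longlonglongrightarrow> 0"
proof -
  define r where "r = \<bar>x i - x j\<bar> / 2"
  have r: "r > 0" using assms x_inj by (auto simp: r_def inj_def)
  have "(\<lambda>n. K (r / b n)) \<longlonglongrightarrow> 0"
  proof -
    have "(K \<longlongrightarrow> 0) at_top"
    proof (rule tendsto_sandwich[OF _ _ tendsto_const K_tail1])
      show "\<forall>\<^sub>F u in at_top. 0 \<le> K u" by (simp add: K_nonneg)
      show "\<forall>\<^sub>F u in at_top. K u \<le> u * K u"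
        using eventually_ge_at_top[of 1]
      proof eventually_elim
        case (elim u)
        then show ?case using mult_right_mono[of 1 u "K u"] K_nonneg[of u] by simp
      qed
    qed
    then show ?thesis by (rule filterlim_compose[OF _ inverse_b_top[OF r]])
  qed
  then have lim: "(\<lambda>n. K (r / b n) * (kmean n i / b n + kmean n j / b n)) \<longlonglongrightarrow> 0 * (f (x i) + f (x j))"
    by (intro tendsto_intros kmean_lim)
  show ?thesis
  proof (rule tendsto_sandwich)
    show "\<forall>\<^sub>F n in sequentially. 0 \<le> kpair n i j 0 / b n"
      using b_pos_eventually by eventually_elim (auto simp: kpair_def K_nonneg intro!: divide_nonneg_pos Bochner_Integration.integral_nonneg)
    show "\<forall>\<^sub>F n in sequentially. kpair n i j 0 / b n \<le> K (r / b n) * (kmean n i / b n + kmean n j / b n)"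
      using b_pos_eventually
    proof eventually_elim
      case (elim n)
      have "kpair n i j 0 \<le> expectation (\<lambda>\<omega>. K (r / b n) * (K ((x i - X 0 \<omega>) / b n) + K ((x j - X 0 \<omega>) / b n)))"
        unfolding kpair_def of_nat_0
      proof (rule integral_mono)
        fix \<omega>
        let ?A = "K ((x i - X 0 \<omega>) / b n)" and ?B = "K ((x j - X 0 \<omega>) / b n)"
        have small: "K ((c - X 0 \<omega>) / b n) \<le> K (r / b n)" if "r \<le> \<bar>c - X 0 \<omega>\<bar>" for c
          using that elim r by (intro K_anti) (auto simp: abs_divide divide_right_mono)
        have "r \<le> \<bar>x i - X 0 \<omega>\<bar> \<or> r \<le> \<bar>x j - X 0 \<omega>\<bar>"
          using abs_triangle_ineq4[of "x i - X 0 \<omega>" "x j - X 0 \<omega>"] unfolding r_def by auto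
        then have "?A * ?B \<le> K (r / b n) * ?B \<or> ?A * ?B \<le> K (r / b n) * ?A"
          using mult_right_mono[OF small[of "x i"] K_nonneg[of "(x j - X 0 \<omega>) / b n"]]
            mult_left_mono[OF small[of "x j"] K_nonneg[of "(x i - X 0 \<omega>) / b n"]]
          by (auto simp: mult.commute)
        moreover have "K (r / b n) * ?A \<ge> 0" "K (r / b n) * ?B \<ge> 0" by (simp_all add: K_nonneg)
        ultimately show "?A * ?B \<le> K (r / b n) * (?A + ?B)" unfolding distrib_left by linarith
      qed (use K_integrable KK_integrable in auto)
      also have "\<dots> = K (r / b n) * (kmean n i + kmean n j)"
        using K_integrable by (simp add: kmean_def)
      finally have "kpair n i j 0 / b n \<le> K (r / b n) * (kmean n i + kmean n j) / b n"
        using elim by (intro divide_right_mono) auto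
      then show ?case by (simp add: distrib_left add_divide_distrib)
    qed
  qed (use lim in auto)
qed

lemma kmean_prod_lim: "(\<lambda>n. kmean n i * kmean n j / b n) \<longlonglongrightarrow> 0"
proof -
  have "(\<lambda>n. (kmean n i / b n) * (kmean n j / b n) * b n) \<longlonglongrightarrow> f (x i) * f (x j) * 0"
    by (intro tendsto_intros kmean_lim b_0)
  moreover have "\<forall>\<^sub>F n in sequentially. (kmean n i / b n) * (kmean n j / b n) * b n = kmean n i * kmean n j / b n"
    using b_pos_eventually by eventually_elim (simp add: field_simps)
  ultimately show ?thesis using Lim_transform_eventually by fastforce
qed

text \<open>The limit of the lag-zero variance of \<open>G\<close>. It is a diagonal form because
  the kernel windows at distinct points separate as the bandwidth shrinks; this is the source of the
  identity covariance.\<close>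

definition asy_var :: "('m \<Rightarrow> real) \<Rightarrow> real" where
  "asy_var \<tau> = (\<Sum>j\<in>UNIV. (\<tau> j)\<^sup>2 * (f (x j) * K_sq))"

lemma asy_var_nonneg: "asy_var \<tau> \<ge> 0"
  unfolding asy_var_def using f_pos K_sq_pos by (intro sum_nonneg mult_nonneg_nonneg) (auto simp: less_imp_le)

lemma acf_0_lim: "(\<lambda>n. acf (G \<tau> n) 0) \<longlonglongrightarrow> asy_var \<tau>"
proof -
  have "(\<lambda>n. kpair n i j 0 / b n - kmean n i * kmean n j / b n) \<longlonglongrightarrow> (if i = j then f (x j) * K_sq else 0) - 0" for i j
    using kpair_diag_lim[of j] kpair_off_lim[of i j] by (intro tendsto_diff kmean_prod_lim) auto
  then have "(\<lambda>n. \<Sum>i\<in>UNIV. \<Sum>j\<in>UNIV. \<tau> i * \<tau> j * (kpair n i j 0 / b n - kmean n i * kmean n j / b n)) \<longlonglongrightarrow>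
      (\<Sum>i\<in>UNIV. \<Sum>j\<in>UNIV. \<tau> i * \<tau> j * ((if i = j then f (x j) * K_sq else 0) - 0))"
    by (intro tendsto_sum tendsto_mult tendsto_const)
  also have "(\<Sum>i\<in>UNIV. \<Sum>j\<in>UNIV. \<tau> i * \<tau> j * ((if i = j then f (x j) * K_sq else 0) - 0)) = asy_var \<tau>"
  proof -
    have "(\<Sum>j\<in>UNIV. \<tau> i * \<tau> j * ((if i = j then f (x j) * K_sq else 0) - 0)) =
        (\<Sum>j\<in>UNIV. if j = i then (\<tau> i)\<^sup>2 * (f (x i) * K_sq) else 0)" for i
      by (intro sum.cong refl) (auto simp: power2_eq_square)
    then show ?thesis unfolding asy_var_def by simp
  qed
  finally show ?thesis
    by (rule Lim_transform_eventually)
       (use b_pos_eventually in eventually_elim, simp add: acf_G diff_divide_distrib)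
qed

text \<open>Both the mixed moment at lag 2 and the product of the means are of order b^2, and the
  normalisation divides by b once. There are finitely many pairs of points, so one threshold for
  \<open>n\<close> serves all.\<close>

lemma acf_2_bound: "\<exists>C\<ge>0. \<forall>\<^sub>F n in sequentially. acf (G \<tau> n) 2 \<le> C * b n"
proof -
  have ex: "\<exists>C. \<forall>\<^sub>F n in sequentially. \<bar>kcov n i j 2\<bar> \<le> C * b n" for i j
  proof -
    obtain r C where r: "r > 0" and C: "\<And>s t. \<bar>s\<bar> < r \<Longrightarrow> \<bar>t\<bar> < r \<Longrightarrow> \<bar>f2 (x i + s, x j + t)\<bar> < C"
      using f2_bdd[of i j] by blast
    have C': "f2 (x i + s, x j + t) \<le> C" if "\<bar>s\<bar> < r" "\<bar>t\<bar> < r" for s t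
      using C[OF that] by simp
    have pair: "kpair n i j 2 \<le> C * (b n)\<^sup>2 + K 0 * K (r / b n)" if "n \<ge> 1" for n
      using kernel_pair_bound[OF K_measurable K_nonneg K_le_K0 K_int K_one K_anti f2_nonneg X_density2 C' r b_pos[OF that]]
      by (simp add: kpair_def)
    \<comment> \<open>Equivalent to K(r/b) < b^2: condition (C2) makes the contribution away from
      the pair of points as small as that of the density.\<close>
    have "\<forall>\<^sub>F n in sequentially. (r / b n)\<^sup>2 * K (r / b n) < r\<^sup>2"
      by (rule order_tendstoD(2)[OF filterlim_compose[OF K_tail inverse_b_top[OF r]]]) (use r in simp)
    moreover have "\<forall>\<^sub>F n in sequentially. kmean n i / b n * (kmean n j / b n) < f (x i) * f (x j) + 1"
      by (rule order_tendstoD(2)[OF tendsto_mult[OF kmean_lim kmean_lim]]) simp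
    ultimately have "\<forall>\<^sub>F n in sequentially. \<bar>kcov n i j 2\<bar> \<le> (C + K 0 + (f (x i) * f (x j) + 1)) * b n"
      using b_pos_eventually
    proof eventually_elim
      case (elim n)
      have "K (r / b n) \<le> (b n)\<^sup>2" using elim r by (simp add: field_simps power_divide)
      then have "K 0 * K (r / b n) \<le> K 0 * (b n)\<^sup>2" by (intro mult_left_mono K_nonneg)
      then have 1: "kpair n i j 2 \<le> (C + K 0) * (b n)\<^sup>2"
        using pair[of n] elim by (simp add: algebra_simps)
      have 2: "kmean n i * kmean n j \<le> (f (x i) * f (x j) + 1) * (b n)\<^sup>2"
        using elim by (simp add: field_simps power2_eq_square)
      have 3: "kpair n i j 2 \<ge> 0" unfolding kpair_def by (intro Bochner_Integration.integral_nonneg) (simp add: K_nonneg)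
      have 4: "kmean n i * kmean n j \<ge> 0" by (simp add: kmean_bounds)
      have "\<bar>kpair n i j 2 - kmean n i * kmean n j\<bar> \<le> (C + K 0) * (b n)\<^sup>2 + (f (x i) * f (x j) + 1) * (b n)\<^sup>2"
        using 1 2 3 4 by linarith
      then have "\<bar>kpair n i j 2 - kmean n i * kmean n j\<bar> \<le> ((C + K 0 + (f (x i) * f (x j) + 1)) * b n) * b n"
        by (simp add: algebra_simps power2_eq_square)
      then show ?case using elim by (simp add: abs_divide divide_le_eq)
    qed
    then show ?thesis by blast
  qed
  define C where "C i j = (SOME C. \<forall>\<^sub>F n in sequentially. \<bar>kcov n i j 2\<bar> \<le> C * b n)" for i j
  have C: "\<forall>\<^sub>F n in sequentially. \<bar>kcov n i j 2\<bar> \<le> C i j * b n" for i j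
    unfolding C_def by (rule someI_ex[OF ex])
  define D where "D = (\<Sum>i\<in>UNIV. \<Sum>j\<in>UNIV. \<bar>\<tau> i * \<tau> j\<bar> * \<bar>C i j\<bar>)"
  have "\<forall>\<^sub>F n in sequentially. \<forall>i\<in>UNIV. \<forall>j\<in>UNIV. \<bar>kcov n i j 2\<bar> \<le> C i j * b n"
    using C by (intro eventually_ball_finite ballI) auto
  then have "\<forall>\<^sub>F n in sequentially. acf (G \<tau> n) 2 \<le> D * b n"
    using b_pos_eventually
  proof eventually_elim
    case (elim n)
    have "acf (G \<tau> n) 2 \<le> (\<Sum>i\<in>UNIV. \<Sum>j\<in>UNIV. \<bar>\<tau> i * \<tau> j\<bar> * \<bar>C i j\<bar> * b n)"
      unfolding acf_G[OF conjunct1[OF elim(2)]]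
    proof (intro sum_mono)
      fix i j
      have "\<tau> i * \<tau> j * kcov n i j 2 \<le> \<bar>\<tau> i * \<tau> j\<bar> * \<bar>kcov n i j 2\<bar>"
        by (rule order_trans[OF abs_ge_self]) (simp add: abs_mult)
      also have "\<dots> \<le> \<bar>\<tau> i * \<tau> j\<bar> * (\<bar>C i j\<bar> * b n)"
        using elim by (intro mult_left_mono order_trans[OF elim(1)[rule_format]] mult_right_mono) auto
      finally show "\<tau> i * \<tau> j * kcov n i j 2 \<le> \<bar>\<tau> i * \<tau> j\<bar> * \<bar>C i j\<bar> * b n"
        by (simp add: mult.assoc)
    qed
    then show ?case by (simp add: D_def sum_distrib_right)
  qed
  moreover have "D \<ge> 0" unfolding D_def by (intro sum_nonneg) auto
  ultimately show ?thesis by blast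
qed


section \<open>Summing the covariances from lag two on\<close>

definition wt :: "('m \<Rightarrow> real) \<Rightarrow> real" where "wt \<tau> = (\<Sum>j\<in>UNIV. \<bar>\<tau> j\<bar>)"

lemma wt_nonneg: "wt \<tau> \<ge> 0"
  unfolding wt_def by (intro sum_nonneg) auto

lemma dK_nonneg: "dK_bound \<ge> 0"
  using order_trans[OF abs_ge_zero dK_le] .

lemma K0_nonneg: "K 0 \<ge> 0"
  by (rule K_nonneg)

text \<open>\<open>G\<close> has mean zero, so its \<open>acf\<close> is a covariance; its
  derivative is of order b^(-3/2), and Hoeffding's formula squares it.\<close>

lemma acf_G_eta:
  assumes "n \<ge> 1" "k \<ge> 1"
  shows "\<bar>acf (G \<tau> n) k\<bar> \<le> (wt \<tau> * dK_bound)\<^sup>2 / b n ^ 3 * (1 / (real k ^ 4 * l (real k)))"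
proof -
  have "\<bar>acf (G \<tau> n) k - (expectation (\<lambda>\<omega>. G \<tau> n (X 0 \<omega>)))\<^sup>2\<bar>
      \<le> (wt \<tau> * (dK_bound / b n / sqrt (b n)))\<^sup>2 * (1 / (real k ^ 4 * l (real k)))"
    using eta[OF assms(2)] l_pos[of "real k"] assms
    by (intro acf_le_eta[OF G_der G_der_bound[folded wt_def] G_bound]) auto
  also have "(wt \<tau> * (dK_bound / b n / sqrt (b n)))\<^sup>2 = (wt \<tau> * dK_bound)\<^sup>2 / b n ^ 3"
    using b_pos[OF assms(1)] by (simp add: power_mult_distrib power_divide power2_eq_square power3_eq_cube)
  finally show ?thesis by (simp add: E_G)
qed

text \<open>The uniform bound for the near lags is the lag-two value, which dominates all later
  ones. The decaying bound holds at k + 2 and is weakened to k, as \<open>l\<close>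
  increases.\<close>

lemma acf_sum_lim: "(\<lambda>n. \<Sum>k=1..n. \<bar>acf (G \<tau> n) (k + 2)\<bar>) \<longlonglongrightarrow> 0"
proof -
  obtain C where C: "C \<ge> 0" "\<forall>\<^sub>F n in sequentially. acf (G \<tau> n) 2 \<le> C * b n"
    using acf_2_bound by blast
  define a where "a n k = (if n \<ge> 1 then \<bar>acf (G \<tau> n) (k + 2)\<bar> else 0)" for n k
  have "(\<lambda>n. \<Sum>k=1..n. a n k) \<longlonglongrightarrow> 0"
  proof (rule sum_covariances_tendsto_0[of a C b "(wt \<tau> * dK_bound)\<^sup>2" l])
    show "\<forall>\<^sub>F n in sequentially. \<forall>k. a n k \<le> C * b n"
      using C(2) b_pos_eventually
    proof eventually_elim
      case (elim n)
      then have "n \<ge> 1" by simp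
      show ?case
        using acf_2_bounds(2)[OF G_measurable G_bound[OF \<open>n \<ge> 1\<close>], of \<tau>] elim \<open>n \<ge> 1\<close>
        by (auto simp: a_def intro: order_trans)
    qed
    show "a n k \<le> (wt \<tau> * dK_bound)\<^sup>2 / b n ^ 3 * (1 / (real k ^ 4 * l (real k)))" if "n \<ge> 1" "k \<ge> 1" for n k
    proof -
      have "\<bar>acf (G \<tau> n) (k + 2)\<bar> \<le> (wt \<tau> * dK_bound)\<^sup>2 / b n ^ 3 * (1 / (real (k + 2) ^ 4 * l (real (k + 2))))"
        using that by (intro acf_G_eta) auto
      also have "\<dots> \<le> (wt \<tau> * dK_bound)\<^sup>2 / b n ^ 3 * (1 / (real k ^ 4 * l (real k)))"
      proof (intro mult_left_mono divide_left_mono mult_mono power_mono)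
        show "l (real k) \<le> l (real (k + 2))" using that by (intro mono_onD[OF l_mono]) auto
      qed (use that l_pos[of "real k"] l_pos[of "real (k + 2)"] b_pos[of n] in auto)
      finally show ?thesis using that by (simp add: a_def)
    qed
  qed (use C(1) b_pos b_0 l_pos l_mono l_top in \<open>auto simp: a_def\<close>)
  then show ?thesis
    by (rule Lim_transform_eventually) (use eventually_ge_at_top[of 1] in eventually_elim, simp add: a_def)
qed

lemma acf_2_lim: "(\<lambda>n. acf (G \<tau> n) 2) \<longlonglongrightarrow> 0"
proof -
  obtain C where C: "C \<ge> 0" "\<forall>\<^sub>F n in sequentially. acf (G \<tau> n) 2 \<le> C * b n"
    using acf_2_bound by blast
  show ?thesis
  proof (rule tendsto_sandwich[OF _ C(2) tendsto_const])
    show "\<forall>\<^sub>F n in sequentially. 0 \<le> acf (G \<tau> n) 2"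
      using b_pos_eventually
    proof eventually_elim
      case (elim n)
      then show ?case using acf_2_bounds(1)[OF G_measurable G_bound] by blast
    qed
    show "(\<lambda>n. C * b n) \<longlonglongrightarrow> 0" using tendsto_mult_right_zero[OF b_0] .
  qed
qed

section \<open>The law of large numbers for the squares\<close>

lemma inverse_nb4_lim: "(\<lambda>n. 1 / (real n * b n ^ 4)) \<longlonglongrightarrow> 0"
  using tendsto_inverse_0_at_top[OF nb4] by (simp add: inverse_eq_divide)

lemma inverse_nb_lim: "(\<lambda>n. 1 / (real n * b n)) \<longlonglongrightarrow> 0"
proof -
  have "(\<lambda>n. 1 / (real n * b n ^ 4) * b n ^ 3) \<longlonglongrightarrow> 0 * 0 ^ 3"
    by (intro tendsto_intros inverse_nb4_lim b_0)
  moreover have "\<forall>\<^sub>F n in sequentially. 1 / (real n * b n ^ 4) * b n ^ 3 = 1 / (real n * b n)"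
    using b_pos_eventually by eventually_elim (simp add: power3_eq_cube power4_eq_xxxx)
  ultimately show ?thesis by (auto elim: Lim_transform_eventually)
qed

lemma inverse_sqrt_nb_lim: "(\<lambda>n. 1 / (sqrt (real n) * sqrt (b n))) \<longlonglongrightarrow> 0"
  using tendsto_real_sqrt[OF inverse_nb_lim] by (simp add: real_sqrt_divide real_sqrt_mult)

text \<open>Centre G^2 by its exact mean \<open>v n\<close>. The variance at lag 0 is of order 1/b;
  the derivative of G^2 is of order b^(-2), so Hoeffding's formula, with l(k) at least l(1), gives
  covariances of order b^(-4) k^(-4), summable in k. The average has variance at most
  \<open>R n\<close>, and \<open>v n\<close> tends to \<open>asy_var\<close>.\<close>

lemma square_average_lim:
  "(\<lambda>n. expectation (\<lambda>\<omega>. \<bar>(\<Sum>k<n. (G \<tau> n (X (int k + 1) \<omega>))\<^sup>2) / n - asy_var \<tau>\<bar>)) \<longlonglongrightarrow> 0"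
proof -
  define A where "A = wt \<tau> * K 0"
  define D where "D = wt \<tau> * dK_bound"
  have AD: "A \<ge> 0" "D \<ge> 0" by (auto simp: A_def D_def wt_nonneg dK_nonneg K0_nonneg)
  define v where "v n = acf (G \<tau> n) 0" for n
  \<comment> \<open>The first summand is the lag-zero part. In the second, 2 counts both signs of
    the lag, 4 A^2 D^2 is the square of the constant in the derivative bound 2 A D / b^2, and 2 / l
    1 bounds the sum of k^(-4) / l(k).\<close>
  define R where "R n = (A\<^sup>2 * v n) * (1 / (real n * b n)) + (2 * (4 * A\<^sup>2 * D\<^sup>2) * (2 / l 1)) * (1 / (real n * b n ^ 4))" for n
  have main: "expectation (\<lambda>\<omega>. \<bar>(\<Sum>k<n. (G \<tau> n (X (int k + 1) \<omega>))\<^sup>2) / n - asy_var \<tau>\<bar>) \<le> sqrt (R n) + \<bar>v n - asy_var \<tau>\<bar>"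
    if "n \<ge> 1" for n
  proof -
    note bn = b_pos[OF that]
    have n: "real n > 0" using that by simp
    define \<phi> where "\<phi> u = (G \<tau> n u)\<^sup>2 - v n" for u
    define d where "d u = (\<Sum>j\<in>UNIV. \<tau> j * (- deriv K ((x j - u) / b n) / b n / sqrt (b n)))" for u
    have Gb: "\<bar>G \<tau> n u\<bar> \<le> A / sqrt (b n)" for u using G_bound[OF that] by (simp add: A_def wt_def)
    have db: "\<bar>d u\<bar> \<le> D / b n / sqrt (b n)" for u using G_der_bound[OF that] by (simp add: d_def D_def wt_def)
    have G2b: "(G \<tau> n u)\<^sup>2 \<le> A\<^sup>2 / b n" for u
      using power_mono[OF Gb[of u] abs_ge_zero, of 2] bn by (simp add: power_divide)
    have iG2: "integrable M (\<lambda>\<omega>. (G \<tau> n (X k \<omega>))\<^sup>2)" for k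
      using G2b by (intro bounded_integrable[of _ "A\<^sup>2 / b n"]) auto
    have v: "expectation (\<lambda>\<omega>. (G \<tau> n (X k \<omega>))\<^sup>2) = v n" for k
      unfolding v_def by (rule expectation_square) measurable
    have v0: "v n \<ge> 0" unfolding v_def by (rule acf_0_nonneg)
    have \<phi>m[measurable]: "\<phi> \<in> borel_measurable borel" unfolding \<phi>_def[abs_def] by measurable
    have \<phi>b: "\<bar>\<phi> u\<bar> \<le> A\<^sup>2 / b n + v n" for u
      using G2b[of u] v0 zero_le_power2[of "G \<tau> n u"] unfolding \<phi>_def abs_le_iff by linarith
    have E\<phi>: "expectation (\<lambda>\<omega>. \<phi> (X 0 \<omega>)) = 0"
      using iG2 v[of 0] by (simp add: \<phi>_def prob_space)
    have \<phi>d: "(\<phi> has_real_derivative 2 * G \<tau> n u * d u) (at u)" for u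
      unfolding \<phi>_def[abs_def] d_def
      by (rule DERIV_cong[OF DERIV_diff[OF DERIV_power[OF G_der[OF that]] DERIV_const]]) (simp add: mult_ac)
    have \<phi>d_le: "\<bar>2 * G \<tau> n u * d u\<bar> \<le> 2 * A * D / (b n)\<^sup>2" for u
    proof -
      have "\<bar>2 * G \<tau> n u * d u\<bar> \<le> 2 * (A / sqrt (b n)) * (D / b n / sqrt (b n))"
        unfolding abs_mult using Gb[of u] db[of u] AD bn by (intro mult_mono) auto
      also have "\<dots> = 2 * A * D / (b n)\<^sup>2" using bn by (simp add: power2_eq_square)
      finally show ?thesis .
    qed
    have acf\<phi>: "\<bar>acf \<phi> k\<bar> \<le> (2 * A * D / (b n)\<^sup>2)\<^sup>2 * (1 / (real k ^ 4 * l (real k)))" if "k \<ge> 1" for k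
      using acf_le_eta[OF \<phi>d \<phi>d_le \<phi>b eta[OF that]] l_pos[of "real k"] that by (simp add: E\<phi>)
    have acf\<phi>': "\<bar>acf \<phi> k\<bar> \<le> 4 * A\<^sup>2 * D\<^sup>2 / b n ^ 4 * (1 / l 1) * (1 / real k ^ 4)" if "k \<ge> 1" for k
    proof -
      have "l 1 \<le> l (real k)" using that by (intro mono_onD[OF l_mono]) auto
      then have "1 / (real k ^ 4 * l (real k)) \<le> 1 / (real k ^ 4 * l 1)"
        using that l_pos[of 1] by (intro divide_left_mono mult_left_mono mult_pos_pos) auto
      then have "(2 * A * D / (b n)\<^sup>2)\<^sup>2 * (1 / (real k ^ 4 * l (real k))) \<le> (2 * A * D / (b n)\<^sup>2)\<^sup>2 * (1 / (real k ^ 4 * l 1))"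
        by (intro mult_left_mono) auto
      with acf\<phi>[OF that] have "\<bar>acf \<phi> k\<bar> \<le> (2 * A * D / (b n)\<^sup>2)\<^sup>2 * (1 / (real k ^ 4 * l 1))" by linarith
      also have "\<dots> = 4 * A\<^sup>2 * D\<^sup>2 / b n ^ 4 * (1 / l 1) * (1 / real k ^ 4)"
        by (simp add: power_mult_distrib power_divide power_mult[symmetric])
      finally show ?thesis .
    qed
    have sum\<phi>: "(\<Sum>k=1..n. \<bar>acf \<phi> k\<bar>) \<le> 4 * A\<^sup>2 * D\<^sup>2 / b n ^ 4 * (1 / l 1) * 2"
    proof -
      have "(\<Sum>k=1..n. \<bar>acf \<phi> k\<bar>) \<le> (\<Sum>k=1..n. 4 * A\<^sup>2 * D\<^sup>2 / b n ^ 4 * (1 / l 1) * (1 / real k ^ 4))"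
        using acf\<phi>' by (intro sum_mono) auto
      also have "\<dots> = 4 * A\<^sup>2 * D\<^sup>2 / b n ^ 4 * (1 / l 1) * (\<Sum>k=1..n. 1 / real k ^ 4)"
        by (simp only: sum_distrib_left)
      also have "\<dots> \<le> 4 * A\<^sup>2 * D\<^sup>2 / b n ^ 4 * (1 / l 1) * 2"
        using bn l_pos[of 1] by (intro mult_left_mono sum_inverse_fourth_power_le) auto
      finally show ?thesis .
    qed
    \<comment> \<open>In (y - v)^2 with y = G^2 the term y^2 is lowered to (A^2/b) y by the sup
      bound, so only the known first moment of y remains.\<close>
    have acf\<phi>0: "acf \<phi> 0 \<le> A\<^sup>2 / b n * v n"
    proof -
      have i: "integrable M (\<lambda>\<omega>. (A\<^sup>2 / b n - 2 * v n) * (G \<tau> n (X 0 \<omega>))\<^sup>2 + (v n)\<^sup>2)" using iG2 by simp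
      have "acf \<phi> 0 \<le> expectation (\<lambda>\<omega>. (A\<^sup>2 / b n - 2 * v n) * (G \<tau> n (X 0 \<omega>))\<^sup>2 + (v n)\<^sup>2)"
        unfolding acf_0
      proof (rule integral_mono'[OF i])
        fix \<omega>
        let ?y = "(G \<tau> n (X 0 \<omega>))\<^sup>2"
        have "?y * ?y \<le> A\<^sup>2 / b n * ?y" by (intro mult_right_mono G2b) simp
        then show *: "(\<phi> (X 0 \<omega>))\<^sup>2 \<le> (A\<^sup>2 / b n - 2 * v n) * ?y + (v n)\<^sup>2"
          unfolding \<phi>_def by (simp add: power2_eq_square algebra_simps)
        show "0 \<le> (A\<^sup>2 / b n - 2 * v n) * ?y + (v n)\<^sup>2" by (rule order_trans[OF zero_le_power2 *])
      qed
      also have "\<dots> = (A\<^sup>2 / b n - 2 * v n) * v n + (v n)\<^sup>2" using iG2 v[of 0] by (simp add: prob_space)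
      also have "\<dots> \<le> A\<^sup>2 / b n * v n" by (simp add: algebra_simps power2_eq_square)
      finally show ?thesis .
    qed
    let ?S = "\<lambda>\<omega>. \<Sum>k<n. \<phi> (X (int k + 1) \<omega>)"
    have S2: "expectation (\<lambda>\<omega>. (?S \<omega>)\<^sup>2) / n\<^sup>2 \<le> R n"
    proof -
      have "expectation (\<lambda>\<omega>. (?S \<omega>)\<^sup>2) \<le> real n * (acf \<phi> 0 + 2 * (\<Sum>k=1..n. \<bar>acf \<phi> k\<bar>))"
        by (rule sum_second_moment[OF \<phi>m \<phi>b])
      also have "\<dots> \<le> real n * (A\<^sup>2 / b n * v n + 2 * (4 * A\<^sup>2 * D\<^sup>2 / b n ^ 4 * (1 / l 1) * 2))"
        using acf\<phi>0 sum\<phi> by (intro mult_left_mono add_mono) auto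
      finally have "expectation (\<lambda>\<omega>. (?S \<omega>)\<^sup>2) / n\<^sup>2 \<le> real n * (A\<^sup>2 / b n * v n + 2 * (4 * A\<^sup>2 * D\<^sup>2 / b n ^ 4 * (1 / l 1) * 2)) / n\<^sup>2"
        by (intro divide_right_mono) auto
      also have "\<dots> = R n" unfolding R_def using n by (simp add: power2_eq_square field_simps)
      finally show ?thesis .
    qed
    have iS: "integrable M ?S"
      using \<phi>b by (intro Bochner_Integration.integrable_sum bounded_integrable[of _ "A\<^sup>2 / b n + v n"]) auto
    have iS2: "integrable M (\<lambda>\<omega>. (?S \<omega>)\<^sup>2)"
      unfolding power2_eq_square sum_product
      by (intro Bochner_Integration.integrable_sum bounded_prod_integrable[OF \<phi>m \<phi>m \<phi>b \<phi>b])
    have "expectation (\<lambda>\<omega>. \<bar>(\<Sum>k<n. (G \<tau> n (X (int k + 1) \<omega>))\<^sup>2) / n - asy_var \<tau>\<bar>)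
       \<le> expectation (\<lambda>\<omega>. \<bar>?S \<omega>\<bar> / n + \<bar>v n - asy_var \<tau>\<bar>)"
    proof (rule integral_mono')
      fix \<omega>
      have "(\<Sum>k<n. (G \<tau> n (X (int k + 1) \<omega>))\<^sup>2) / n - asy_var \<tau> = ?S \<omega> / n + (v n - asy_var \<tau>)"
        using n by (simp add: \<phi>_def sum_subtractf diff_divide_distrib)
      then show "\<bar>(\<Sum>k<n. (G \<tau> n (X (int k + 1) \<omega>))\<^sup>2) / n - asy_var \<tau>\<bar> \<le> \<bar>?S \<omega>\<bar> / n + \<bar>v n - asy_var \<tau>\<bar>"
        using abs_triangle_ineq[of "?S \<omega> / n" "v n - asy_var \<tau>"] n by (simp add: abs_divide)
    qed (use iS in auto)
    also have "\<dots> = expectation (\<lambda>\<omega>. \<bar>?S \<omega>\<bar>) / n + \<bar>v n - asy_var \<tau>\<bar>"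
      using iS by (simp add: prob_space)
    also have "expectation (\<lambda>\<omega>. \<bar>?S \<omega>\<bar>) / n \<le> sqrt (expectation (\<lambda>\<omega>. (?S \<omega>)\<^sup>2)) / n"
      using expectation_abs_le_sqrt[OF iS iS2] n by (simp add: divide_right_mono)
    also have "\<dots> = sqrt (expectation (\<lambda>\<omega>. (?S \<omega>)\<^sup>2) / n\<^sup>2)" by (simp add: real_sqrt_divide)
    also have "\<dots> \<le> sqrt (R n)" by (intro real_sqrt_le_mono S2)
    finally show ?thesis by simp
  qed
  have "R \<longlonglongrightarrow> (A\<^sup>2 * asy_var \<tau>) * 0 + (2 * (4 * A\<^sup>2 * D\<^sup>2) * (2 / l 1)) * 0"
    unfolding R_def[abs_def] v_def by (intro tendsto_intros inverse_nb_lim inverse_nb4_lim acf_0_lim)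
  then have "(\<lambda>n. sqrt (R n)) \<longlonglongrightarrow> sqrt 0" by (intro tendsto_real_sqrt) simp
  moreover have "(\<lambda>n. \<bar>v n - asy_var \<tau>\<bar>) \<longlonglongrightarrow> \<bar>asy_var \<tau> - asy_var \<tau>\<bar>"
    unfolding v_def by (intro tendsto_intros acf_0_lim)
  ultimately have "(\<lambda>n. sqrt (R n) + \<bar>v n - asy_var \<tau>\<bar>) \<longlonglongrightarrow> sqrt 0 + \<bar>asy_var \<tau> - asy_var \<tau>\<bar>" by (rule tendsto_add)
  then have lim: "(\<lambda>n. sqrt (R n) + \<bar>v n - asy_var \<tau>\<bar>) \<longlonglongrightarrow> 0" by simp
  show ?thesis
  proof (rule tendsto_sandwich[OF _ _ tendsto_const lim])
    show "\<forall>\<^sub>F n in sequentially. expectation (\<lambda>\<omega>. \<bar>(\<Sum>k<n. (G \<tau> n (X (int k + 1) \<omega>))\<^sup>2) / n - asy_var \<tau>\<bar>) \<le> sqrt (R n) + \<bar>v n - asy_var \<tau>\<bar>"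
      using eventually_ge_at_top[of 1] by eventually_elim (rule main)
  qed simp
qed

section \<open>The central limit theorem for linear combinations\<close>

definition S :: "('m \<Rightarrow> real) \<Rightarrow> nat \<Rightarrow> 'a \<Rightarrow> real" where
  "S \<tau> n \<omega> = (\<Sum>k<n. G \<tau> n (X (int k + 1) \<omega>)) / sqrt n"

lemma S_measurable [measurable]: "S \<tau> n \<in> borel_measurable M"
  unfolding S_def[abs_def] by measurable

text \<open>All terms of \<open>clt_bound\<close> vanish: the increments are of order (n b)^(-1/2),
  the squares average to \<open>asy_var\<close>, and the cross term is a bounded factor times the
  root of the vanishing lag-two value.\<close>

lemma S_char_lim: "(\<lambda>n. expectation (\<lambda>\<omega>. cis (S \<tau> n \<omega>))) \<longlonglongrightarrow> of_real (exp (- asy_var \<tau> / 2))"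
proof -
  define s where "s = asy_var \<tau>"
  define A where "A = wt \<tau> * K 0"
  define C where "C n = A / sqrt (b n)" for n
  have Clim: "(\<lambda>n. 2 * C n / sqrt n) \<longlonglongrightarrow> 0"
  proof -
    have "(\<lambda>n. 2 * A * (1 / (sqrt (real n) * sqrt (b n)))) \<longlonglongrightarrow> 2 * A * 0"
      by (intro tendsto_intros inverse_sqrt_nb_lim)
    then show ?thesis by (simp add: C_def mult.commute)
  qed
  let ?E = "\<lambda>n. expectation (\<lambda>\<omega>. \<bar>(\<Sum>k<n. (G \<tau> n (X (int k + 1) \<omega>))\<^sup>2) / n - s\<bar>)"
  let ?B = "\<lambda>n. exp ((s + 2) / 2) * (4 * (2 * C n / sqrt n) * (s + 2) +
         2 * (?E n + 2 * (sqrt (acf (G \<tau> n) 0) * sqrt (acf (G \<tau> n) 2)) + acf (G \<tau> n) 2))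
      + sqrt (acf (G \<tau> n) 2 + 2 * (\<Sum>k=1..n. \<bar>acf (G \<tau> n) (k + 2)\<bar>))"
  have "?B \<longlonglongrightarrow> exp ((s + 2) / 2) * (4 * 0 * (s + 2) + 2 * (0 + 2 * (sqrt s * sqrt 0) + 0)) + sqrt (0 + 2 * 0)"
    unfolding s_def
    by (intro tendsto_intros Clim square_average_lim acf_0_lim acf_2_lim acf_sum_lim)
  then have lim: "?B \<longlonglongrightarrow> 0" by simp
  have "\<forall>\<^sub>F n in sequentially. 2 * C n / sqrt n < 1"
    by (rule order_tendstoD(2)[OF Clim]) simp
  then have "\<forall>\<^sub>F n in sequentially. norm (expectation (\<lambda>\<omega>. cis (S \<tau> n \<omega>)) - of_real (exp (- s / 2))) \<le> ?B n"
    using eventually_ge_at_top[of 1]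
  proof eventually_elim
    case (elim n)
    have "\<bar>G \<tau> n u\<bar> \<le> C n" for u using G_bound[OF elim(2)] by (simp add: C_def A_def wt_def)
    then show ?case
      unfolding S_def using elim asy_var_nonneg by (intro clt_bound) (auto simp: s_def)
  qed
  then have "(\<lambda>n. expectation (\<lambda>\<omega>. cis (S \<tau> n \<omega>)) - of_real (exp (- s / 2))) \<longlonglongrightarrow> 0"
    using lim by (rule Lim_null_comparison)
  then show ?thesis unfolding s_def by (simp add: LIM_zero_iff)
qed

text \<open>For boundedness it suffices to compare lag 1 with lag 0, which accounts for the
  coefficient 3 = 1 + 2; lag 2 and the later ones tend to 0.\<close>

lemma S_second_moment: "\<exists>B. \<forall>\<^sub>F n in sequentially. expectation (\<lambda>\<omega>. (S \<tau> n \<omega>)\<^sup>2) \<le> B"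
proof -
  have "(\<lambda>n. 3 * acf (G \<tau> n) 0 + 2 * acf (G \<tau> n) 2 + 2 * (\<Sum>k=1..n. \<bar>acf (G \<tau> n) (k + 2)\<bar>)) \<longlonglongrightarrow>
     3 * asy_var \<tau> + 2 * 0 + 2 * 0"
    by (intro tendsto_intros acf_0_lim acf_2_lim acf_sum_lim)
  then have "\<forall>\<^sub>F n in sequentially. 3 * acf (G \<tau> n) 0 + 2 * acf (G \<tau> n) 2 + 2 * (\<Sum>k=1..n. \<bar>acf (G \<tau> n) (k + 2)\<bar>) < 3 * asy_var \<tau> + 1"
    by (intro order_tendstoD(2)) auto
  then have "\<forall>\<^sub>F n in sequentially. expectation (\<lambda>\<omega>. (S \<tau> n \<omega>)\<^sup>2) \<le> 3 * asy_var \<tau> + 1"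
    using eventually_ge_at_top[of 1]
  proof eventually_elim
    case (elim n)
    note m = G_measurable[of \<tau> n] and Gb = G_bound[OF elim(2), of \<tau>]
    have "(\<Sum>k=1..n. \<bar>acf (G \<tau> n) k\<bar>) \<le> (\<Sum>k\<in>{1, 2} \<union> {3..n + 2}. \<bar>acf (G \<tau> n) k\<bar>)"
      by (intro sum_mono2) auto
    also have "\<dots> = (\<Sum>k\<in>{1, 2}. \<bar>acf (G \<tau> n) k\<bar>) + (\<Sum>k=3..n + 2. \<bar>acf (G \<tau> n) k\<bar>)"
      by (intro sum.union_disjoint) auto
    also have "(\<Sum>k=3..n + 2. \<bar>acf (G \<tau> n) k\<bar>) = (\<Sum>k=1..n. \<bar>acf (G \<tau> n) (k + 2)\<bar>)"
      using sum.shift_bounds_cl_nat_ivl[of "\<lambda>k. \<bar>acf (G \<tau> n) k\<bar>" 1 2 n] by (simp add: numeral_3_eq_3)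
    also have "(\<Sum>k\<in>{1, 2}. \<bar>acf (G \<tau> n) k\<bar>) \<le> acf (G \<tau> n) 0 + acf (G \<tau> n) 2"
      using acf_le_acf_0[OF m Gb, of 1] acf_2_bounds(1)[OF m Gb] by simp
    finally have s: "(\<Sum>k=1..n. \<bar>acf (G \<tau> n) k\<bar>) \<le> acf (G \<tau> n) 0 + acf (G \<tau> n) 2 + (\<Sum>k=1..n. \<bar>acf (G \<tau> n) (k + 2)\<bar>)"
      by simp
    have n: "real n > 0" using elim by simp
    have "expectation (\<lambda>\<omega>. (S \<tau> n \<omega>)\<^sup>2) = expectation (\<lambda>\<omega>. (\<Sum>k<n. G \<tau> n (X (int k + 1) \<omega>))\<^sup>2) / n"
      unfolding S_def by (simp add: power_divide)
    also have "\<dots> \<le> acf (G \<tau> n) 0 + 2 * (\<Sum>k=1..n. \<bar>acf (G \<tau> n) k\<bar>)"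
      using sum_second_moment[OF m Gb, of 1 n] unfolding pos_divide_le_eq[OF n] by (simp only: mult.commute)
    finally show ?case using s elim(1) by linarith
  qed
  then show ?thesis by blast
qed


section \<open>Replacing the random denominator by its limit\<close>

definition Sj :: "nat \<Rightarrow> 'm \<Rightarrow> 'a \<Rightarrow> real" where
  "Sj n j \<omega> = (\<Sum>k<n. g n j (X (int k + 1) \<omega>)) / sqrt n"

lemma Sj_measurable [measurable]: "Sj n j \<in> borel_measurable M"
  unfolding Sj_def[abs_def] by measurable

lemma S_eq_sum: "S \<tau> n \<omega> = (\<Sum>j\<in>UNIV. \<tau> j * Sj n j \<omega>)"
  unfolding S_def Sj_def G_def
  by (subst sum.swap) (simp add: sum_divide_distrib sum_distrib_left)

lemma Sj_eq_S: "Sj n j = S (\<lambda>i. if i = j then 1 else 0) n"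
  by (rule ext) (simp add: S_eq_sum if_distrib[of "\<lambda>z. z * _"] cong: if_cong)

abbreviation fhat :: "nat \<Rightarrow> 'm \<Rightarrow> 'a \<Rightarrow> real" where
  "fhat n j \<equiv> kernel_density_estimator K b X n (x j)"

lemma fhat_eq_sum: "fhat n j \<omega> = (\<Sum>k<n. K ((x j - X (int k + 1) \<omega>) / b n)) / (real n * b n)"
proof -
  have "(\<Sum>k=1..n. K ((x j - X (int k) \<omega>) / b n)) = (\<Sum>k<n. K ((x j - X (int k + 1) \<omega>) / b n))"
    by (rule sum.reindex_bij_witness[of _ "\<lambda>k. k + 1" "\<lambda>k. k - 1"]) (auto simp: add.commute of_nat_diff)
  then show ?thesis by (simp add: kernel_density_estimator_def)
qed

lemma fhat_measurable [measurable]: "fhat n j \<in> borel_measurable M"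
  unfolding fhat_eq_sum[abs_def] by measurable

lemma E_fhat: "n \<ge> 1 \<Longrightarrow> expectation (fhat n j) = kmean n j / b n"
  unfolding fhat_eq_sum[abs_def] using K_integrable b_pos[of n] by (simp add: kmean_shift)

lemma Sj_eq_fhat:
  assumes "n \<ge> 1"
  shows "Sj n j \<omega> = sqrt (real n * b n) * (fhat n j \<omega> - expectation (fhat n j))"
proof -
  have bn: "b n > 0" and n: "real n > 0" using b_pos[OF assms] assms by auto
  have "Sj n j \<omega> = ((\<Sum>k<n. K ((x j - X (int k + 1) \<omega>) / b n)) - real n * kmean n j) / (sqrt n * sqrt (b n))"
    unfolding Sj_def g_def by (simp add: sum_subtractf sum_divide_distrib[symmetric] mult.commute)
  also have "\<dots> = (sqrt n * sqrt (b n)) * (((\<Sum>k<n. K ((x j - X (int k + 1) \<omega>) / b n)) - real n * kmean n j) / ((sqrt n * sqrt (b n)) * (sqrt n * sqrt (b n))))"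
    using bn n by simp
  also have "(sqrt n * sqrt (b n)) * (sqrt n * sqrt (b n)) = real n * b n"
    using bn n by (simp add: mult.left_commute mult.assoc)
  also have "((\<Sum>k<n. K ((x j - X (int k + 1) \<omega>) / b n)) - real n * kmean n j) / (real n * b n) = fhat n j \<omega> - kmean n j / b n"
    unfolding fhat_eq_sum using n by (simp add: diff_divide_distrib)
  finally show ?thesis using E_fhat[OF assms] by (simp add: real_sqrt_mult)
qed

text \<open>The estimator relative to its target. The random denominator is the limiting one times
  the root of \<open>q\<close>, so \<open>q\<close> near 1 is all that Studentization asks
  for.\<close>

definition q :: "nat \<Rightarrow> 'm \<Rightarrow> 'a \<Rightarrow> real" where
  "q n j \<omega> = fhat n j \<omega> / f (x j)"

lemma q_measurable [measurable]: "q n j \<in> borel_measurable M"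
  unfolding q_def[abs_def] by measurable

lemma Sj_integrable: "integrable M (\<lambda>\<omega>. Sj n j \<omega>)"
  unfolding Sj_def by (intro integrable_divide_zero impI Bochner_Integration.integrable_sum g_integrable)

lemma Sj2_integrable: "integrable M (\<lambda>\<omega>. (Sj n j \<omega>)\<^sup>2)"
  unfolding Sj_def power2_eq_square times_divide_times_eq sum_product
  by (intro integrable_divide_zero impI Bochner_Integration.integrable_sum gg_integrable)

text \<open>The split into a random fluctuation, carrying the factor (n b)^(-1/2), and the
  deterministic bias of the estimator.\<close>

lemma q_eq:
  assumes "n \<ge> 1"
  shows "q n j \<omega> - 1 = Sj n j \<omega> / (sqrt (real n * b n) * f (x j)) + (kmean n j / b n / f (x j) - 1)"
proof -
  have "real n * b n > 0" using b_pos[OF assms] assms by simp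
  then have r: "sqrt (real n * b n) \<noteq> 0" using real_sqrt_gt_zero by fastforce
  have "Sj n j \<omega> / (sqrt (real n * b n) * f (x j)) = (fhat n j \<omega> - kmean n j / b n) / f (x j)"
    unfolding Sj_eq_fhat[OF assms] E_fhat[OF assms] by (rule nonzero_mult_divide_mult_cancel_left[OF r])
  then show ?thesis by (simp add: q_def diff_divide_distrib)
qed

lemma q_integrable: "n \<ge> 1 \<Longrightarrow> integrable M (\<lambda>\<omega>. q n j \<omega> - 1)"
  using Sj_integrable by (simp add: q_eq)

lemma q2_integrable: "n \<ge> 1 \<Longrightarrow> integrable M (\<lambda>\<omega>. (q n j \<omega> - 1)\<^sup>2)"
proof -
  have "integrable M (\<lambda>\<omega>. (c * Sj n j \<omega> + d)\<^sup>2)" for c d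
  proof -
    have "integrable M (\<lambda>\<omega>. c\<^sup>2 * (Sj n j \<omega>)\<^sup>2 + 2 * c * d * Sj n j \<omega> + d\<^sup>2)"
      using Sj_integrable Sj2_integrable by simp
    then show ?thesis by (simp add: power2_sum power_mult_distrib algebra_simps)
  qed
  from this[of "1 / (sqrt (real n * b n) * f (x j))" "kmean n j / b n / f (x j) - 1"]
  show "integrable M (\<lambda>\<omega>. (q n j \<omega> - 1)\<^sup>2)" if "n \<ge> 1" using that by (simp add: q_eq)
qed

text \<open>The fluctuation has a bounded second moment divided by n b, and the bias tends to 0 by
  \<open>kmean_lim\<close>; the L^2 consistency thus follows from the estimates made for the central
  limit theorem.\<close>

lemma q_lim: "(\<lambda>n. expectation (\<lambda>\<omega>. (q n j \<omega> - 1)\<^sup>2)) \<longlonglongrightarrow> 0"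
proof -
  obtain B where B: "\<forall>\<^sub>F n in sequentially. expectation (\<lambda>\<omega>. (Sj n j \<omega>)\<^sup>2) \<le> B"
    using S_second_moment unfolding Sj_eq_S by blast
  have "(\<lambda>n. 2 * (1 / (f (x j))\<^sup>2 * \<bar>B\<bar>) * (1 / (real n * b n)) + 2 * (kmean n j / b n / f (x j) - 1)\<^sup>2) \<longlonglongrightarrow>
      2 * (1 / (f (x j))\<^sup>2 * \<bar>B\<bar>) * 0 + 2 * (f (x j) / f (x j) - 1)\<^sup>2"
    using f_pos[of j] by (intro tendsto_intros inverse_nb_lim kmean_lim) auto
  then have lim: "(\<lambda>n. 2 * (1 / (f (x j))\<^sup>2 * \<bar>B\<bar>) * (1 / (real n * b n)) + 2 * (kmean n j / b n / f (x j) - 1)\<^sup>2) \<longlonglongrightarrow> 0"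
    using f_pos[of j] by simp
  show ?thesis
  proof (rule tendsto_sandwich[OF _ _ tendsto_const lim])
    show "\<forall>\<^sub>F n in sequentially. expectation (\<lambda>\<omega>. (q n j \<omega> - 1)\<^sup>2) \<le>
       2 * (1 / (f (x j))\<^sup>2 * \<bar>B\<bar>) * (1 / (real n * b n)) + 2 * (kmean n j / b n / f (x j) - 1)\<^sup>2"
      using B b_pos_eventually
    proof eventually_elim
      case (elim n)
      then have n: "n \<ge> 1" and nb: "real n * b n > 0" by auto
      let ?\<beta> = "kmean n j / b n / f (x j) - 1" and ?c = "1 / (f (x j))\<^sup>2 * (1 / (real n * b n))"
      have "expectation (\<lambda>\<omega>. (q n j \<omega> - 1)\<^sup>2) \<le> expectation (\<lambda>\<omega>. 2 * (?c * (Sj n j \<omega>)\<^sup>2) + 2 * ?\<beta>\<^sup>2)"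
      proof (rule integral_mono)
        fix \<omega>
        have "(u + v)\<^sup>2 \<le> 2 * u\<^sup>2 + 2 * v\<^sup>2" for u v :: real
          using zero_le_power2[of "u - v"] by (simp add: power2_eq_square algebra_simps)
        from this[of "Sj n j \<omega> / (sqrt (real n * b n) * f (x j))" ?\<beta>]
        have "(q n j \<omega> - 1)\<^sup>2 \<le> 2 * (Sj n j \<omega> / (sqrt (real n * b n) * f (x j)))\<^sup>2 + 2 * ?\<beta>\<^sup>2"
          by (simp only: q_eq[OF n])
        also have "(Sj n j \<omega> / (sqrt (real n * b n) * f (x j)))\<^sup>2 = ?c * (Sj n j \<omega>)\<^sup>2"
          using nb by (simp add: power_divide power_mult_distrib mult.commute)
        finally show "(q n j \<omega> - 1)\<^sup>2 \<le> 2 * (?c * (Sj n j \<omega>)\<^sup>2) + 2 * ?\<beta>\<^sup>2" .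
      qed (use q2_integrable[OF n] Sj2_integrable in auto)
      also have "\<dots> = 2 * (?c * expectation (\<lambda>\<omega>. (Sj n j \<omega>)\<^sup>2)) + 2 * ?\<beta>\<^sup>2"
        using Sj2_integrable by (simp add: prob_space)
      also have "\<dots> \<le> 2 * (?c * \<bar>B\<bar>) + 2 * ?\<beta>\<^sup>2"
        using elim(1) nb by (intro add_right_mono mult_left_mono) auto
      finally show ?case by (simp add: mult_ac)
    qed
  qed simp
qed

abbreviation stud :: "real \<Rightarrow> nat \<Rightarrow> 'm \<Rightarrow> 'a \<Rightarrow> real" where
  "stud c n j \<omega> \<equiv> sqrt (real n * b n) * studentized_estimator c M K b X n (x j) \<omega>"

text \<open>The factor 4 makes the bound trivial when some estimator is off by more than half, in
  particular where it vanishes.\<close>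

lemma studentized_cis_bound:
  fixes c :: real and t :: "'m \<Rightarrow> real"
  assumes n: "n \<ge> 1"
  defines "\<sigma> \<equiv> \<lambda>j. sqrt (f (x j) * K_sq)"
  shows "cmod (cis (\<Sum>j\<in>UNIV. t j * stud c n j \<omega>) - cis (S (\<lambda>j. t j / \<sigma> j) n \<omega>))
     \<le> (\<Sum>j\<in>UNIV. \<bar>t j / \<sigma> j\<bar> * \<bar>Sj n j \<omega> * (q n j \<omega> - 1)\<bar> + 4 * \<bar>q n j \<omega> - 1\<bar>)"
proof (cases "\<forall>j. \<bar>q n j \<omega> - 1\<bar> \<le> 1 / 2")
  case True
  have "cmod (cis (\<Sum>j\<in>UNIV. t j * stud c n j \<omega>) - cis (S (\<lambda>j. t j / \<sigma> j) n \<omega>))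
     \<le> \<bar>(\<Sum>j\<in>UNIV. t j * stud c n j \<omega>) - S (\<lambda>j. t j / \<sigma> j) n \<omega>\<bar>"
    by (rule cmod_cis_diff_le)
  also have "\<dots> = \<bar>\<Sum>j\<in>UNIV. t j * stud c n j \<omega> - t j / \<sigma> j * Sj n j \<omega>\<bar>"
    by (simp add: S_eq_sum sum_subtractf)
  also have "\<dots> \<le> (\<Sum>j\<in>UNIV. \<bar>t j * stud c n j \<omega> - t j / \<sigma> j * Sj n j \<omega>\<bar>)"
    by (rule sum_abs)
  also have "\<dots> \<le> (\<Sum>j\<in>UNIV. \<bar>t j / \<sigma> j\<bar> * \<bar>Sj n j \<omega> * (q n j \<omega> - 1)\<bar> + 4 * \<bar>q n j \<omega> - 1\<bar>)"
  proof (rule sum_mono)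
    fix j
    have q: "q n j \<omega> \<ge> 1 / 2" using True[rule_format, of j] by linarith
    \<comment> \<open>In this case the estimator is positive, so the default value \<open>c\<close>
      does not enter.\<close>
    then have fh: "fhat n j \<omega> \<noteq> 0" by (auto simp: q_def)
    have qf: "fhat n j \<omega> = q n j \<omega> * f (x j)" using f_pos[of j] by (simp add: q_def)
    have "sqrt (real n * b n) * studentized_estimator c M K b X n (x j) \<omega> = Sj n j \<omega> / sqrt (fhat n j \<omega> * K_sq)"
      using fh by (simp add: studentized_estimator_def Let_def K_sq_def Sj_eq_fhat[OF n])
    also have "\<dots> = Sj n j \<omega> / \<sigma> j * (1 / sqrt (q n j \<omega>))"
      unfolding qf \<sigma>_def by (simp add: real_sqrt_mult mult_ac)
    finally have "t j * stud c n j \<omega> - t j / \<sigma> j * Sj n j \<omega>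
       = t j / \<sigma> j * Sj n j \<omega> * (1 / sqrt (q n j \<omega>) - 1)"
      by (simp add: right_diff_distrib)
    then have "\<bar>t j * stud c n j \<omega> - t j / \<sigma> j * Sj n j \<omega>\<bar>
       = \<bar>t j / \<sigma> j * Sj n j \<omega>\<bar> * \<bar>1 / sqrt (q n j \<omega>) - 1\<bar>"
      by (simp only: abs_mult)
    also have "\<dots> \<le> \<bar>t j / \<sigma> j * Sj n j \<omega>\<bar> * \<bar>q n j \<omega> - 1\<bar>"
      by (intro mult_left_mono abs_inverse_sqrt_minus_1_le q) simp
    also have "\<bar>t j / \<sigma> j * Sj n j \<omega>\<bar> * \<bar>q n j \<omega> - 1\<bar> = \<bar>t j / \<sigma> j\<bar> * \<bar>Sj n j \<omega> * (q n j \<omega> - 1)\<bar>"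
      by (simp only: abs_mult mult.assoc)
    finally have *: "\<bar>t j * stud c n j \<omega> - t j / \<sigma> j * Sj n j \<omega>\<bar>
       \<le> \<bar>t j / \<sigma> j\<bar> * \<bar>Sj n j \<omega> * (q n j \<omega> - 1)\<bar>" .
    show "\<bar>t j * stud c n j \<omega> - t j / \<sigma> j * Sj n j \<omega>\<bar>
       \<le> \<bar>t j / \<sigma> j\<bar> * \<bar>Sj n j \<omega> * (q n j \<omega> - 1)\<bar> + 4 * \<bar>q n j \<omega> - 1\<bar>"
      by (rule add_increasing2[OF _ *]) simp
  qed
  finally show ?thesis .
next
  case False
  then obtain i where i: "\<bar>q n i \<omega> - 1\<bar> > 1 / 2" by (auto simp: not_le)
  have "cmod (cis a - cis d) \<le> 2" for a d
    using norm_triangle_ineq4[of "cis a" "cis d"] by simp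
  then have "cmod (cis (\<Sum>j\<in>UNIV. t j * stud c n j \<omega>) - cis (S (\<lambda>j. t j / \<sigma> j) n \<omega>)) \<le> 2" .
  also have "2 \<le> \<bar>t i / \<sigma> i\<bar> * \<bar>Sj n i \<omega> * (q n i \<omega> - 1)\<bar> + 4 * \<bar>q n i \<omega> - 1\<bar>"
    using i by (intro add_increasing mult_nonneg_nonneg) auto
  also have "\<dots> \<le> (\<Sum>j\<in>UNIV. \<bar>t j / \<sigma> j\<bar> * \<bar>Sj n j \<omega> * (q n j \<omega> - 1)\<bar> + 4 * \<bar>q n j \<omega> - 1\<bar>)"
    by (rule member_le_sum) auto
  finally show ?thesis .
qed

lemma studentized_measurable [measurable]:
  "studentized_estimator c M K b X n (x j) \<in> borel_measurable M"
proof -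
  have "(\<lambda>\<omega>. if fhat n j \<omega> = 0 then c else (fhat n j \<omega> - expectation (fhat n j)) / sqrt (fhat n j \<omega> * (\<integral>u. (K u)\<^sup>2 \<partial>lborel)))
      \<in> borel_measurable M"
    by measurable
  then show ?thesis by (simp add: studentized_estimator_def[abs_def] Let_def)
qed

text \<open>A Slutsky argument in L^1. Dividing the coefficients by \<open>\<sigma> j\<close> turns
  \<open>asy_var\<close> into the plain sum of squares, so the sum with deterministic denominators
  has the right limit. The pointwise bound is then integrated, and Cauchy-Schwarz makes the product
  of \<open>Sj\<close> and q - 1 a bounded factor times a vanishing one.\<close>

lemma studentized_char_lim:
  fixes c :: real and t :: "'m \<Rightarrow> real"
  shows "(\<lambda>n. expectation (\<lambda>\<omega>. cis (\<Sum>j\<in>UNIV. t j * stud c n j \<omega>)))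
     \<longlonglongrightarrow> of_real (exp (- (\<Sum>j\<in>UNIV. (t j)\<^sup>2) / 2))"
proof -
  define \<sigma> where "\<sigma> j = sqrt (f (x j) * K_sq)" for j
  let ?Y = "\<lambda>n \<omega>. \<Sum>j\<in>UNIV. t j * stud c n j \<omega>"
  let ?Z = "\<lambda>n. S (\<lambda>j. t j / \<sigma> j) n"
  have \<sigma>2: "(\<sigma> j)\<^sup>2 = f (x j) * K_sq" "\<sigma> j > 0" for j
    using f_pos[of j] K_sq_pos by (simp_all add: \<sigma>_def)
  have "asy_var (\<lambda>j. t j / \<sigma> j) = (\<Sum>j\<in>UNIV. (t j)\<^sup>2)"
    unfolding asy_var_def power_divide \<sigma>2 using f_pos K_sq_pos
    by (intro sum.cong refl) (auto simp: less_imp_neq[symmetric])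
  then have Zlim: "(\<lambda>n. expectation (\<lambda>\<omega>. cis (?Z n \<omega>))) \<longlonglongrightarrow> of_real (exp (- (\<Sum>j\<in>UNIV. (t j)\<^sup>2) / 2))"
    using S_char_lim[of "\<lambda>j. t j / \<sigma> j"] by simp
  have "\<forall>j. \<exists>B. \<forall>\<^sub>F n in sequentially. expectation (\<lambda>\<omega>. (Sj n j \<omega>)\<^sup>2) \<le> B"
    using S_second_moment unfolding Sj_eq_S by blast
  then obtain B where B: "\<And>j. \<forall>\<^sub>F n in sequentially. expectation (\<lambda>\<omega>. (Sj n j \<omega>)\<^sup>2) \<le> B j"
    unfolding choice_iff by blast
  define Q where "Q n j = sqrt (expectation (\<lambda>\<omega>. (q n j \<omega> - 1)\<^sup>2))" for n j
  have Qlim: "(\<lambda>n. Q n j) \<longlonglongrightarrow> 0" for j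
    using tendsto_real_sqrt[OF q_lim[of j]] by (simp add: Q_def)
  have lim: "(\<lambda>n. \<Sum>j\<in>UNIV. \<bar>t j / \<sigma> j\<bar> * (sqrt \<bar>B j\<bar> * Q n j) + 4 * Q n j) \<longlonglongrightarrow> 0"
    by (rule tendsto_eq_intros Qlim refl | simp)+
  have "\<forall>\<^sub>F n in sequentially. \<forall>j\<in>UNIV. expectation (\<lambda>\<omega>. (Sj n j \<omega>)\<^sup>2) \<le> B j"
    using B by (intro eventually_ball_finite ballI) auto
  then have "\<forall>\<^sub>F n in sequentially. norm (expectation (\<lambda>\<omega>. cis (?Y n \<omega>)) - expectation (\<lambda>\<omega>. cis (?Z n \<omega>)))
     \<le> (\<Sum>j\<in>UNIV. \<bar>t j / \<sigma> j\<bar> * (sqrt \<bar>B j\<bar> * Q n j) + 4 * Q n j)"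
    using eventually_ge_at_top[of 1]
  proof eventually_elim
    case (elim n)
    have icis: "integrable M (\<lambda>\<omega>. cis (h \<omega>))" if [measurable]: "h \<in> borel_measurable M" for h
      by (rule integrable_const_bound[of _ 1]) auto
    have iSq: "integrable M (\<lambda>\<omega>. Sj n j \<omega> * (q n j \<omega> - 1))" for j
    proof -
      have uv: "\<bar>u * v\<bar> \<le> \<bar>u\<^sup>2 + v\<^sup>2\<bar>" for u v :: real
      proof -
        have "0 \<le> (\<bar>u\<bar> - \<bar>v\<bar>)\<^sup>2" by simp
        then have "2 * \<bar>u * v\<bar> \<le> u\<^sup>2 + v\<^sup>2" by (simp add: power2_diff abs_mult)
        then show ?thesis using abs_ge_zero[of "u * v"] by linarith
      qed
      have "integrable M (\<lambda>\<omega>. (Sj n j \<omega>)\<^sup>2 + (q n j \<omega> - 1)\<^sup>2)"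
        using Sj2_integrable q2_integrable[OF elim(2)] by (rule Bochner_Integration.integrable_add)
      then show ?thesis
      proof (rule Bochner_Integration.integrable_bound)
        show "AE \<omega> in M. norm (Sj n j \<omega> * (q n j \<omega> - 1)) \<le> norm ((Sj n j \<omega>)\<^sup>2 + (q n j \<omega> - 1)\<^sup>2)"
          unfolding real_norm_def by (intro AE_I2 uv)
      qed measurable
    qed
    have "norm (expectation (\<lambda>\<omega>. cis (?Y n \<omega>)) - expectation (\<lambda>\<omega>. cis (?Z n \<omega>)))
       = norm (expectation (\<lambda>\<omega>. cis (?Y n \<omega>) - cis (?Z n \<omega>)))"
      by (subst Bochner_Integration.integral_diff) (auto intro!: icis)
    also have "\<dots> \<le> expectation (\<lambda>\<omega>. cmod (cis (?Y n \<omega>) - cis (?Z n \<omega>)))"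
      by (rule integral_norm_bound)
    also have "\<dots> \<le> expectation (\<lambda>\<omega>. \<Sum>j\<in>UNIV. \<bar>t j / \<sigma> j\<bar> * \<bar>Sj n j \<omega> * (q n j \<omega> - 1)\<bar> + 4 * \<bar>q n j \<omega> - 1\<bar>)"
    proof (rule integral_mono)
      show "integrable M (\<lambda>\<omega>. cmod (cis (?Y n \<omega>) - cis (?Z n \<omega>)))"
        by (intro integrable_norm Bochner_Integration.integrable_diff icis) measurable
      show "integrable M (\<lambda>\<omega>. \<Sum>j\<in>UNIV. \<bar>t j / \<sigma> j\<bar> * \<bar>Sj n j \<omega> * (q n j \<omega> - 1)\<bar> + 4 * \<bar>q n j \<omega> - 1\<bar>)"
        using iSq q_integrable[OF elim(2)] by simp
    qed (use studentized_cis_bound[OF elim(2)] in \<open>simp add: \<sigma>_def\<close>)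
    also have "\<dots> = (\<Sum>j\<in>UNIV. \<bar>t j / \<sigma> j\<bar> * expectation (\<lambda>\<omega>. \<bar>Sj n j \<omega> * (q n j \<omega> - 1)\<bar>) + 4 * expectation (\<lambda>\<omega>. \<bar>q n j \<omega> - 1\<bar>))"
      using iSq q_integrable[OF elim(2)] by (subst Bochner_Integration.integral_sum) auto
    also have "\<dots> \<le> (\<Sum>j\<in>UNIV. \<bar>t j / \<sigma> j\<bar> * (sqrt \<bar>B j\<bar> * Q n j) + 4 * Q n j)"
    proof (intro sum_mono add_mono mult_left_mono)
      fix j
      have "expectation (\<lambda>\<omega>. \<bar>Sj n j \<omega> * (q n j \<omega> - 1)\<bar>) \<le> sqrt (expectation (\<lambda>\<omega>. (Sj n j \<omega>)\<^sup>2)) * Q n j"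
        unfolding Q_def by (rule expectation_cauchy_schwarz[OF Sj2_integrable q2_integrable[OF elim(2)] iSq])
      also have "\<dots> \<le> sqrt \<bar>B j\<bar> * Q n j"
        using elim(1) by (intro mult_right_mono real_sqrt_le_mono) (auto simp: Q_def intro: order_trans)
      finally show "expectation (\<lambda>\<omega>. \<bar>Sj n j \<omega> * (q n j \<omega> - 1)\<bar>) \<le> sqrt \<bar>B j\<bar> * Q n j" .
      show "expectation (\<lambda>\<omega>. \<bar>q n j \<omega> - 1\<bar>) \<le> Q n j"
        unfolding Q_def by (rule expectation_abs_le_sqrt[OF q_integrable[OF elim(2)] q2_integrable[OF elim(2)]])
    qed auto
    finally show ?case .
  qed
  from tendsto_add[OF Lim_null_comparison[OF this lim] Zlim] show ?thesis by simp
qed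

end

section \<open>The joint limit\<close>

lemma multivariate_normal_standard:
  "multivariate_normal 0 (mat 1 :: real^'m^'m) = gauss_measure"
proof -
  \<comment> \<open>\<open>matrix_inv\<close> is a Hilbert choice among two-sided inverses; the unit
    law leaves a single candidate.\<close>
  have inv: "matrix_inv (mat 1 :: real^'m^'m) = mat 1"
    unfolding matrix_inv_def by (rule some_equality) (simp_all add: matrix_mul_lid)
  show ?thesis
    unfolding multivariate_normal_def gauss_measure_def gauss_density_def inv
    by (simp add: power2_norm_eq_inner)
qed

theorem theorem1:
  fixes M :: "'a measure"
    and X :: "int \<Rightarrow> 'a \<Rightarrow> real"
    and f :: "real \<Rightarrow> real" and f2 :: "real \<times> real \<Rightarrow> real"
    and l K :: "real \<Rightarrow> real" and b :: "nat \<Rightarrow> real"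
    and x :: "'m::finite \<Rightarrow> real"
    and c :: real
  assumes "prob_space M"
    and "stationary_process M X" and "markov_chain M X" and "reversible M X"
    and "\<And>t. f t \<ge> 0" and "distributed M lborel (X 0) (\<lambda>t. ennreal (f t))"
    and "\<And>t. t > 0 \<Longrightarrow> l t > 0" and "mono_on {0<..} l"
    and "filterlim l at_top at_top" and "slowly_varying l"
    and "\<And>k. k \<ge> 1 \<Longrightarrow> eta_coeff M X k \<le> ennreal (1 / (real k ^ 4 * l (real k)))"
    and "\<And>n. n \<ge> 1 \<Longrightarrow> b n > 0" and "b \<longlonglongrightarrow> 0"
    and "filterlim (\<lambda>n. real n * b n ^ 4) at_top sequentially"
    and "\<And>u. K u \<ge> 0" and "\<And>u. K (- u) = K u" and "antimono_on {0<..} K"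
    and "integrable lborel K" and "(\<integral>u. K u \<partial>lborel) = 1"
    and "((\<lambda>u. u\<^sup>2 * K u) \<longlongrightarrow> 0) at_top"
    and "\<And>u. K field_differentiable (at u)" and "bounded (range (deriv K))"
    and "inj x"
    and "\<And>j. isCont f (x j)" and "\<And>j. f (x j) \<noteq> 0"
    and "\<And>p. f2 p \<ge> 0"
    and "distributed M (lborel \<Otimes>\<^sub>M lborel) (\<lambda>\<omega>. (X 0 \<omega>, X 2 \<omega>)) (\<lambda>p. ennreal (f2 p))"
    and "\<And>i j. \<exists>r>0. \<exists>C. \<forall>s t. \<bar>s\<bar> < r \<and> \<bar>t\<bar> < r \<longrightarrow> \<bar>f2 (x i + s, x j + t)\<bar> < C"
  shows "converges_in_distribution M
     (\<lambda>n \<omega>. \<chi> j. sqrt (real n * b n) * studentized_estimator c M K b X n (x j) \<omega>)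
     (multivariate_normal 0 (mat 1 :: real^'m^'m))"
proof -
  interpret prob_space M by fact
  interpret kernel_estimation M X f f2 l K b x
    using assms by unfold_locales
  define Y :: "nat \<Rightarrow> 'a \<Rightarrow> real^'m" where
    "Y n \<omega> = (\<chi> j. sqrt (real n * b n) * studentized_estimator c M K b X n (x j) \<omega>)" for n \<omega>
  have inner: "t \<bullet> Y n \<omega> = (\<Sum>j\<in>UNIV. t $ j * (sqrt (real n * b n) * studentized_estimator c M K b X n (x j) \<omega>))" for t n \<omega>
    by (simp add: inner_vec_def Y_def)
  have Ym[measurable]: "Y n \<in> borel_measurable M" for n
  proof (subst borel_measurable_euclidean_space, intro ballI)
    fix i :: "real^'m"
    have "(\<lambda>\<omega>. \<Sum>j\<in>UNIV. i $ j * (sqrt (real n * b n) * studentized_estimator c M K b X n (x j) \<omega>)) \<in> borel_measurable M"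
      by measurable
    then show "(\<lambda>\<omega>. Y n \<omega> \<bullet> i) \<in> borel_measurable M"
      by (simp only: inner_commute[of _ i] inner)
  qed
  \<comment> \<open>The characteristic function at \<open>t\<close> is that of a scalar combination
    of the coordinates, so the one-dimensional limits for all \<open>t\<close> give exactly the
    hypothesis of the continuity theorem.\<close>
  have char: "(\<lambda>n. \<integral>y. cis (t \<bullet> y) \<partial>distr M borel (Y n)) \<longlonglongrightarrow> of_real (exp (- (norm t)\<^sup>2 / 2))" for t :: "real^'m"
  proof -
    have "(\<integral>y. cis (t \<bullet> y) \<partial>distr M borel (Y n)) = expectation (\<lambda>\<omega>. cis (t \<bullet> Y n \<omega>))" for n
      by (rule integral_distr) measurable
    moreover have "(norm t)\<^sup>2 = (\<Sum>j\<in>UNIV. (t $ j)\<^sup>2)"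
      unfolding power2_norm_eq_inner inner_vec_def by (simp add: power2_eq_square)
    ultimately show ?thesis
      using studentized_char_lim[of "\<lambda>j. t $ j" c] by (simp add: inner)
  qed
  have "(\<lambda>n. \<integral>z. h z \<partial>distr M borel (Y n)) \<longlonglongrightarrow> (\<integral>z. h z \<partial>gauss_measure)"
    if cont: "continuous_on UNIV h" and bdd: "bounded (range h)" for h :: "real^'m \<Rightarrow> real"
  proof -
    obtain B where B: "\<And>z. \<bar>h z\<bar> \<le> B" using bdd by (auto simp: bounded_iff)
    show ?thesis
      by (rule levy_continuity_gauss[OF prob_space_distr[OF Ym] sets_distr char cont B])
  qed
  then have "converges_in_distribution M Y gauss_measure"
    unfolding converges_in_distribution_def using Ym by blast
  then show ?thesis unfolding multivariate_normal_standard Y_def[abs_def] .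
qed

end
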